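(* Let $X$ be an integral Noetherian normal scheme. Then the factor group $\mathrm{Div}_{\mathrm{Weil}}(X)/\mathrm{Div}_{\mathrm{Cart}}(X)$ of the group of Weil divisors modulo the group of Cartier divisors on $X$ is a subgroup, via the canonical homomorphism, of the projective limit $$\varprojlim_{x \in X} \mathrm{Cl}(\mathcal{O}_{X,x})$$ of the divisor class groups of the local rings of $X$. That is, the homomorphism $\mathrm{Div}_{\mathrm{Weil}}(X)/\mathrm{Div}_{\mathrm{Cart}}(X)\to \varprojlim_{x\in X}\mathrm{Cl}(\mathcal{O}_{X,x})$ induced by the maps $\mathrm{Div}_{\mathrm{Weil}}(X)\to \mathrm{Cl}(\mathcal{O}_{X,x})$ is injective.
   Context: $X$ is not assumed to be separated. $\mathrm{Div}_{\mathrm{Weil}}(X)$ is the free abelian group on the integral closed subschemes of codimension one (equivalently, on the points $\xi\in X$ with $\dim \mathcal{O}_{X,\xi}=1$). The group $\mathrm{Div}_{\mathrm{Cart}}(X)$ of Cartier divisors is identified with the subgroup of those Weil divisors that are locally principal. For a Noetherian normal domain $B$, $\mathrm{Cl}(B)$ denotes its divisor class group (nonzero divisorial fractional ideals modulo nonzero principal fractional ideals), which is also the group of Weil divisors of $\mathrm{Spec}(B)$ modulo principal divisors. For $x\in X$, the map $\mathrm{Div}_{\mathrm{Weil}}(X)\to\mathrm{Cl}(\mathcal{O}_{X,x})$ sends a Weil divisor to the class of its restriction to $\mathrm{Spec}(\mathcal{O}_{X,x})$ (keep only the prime divisors passing through $x$). If $y$ is a generization of $x$ (i.e. $x\in\overline{\{y\}}$),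 then $\mathcal{O}_{X,y}$ is a localization of $\mathcal{O}_{X,x}$ at a prime ideal, and there is a homomorphism $\mathrm{Cl}(\mathcal{O}_{X,x})\to\mathrm{Cl}(\mathcal{O}_{X,y})$, $[I]\mapsto[I\mathcal{O}_{X,y}]$. The projective limit is taken with respect to these maps and is regarded as the subgroup of compatible families in $\prod_{x}\mathrm{Cl}(\mathcal{O}_{X,x})$. *)

theory Defs
  imports
    "HOL-Algebra.Algebra"
    "HOL-Analysis.Abstract_Topology"
    "HOL-Library.Extended_Nat"
begin

section \<open>Commutative algebra\<close>

subsection \<open>Localization\<close>

definition fraction :: "'a ring \<Rightarrow> 'a set \<Rightarrow> 'a \<Rightarrow> 'a \<Rightarrow> ('a \<times> 'a) set" where
  "fraction A S a s =
     {(b, t). b \<in> carrier A \<and> t \<in> S \<and>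
              (\<exists>u\<in>S. u \<otimes>\<^bsub>A\<^esub> (a \<otimes>\<^bsub>A\<^esub> t) = u \<otimes>\<^bsub>A\<^esub> (b \<otimes>\<^bsub>A\<^esub> s))}"

text \<open>For a multiplicative set \<open>S\<close>; the unions run over all representatives, all of which give
  the same fraction.\<close>

definition localization :: "'a ring \<Rightarrow> 'a set \<Rightarrow> ('a \<times> 'a) set ring" where
  "localization A S =
     \<lparr>carrier = {fraction A S a s | a s. a \<in> carrier A \<and> s \<in> S},
      monoid.mult = (\<lambda>P Q. \<Union>(a, s)\<in>P. \<Union>(b, t)\<in>Q. fraction A S (a \<otimes>\<^bsub>A\<^esub> b) (s \<otimes>\<^bsub>A\<^esub> t)),
      monoid.one = fraction A S \<one>\<^bsub>A\<^esub> \<one>\<^bsub>A\<^esub>,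
      ring.zero = fraction A S \<zero>\<^bsub>A\<^esub> \<one>\<^bsub>A\<^esub>,
      ring.add = (\<lambda>P Q. \<Union>(a, s)\<in>P. \<Union>(b, t)\<in>Q.
               fraction A S ((a \<otimes>\<^bsub>A\<^esub> t) \<oplus>\<^bsub>A\<^esub> (b \<otimes>\<^bsub>A\<^esub> s)) (s \<otimes>\<^bsub>A\<^esub> t))\<rparr>"

abbreviation localization_at :: "'a ring \<Rightarrow> 'a set \<Rightarrow> ('a \<times> 'a) set ring" where
  "localization_at A p \<equiv> localization A (carrier A - p)"

abbreviation nonzero_elements :: "'a ring \<Rightarrow> 'a set" where
  "nonzero_elements A \<equiv> carrier A - {\<zero>\<^bsub>A\<^esub>}"

abbreviation fraction_field :: "'a ring \<Rightarrow> ('a \<times> 'a) set ring" where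
  "fraction_field A \<equiv> localization A (nonzero_elements A)"

subsection \<open>Local rings, dimension, integral closedness\<close>

definition is_local_ring :: "'a ring \<Rightarrow> bool" where
  "is_local_ring A \<longleftrightarrow> cring A \<and> (\<exists>!m. maximalideal m A)"

text \<open>The zero ring gets dimension 0 here.\<close>

definition krull_dim :: "'a ring \<Rightarrow> enat" where
  "krull_dim A =
     Sup {enat n | n. \<exists>p. (\<forall>i\<le>n. primeideal (p i) A) \<and> (\<forall>i<n. p i \<subset> p (Suc i))}"

definition integrally_closed_domain :: "'a ring \<Rightarrow> bool" where
  "integrally_closed_domain A \<longleftrightarrow> domain A \<and>
     (let F = fraction_field A; \<iota> = (\<lambda>a. fraction A (nonzero_elements A) a \<one>\<^bsub>A\<^esub>) in
      \<forall>z\<in>carrier F.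
        (\<exists>(n::nat) c. (\<forall>i<n. c i \<in> carrier A) \<and>
           (z [^]\<^bsub>F\<^esub> n) \<oplus>\<^bsub>F\<^esub> (\<Oplus>\<^bsub>F\<^esub>i\<in>{..<n}. \<iota> (c i) \<otimes>\<^bsub>F\<^esub> (z [^]\<^bsub>F\<^esub> i)) = \<zero>\<^bsub>F\<^esub>)
        \<longrightarrow> z \<in> \<iota> ` carrier A)"

subsection \<open>The divisor class group\<close>

text \<open>Throughout, \<open>B\<close> is a subring of a field \<open>L\<close> such that \<open>L\<close> is the field of fractions
  of \<open>B\<close>.\<close>

definition is_submodule :: "'a ring \<Rightarrow> 'a set \<Rightarrow> 'a set \<Rightarrow> bool" where
  "is_submodule L B M \<longleftrightarrow> additive_subgroup M L \<and> (\<forall>b\<in>B. \<forall>m\<in>M. b \<otimes>\<^bsub>L\<^esub> m \<in> M)"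

definition generated_submodule :: "'a ring \<Rightarrow> 'a set \<Rightarrow> 'a set \<Rightarrow> 'a set" where
  "generated_submodule L B S = \<Inter>{M. is_submodule L B M \<and> S \<subseteq> M}"

definition fractional_ideal :: "'a ring \<Rightarrow> 'a set \<Rightarrow> 'a set \<Rightarrow> bool" where
  "fractional_ideal L B I \<longleftrightarrow> is_submodule L B I \<and>
     (\<exists>d\<in>B. d \<noteq> \<zero>\<^bsub>L\<^esub> \<and> (\<forall>i\<in>I. d \<otimes>\<^bsub>L\<^esub> i \<in> B))"

definition colon :: "'a ring \<Rightarrow> 'a set \<Rightarrow> 'a set \<Rightarrow> 'a set" where
  "colon L I J = {z \<in> carrier L. \<forall>j\<in>J. z \<otimes>\<^bsub>L\<^esub> j \<in> I}"

definition divisorial_hull :: "'a ring \<Rightarrow> 'a set \<Rightarrow> 'a set \<Rightarrow> 'a set" where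
  "divisorial_hull L B I = colon L B (colon L B I)"

definition divisorial_group :: "'a ring \<Rightarrow> 'a set \<Rightarrow> 'a set monoid" where
  "divisorial_group L B =
     \<lparr>carrier = {I. fractional_ideal L B I \<and> I \<noteq> {\<zero>\<^bsub>L\<^esub>} \<and> divisorial_hull L B I = I},
      monoid.mult = (\<lambda>I J. divisorial_hull L B (generated_submodule L B (I <#>\<^bsub>L\<^esub> J))),
      monoid.one = B\<rparr>"

definition principal_fractional_ideals :: "'a ring \<Rightarrow> 'a set \<Rightarrow> 'a set set" where
  "principal_fractional_ideals L B =
     {(\<lambda>b. f \<otimes>\<^bsub>L\<^esub> b) ` B | f. f \<in> carrier L \<and> f \<noteq> \<zero>\<^bsub>L\<^esub>}"

definition class_group :: "'a ring \<Rightarrow> 'a set \<Rightarrow> 'a set set monoid" where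
  "class_group L B = divisorial_group L B Mod principal_fractional_ideals L B"

definition ideal_class :: "'a ring \<Rightarrow> 'a set \<Rightarrow> 'a set \<Rightarrow> 'a set set" where
  "ideal_class L B I = principal_fractional_ideals L B #>\<^bsub>divisorial_group L B\<^esub> I"

text \<open>The normalized valuation of \<open>L\<close> whose valuation ring is the discrete valuation ring \<open>B\<close>:
  \<open>\<pi>\<close> is a uniformizer, as the maximal ideal of a local ring is its set of non-units.\<close>

definition dvr_valuation :: "'a ring \<Rightarrow> 'a set \<Rightarrow> 'a \<Rightarrow> int" where
  "dvr_valuation L B f =
     (let R = L\<lparr>carrier := B\<rparr> in
      THE n. \<exists>\<pi>\<in>B. \<exists>u\<in>Units R. B - Units R = PIdl\<^bsub>R\<^esub> \<pi> \<and> f = u \<otimes>\<^bsub>L\<^esub> (\<pi> [^]\<^bsub>L\<^esub> n))"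


section \<open>Schemes\<close>

subsection \<open>Ringed spaces\<close>

text \<open>Sections and restriction maps are only meaningful on open sets; \<open>res \<S> U V\<close> restricts from
  \<open>U\<close> to \<open>V \<subseteq> U\<close>.\<close>

record ('p, 'r) ringed_space =
  topo :: "'p topology"
  sect :: "'p set \<Rightarrow> 'r ring"
  res :: "'p set \<Rightarrow> 'p set \<Rightarrow> 'r \<Rightarrow> 'r"

abbreviation points :: "('p, 'r) ringed_space \<Rightarrow> 'p set" where
  "points \<S> \<equiv> topspace (topo \<S>)"

locale is_ringed_space =
  fixes \<S> :: "('p, 'r) ringed_space"
  assumes sect_cring: "openin (topo \<S>) U \<Longrightarrow> cring (sect \<S> U)"
    and res_hom: "\<lbrakk>openin (topo \<S>) U; openin (topo \<S>) V; V \<subseteq> U\<rbrakk>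
      \<Longrightarrow> res \<S> U V \<in> ring_hom (sect \<S> U) (sect \<S> V)"
    and res_id: "\<lbrakk>openin (topo \<S>) U; s \<in> carrier (sect \<S> U)\<rbrakk> \<Longrightarrow> res \<S> U U s = s"
    and res_trans: "\<lbrakk>openin (topo \<S>) U; openin (topo \<S>) V; openin (topo \<S>) W; W \<subseteq> V; V \<subseteq> U;
        s \<in> carrier (sect \<S> U)\<rbrakk> \<Longrightarrow> res \<S> V W (res \<S> U V s) = res \<S> U W s"
    and locality: "\<lbrakk>\<And>V. V \<in> \<V> \<Longrightarrow> openin (topo \<S>) V;
        s \<in> carrier (sect \<S> (\<Union>\<V>)); t \<in> carrier (sect \<S> (\<Union>\<V>));
        \<And>V. V \<in> \<V> \<Longrightarrow> res \<S> (\<Union>\<V>) V s = res \<S> (\<Union>\<V>) V t\<rbrakk> \<Longrightarrow> s = t"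
    and gluing: "\<lbrakk>\<And>V. V \<in> \<V> \<Longrightarrow> openin (topo \<S>) V;
        \<And>V. V \<in> \<V> \<Longrightarrow> \<sigma> V \<in> carrier (sect \<S> V);
        \<And>V W. \<lbrakk>V \<in> \<V>; W \<in> \<V>\<rbrakk> \<Longrightarrow> res \<S> V (V \<inter> W) (\<sigma> V) = res \<S> W (V \<inter> W) (\<sigma> W)\<rbrakk>
      \<Longrightarrow> \<exists>s\<in>carrier (sect \<S> (\<Union>\<V>)). \<forall>V\<in>\<V>. res \<S> (\<Union>\<V>) V s = \<sigma> V"

definition open_subspace :: "('p, 'r) ringed_space \<Rightarrow> 'p set \<Rightarrow> ('p, 'r) ringed_space" where
  "open_subspace \<S> U = \<S>\<lparr>topo := subtopology (topo \<S>) U\<rparr>"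

definition isomorphic_ringed_spaces ::
    "('p, 'r) ringed_space \<Rightarrow> ('q, 's) ringed_space \<Rightarrow> bool" where
  "isomorphic_ringed_spaces \<S> Y \<longleftrightarrow>
     (\<exists>f \<phi>. homeomorphic_map (topo \<S>) (topo Y) f \<and>
        (\<forall>V. openin (topo Y) V \<longrightarrow>
           \<phi> V \<in> ring_iso (sect Y V) (sect \<S> {x \<in> points \<S>. f x \<in> V})) \<and>
        (\<forall>V W s. openin (topo Y) V \<and> openin (topo Y) W \<and> W \<subseteq> V \<and> s \<in> carrier (sect Y V) \<longrightarrow>
           \<phi> W (res Y V W s) =
           res \<S> {x \<in> points \<S>. f x \<in> V} {x \<in> points \<S>. f x \<in> W} (\<phi> V s)))"

subsection \<open>Stalks\<close>

definition germ :: "('p, 'r) ringed_space \<Rightarrow> 'p \<Rightarrow> 'p set \<Rightarrow> 'r \<Rightarrow> ('p set \<times> 'r) set" where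
  "germ \<S> x U s =
     {(V, t). openin (topo \<S>) V \<and> x \<in> V \<and> t \<in> carrier (sect \<S> V) \<and>
        (\<exists>W. openin (topo \<S>) W \<and> x \<in> W \<and> W \<subseteq> U \<inter> V \<and> res \<S> U W s = res \<S> V W t)}"

definition stalk :: "('p, 'r) ringed_space \<Rightarrow> 'p \<Rightarrow> ('p set \<times> 'r) set ring" where
  "stalk \<S> x =
     \<lparr>carrier = {germ \<S> x U s | U s. openin (topo \<S>) U \<and> x \<in> U \<and> s \<in> carrier (sect \<S> U)},
      monoid.mult = (\<lambda>a b. \<Union>(U, s)\<in>a. \<Union>(V, t)\<in>b. germ \<S> x (U \<inter> V)
                (res \<S> U (U \<inter> V) s \<otimes>\<^bsub>sect \<S> (U \<inter> V)\<^esub> res \<S> V (U \<inter> V) t)),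
      monoid.one = germ \<S> x (points \<S>) \<one>\<^bsub>sect \<S> (points \<S>)\<^esub>,
      ring.zero = germ \<S> x (points \<S>) \<zero>\<^bsub>sect \<S> (points \<S>)\<^esub>,
      ring.add = (\<lambda>a b. \<Union>(U, s)\<in>a. \<Union>(V, t)\<in>b. germ \<S> x (U \<inter> V)
                (res \<S> U (U \<inter> V) s \<oplus>\<^bsub>sect \<S> (U \<inter> V)\<^esub> res \<S> V (U \<inter> V) t))\<rparr>"

text \<open>For a generization \<open>y\<close> of \<open>x\<close>, every open neighbourhood of \<open>x\<close> contains \<open>y\<close>, whence a
  map of stalks from \<open>x\<close> to \<open>y\<close>.\<close>

definition generization :: "('p, 'r) ringed_space \<Rightarrow> 'p \<Rightarrow> 'p \<Rightarrow> bool" where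
  "generization \<S> y x \<longleftrightarrow> y \<in> points \<S> \<and> x \<in> topo \<S> closure_of {y}"

definition cospecialization ::
    "('p, 'r) ringed_space \<Rightarrow> 'p \<Rightarrow> 'p \<Rightarrow> ('p set \<times> 'r) set \<Rightarrow> ('p set \<times> 'r) set" where
  "cospecialization \<S> x y a = (\<Union>(U, s)\<in>a. germ \<S> y U s)"

definition locally_ringed_space :: "('p, 'r) ringed_space \<Rightarrow> bool" where
  "locally_ringed_space \<S> \<longleftrightarrow> is_ringed_space \<S> \<and> (\<forall>x\<in>points \<S>. is_local_ring (stalk \<S> x))"

subsection \<open>Spectra\<close>

definition spec_topology :: "'a ring \<Rightarrow> 'a set topology" where
  "spec_topology A =
     topology (\<lambda>U. \<exists>E. E \<subseteq> carrier A \<and> U = {p. primeideal p A \<and> \<not> E \<subseteq> p})"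

text \<open>Sections are the functions into the localizations at primes that are locally fractions.\<close>

definition spec_sections :: "'a ring \<Rightarrow> 'a set set \<Rightarrow> ('a set \<Rightarrow> ('a \<times> 'a) set) set" where
  "spec_sections A U =
     {s \<in> \<Pi>\<^sub>E p\<in>U. carrier (localization_at A p).
        \<forall>p\<in>U. \<exists>V. openin (spec_topology A) V \<and> p \<in> V \<and> V \<subseteq> U \<and>
          (\<exists>a\<in>carrier A. \<exists>h\<in>carrier A.
             \<forall>q\<in>V. h \<notin> q \<and> s q = fraction A (carrier A - q) a h)}"

definition Spec :: "'a ring \<Rightarrow> ('a set, 'a set \<Rightarrow> ('a \<times> 'a) set) ringed_space" where
  "Spec A =
     \<lparr>topo = spec_topology A,
      sect = (\<lambda>U. \<lparr>carrier = spec_sections A U,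
                   monoid.mult = (\<lambda>s t. \<lambda>p\<in>U. s p \<otimes>\<^bsub>localization_at A p\<^esub> t p),
                   monoid.one = (\<lambda>p\<in>U. \<one>\<^bsub>localization_at A p\<^esub>),
                   ring.zero = (\<lambda>p\<in>U. \<zero>\<^bsub>localization_at A p\<^esub>),
                   ring.add = (\<lambda>s t. \<lambda>p\<in>U. s p \<oplus>\<^bsub>localization_at A p\<^esub> t p)\<rparr>),
      res = (\<lambda>U V s. restrict s V)\<rparr>"

lemma istopology_spec:
  "istopology (\<lambda>U. \<exists>E. E \<subseteq> carrier A \<and> U = {p. primeideal p A \<and> \<not> E \<subseteq> p})"
  unfolding istopology_def
proof (rule conjI; intro allI impI)
  fix U V
  assume "\<exists>E. E \<subseteq> carrier A \<and> U = {p. primeideal p A \<and> \<not> E \<subseteq> p}"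
    and "\<exists>E. E \<subseteq> carrier A \<and> V = {p. primeideal p A \<and> \<not> E \<subseteq> p}"
  then obtain E F where E: "E \<subseteq> carrier A" "U = {p. primeideal p A \<and> \<not> E \<subseteq> p}"
    and F: "F \<subseteq> carrier A" "V = {p. primeideal p A \<and> \<not> F \<subseteq> p}"
    by blast
  let ?G = "{e \<otimes>\<^bsub>A\<^esub> f | e f. e \<in> E \<and> f \<in> F}"
  have iff: "\<not> ?G \<subseteq> p \<longleftrightarrow> \<not> E \<subseteq> p \<and> \<not> F \<subseteq> p" if p: "primeideal p A" for p
  proof -
    interpret primeideal p A by (rule p)
    show ?thesis
    proof (intro iffI conjI)
      assume G: "\<not> ?G \<subseteq> p"
      show "\<not> E \<subseteq> p" using G I_r_closed F(1) by blast
      show "\<not> F \<subseteq> p" using G I_l_closed E(1) by blast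
    next
      assume "\<not> E \<subseteq> p \<and> \<not> F \<subseteq> p"
      then obtain e f where ef: "e \<in> E" "e \<notin> p" "f \<in> F" "f \<notin> p" by blast
      then have "e \<otimes>\<^bsub>A\<^esub> f \<notin> p" using I_prime E(1) F(1) by blast
      then show "\<not> ?G \<subseteq> p" using ef by blast
    qed
  qed
  have eq: "?G \<inter> carrier A = ?G" if "primeideal p A" for p
  proof -
    interpret primeideal p A by (rule that)
    show ?thesis using E(1) F(1) by blast
  qed
  have "p \<in> U \<inter> V \<longleftrightarrow> primeideal p A \<and> \<not> (?G \<inter> carrier A) \<subseteq> p" for p
  proof (cases "primeideal p A")
    case True
    show ?thesis
      by (simp only: E(2) F(2) Int_iff mem_Collect_eq eq[OF True] iff[OF True] True simp_thms)
  next
    case False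
    then show ?thesis by (simp only: E(2) Int_iff mem_Collect_eq simp_thms)
  qed
  then have "U \<inter> V = {p. primeideal p A \<and> \<not> (?G \<inter> carrier A) \<subseteq> p}"
    by (simp only: set_eq_iff mem_Collect_eq simp_thms)
  then show "\<exists>E. E \<subseteq> carrier A \<and> U \<inter> V = {p. primeideal p A \<and> \<not> E \<subseteq> p}"
    by (intro exI[of _ "?G \<inter> carrier A"] conjI Int_lower2)
next
  fix \<U>
  assume "\<forall>U\<in>\<U>. \<exists>E. E \<subseteq> carrier A \<and> U = {p. primeideal p A \<and> \<not> E \<subseteq> p}"
  then obtain E where E: "\<And>U. U \<in> \<U> \<Longrightarrow> E U \<subseteq> carrier A"
    "\<And>U. U \<in> \<U> \<Longrightarrow> U = {p. primeideal p A \<and> \<not> E U \<subseteq> p}"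
    by metis
  have "\<Union>\<U> = {p. primeideal p A \<and> \<not> (\<Union>U\<in>\<U>. E U) \<subseteq> p}"
  proof (intro equalityI subsetI)
    fix p assume "p \<in> \<Union>\<U>"
    then obtain U where U: "U \<in> \<U>" "p \<in> U" by blast
    then have "p \<in> {p. primeideal p A \<and> \<not> E U \<subseteq> p}" using E(2)[OF U(1)] by simp
    then show "p \<in> {p. primeideal p A \<and> \<not> (\<Union>U\<in>\<U>. E U) \<subseteq> p}" using U(1) by blast
  next
    fix p assume "p \<in> {p. primeideal p A \<and> \<not> (\<Union>U\<in>\<U>. E U) \<subseteq> p}"
    then obtain U where U: "U \<in> \<U>" "primeideal p A" "\<not> E U \<subseteq> p" by blast
    then have "p \<in> U" using E(2)[OF U(1)] by blast
    then show "p \<in> \<Union>\<U>" using U(1) by blast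
  qed
  moreover have "(\<Union>U\<in>\<U>. E U) \<subseteq> carrier A" using E(1) by blast
  ultimately show "\<exists>E. E \<subseteq> carrier A \<and> \<Union>\<U> = {p. primeideal p A \<and> \<not> E \<subseteq> p}" by blast
qed

subsection \<open>Schemes and their properties\<close>

text \<open>If \<open>U\<close> is isomorphic to \<open>Spec A\<close>, then \<open>A\<close> is isomorphic to the ring of sections over \<open>U\<close>,
  so it is no restriction to take \<open>A\<close> on the same type as the rings of sections.  Since both sides
  are locally ringed and isomorphisms of local rings are local, an isomorphism of ringed spaces
  is the same as one of locally ringed spaces.\<close>

definition is_spec_of :: "('p, 'r) ringed_space \<Rightarrow> 'p set \<Rightarrow> 'r ring \<Rightarrow> bool" where
  "is_spec_of \<S> U A \<longleftrightarrow> openin (topo \<S>) U \<and> cring A \<and>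
     isomorphic_ringed_spaces (open_subspace \<S> U) (Spec A)"

definition scheme :: "('p, 'r) ringed_space \<Rightarrow> bool" where
  "scheme \<S> \<longleftrightarrow> locally_ringed_space \<S> \<and> (\<forall>x\<in>points \<S>. \<exists>U A. x \<in> U \<and> is_spec_of \<S> U A)"

definition integral_scheme :: "('p, 'r) ringed_space \<Rightarrow> bool" where
  "integral_scheme \<S> \<longleftrightarrow> scheme \<S> \<and> points \<S> \<noteq> {} \<and>
     (\<forall>U. openin (topo \<S>) U \<and> U \<noteq> {} \<longrightarrow> domain (sect \<S> U))"

definition noetherian_scheme :: "('p, 'r) ringed_space \<Rightarrow> bool" where
  "noetherian_scheme \<S> \<longleftrightarrow> scheme \<S> \<and>
     (\<exists>\<U>. finite \<U> \<and> \<Union>\<U> = points \<S> \<and> (\<forall>U\<in>\<U>. \<exists>A. is_spec_of \<S> U A \<and> noetherian_ring A))"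

definition normal_scheme :: "('p, 'r) ringed_space \<Rightarrow> bool" where
  "normal_scheme \<S> \<longleftrightarrow> scheme \<S> \<and> (\<forall>x\<in>points \<S>. integrally_closed_domain (stalk \<S> x))"


section \<open>Divisors on an integral Noetherian normal scheme\<close>

definition generic_point :: "('p, 'r) ringed_space \<Rightarrow> 'p" where
  "generic_point \<S> = (THE \<eta>. \<eta> \<in> points \<S> \<and> topo \<S> closure_of {\<eta>} = points \<S>)"

definition function_field :: "('p, 'r) ringed_space \<Rightarrow> ('p set \<times> 'r) set ring" where
  "function_field \<S> = stalk \<S> (generic_point \<S>)"

text \<open>As usual for integral schemes, the stalk at \<open>x\<close> is identified with its image in the
  function field, which is its field of fractions.  The map from this stalk to the one at a
  generization then becomes an inclusion.\<close>

definition local_ring :: "('p, 'r) ringed_space \<Rightarrow> 'p \<Rightarrow> ('p set \<times> 'r) set set" where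
  "local_ring \<S> x = cospecialization \<S> x (generic_point \<S>) ` carrier (stalk \<S> x)"

definition codim_one_points :: "('p, 'r) ringed_space \<Rightarrow> 'p set" where
  "codim_one_points \<S> = {\<xi> \<in> points \<S>. krull_dim (stalk \<S> \<xi>) = 1}"

definition ord_at :: "('p, 'r) ringed_space \<Rightarrow> 'p \<Rightarrow> ('p set \<times> 'r) set \<Rightarrow> int" where
  "ord_at \<S> \<xi> = dvr_valuation (function_field \<S>) (local_ring \<S> \<xi>)"

definition weil_divisors :: "('p, 'r) ringed_space \<Rightarrow> ('p \<Rightarrow>\<^sub>0 int) monoid" where
  "weil_divisors \<S> = free_Abelian_group (codim_one_points \<S>)"

definition cartier_divisors :: "('p, 'r) ringed_space \<Rightarrow> ('p \<Rightarrow>\<^sub>0 int) set" where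
  "cartier_divisors \<S> =
     {D \<in> carrier (weil_divisors \<S>).
        \<forall>x\<in>points \<S>. \<exists>U f. openin (topo \<S>) U \<and> x \<in> U \<and>
          f \<in> carrier (function_field \<S>) \<and> f \<noteq> \<zero>\<^bsub>function_field \<S>\<^esub> \<and>
          (\<forall>\<xi>\<in>codim_one_points \<S> \<inter> U. Poly_Mapping.lookup D \<xi> = ord_at \<S> \<xi> f)}"

definition local_class_group ::
    "('p, 'r) ringed_space \<Rightarrow> 'p \<Rightarrow> ('p set \<times> 'r) set set set monoid" where
  "local_class_group \<S> x = class_group (function_field \<S>) (local_ring \<S> x)"

text \<open>The prime divisors of the spectrum of the local ring at \<open>x\<close> are given by the codimension-one
  points whose closure contains \<open>x\<close>.  The restriction of a Weil divisor \<open>D\<close> corresponds to the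
  divisorial ideal of all \<open>f\<close> whose divisor on this spectrum is at least \<open>D\<close>; in particular,
  a prime divisor corresponds to its prime ideal.\<close>

definition local_divisorial_ideal ::
    "('p, 'r) ringed_space \<Rightarrow> 'p \<Rightarrow> ('p \<Rightarrow>\<^sub>0 int) \<Rightarrow> ('p set \<times> 'r) set set" where
  "local_divisorial_ideal \<S> x D =
     {f \<in> carrier (function_field \<S>). f = \<zero>\<^bsub>function_field \<S>\<^esub> \<or>
        (\<forall>\<xi>\<in>codim_one_points \<S>. generization \<S> \<xi> x \<longrightarrow>
           Poly_Mapping.lookup D \<xi> \<le> ord_at \<S> \<xi> f)}"

definition divisor_class_at ::
    "('p, 'r) ringed_space \<Rightarrow> 'p \<Rightarrow> ('p \<Rightarrow>\<^sub>0 int) \<Rightarrow> ('p set \<times> 'r) set set set" where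
  "divisor_class_at \<S> x D =
     ideal_class (function_field \<S>) (local_ring \<S> x) (local_divisorial_ideal \<S> x D)"

text \<open>\<open>[I] \<mapsto> [I O\<^sub>y]\<close>, independent of the representative \<open>I\<close> of the class \<open>C\<close>.\<close>

definition class_group_map ::
    "('p, 'r) ringed_space \<Rightarrow> 'p \<Rightarrow> ('p set \<times> 'r) set set set \<Rightarrow> ('p set \<times> 'r) set set set" where
  "class_group_map \<S> y C =
     the_elem ((\<lambda>I. ideal_class (function_field \<S>) (local_ring \<S> y)
                      (generated_submodule (function_field \<S>) (local_ring \<S> y) I)) ` C)"

definition class_group_limit ::
    "('p, 'r) ringed_space \<Rightarrow> ('p \<Rightarrow> ('p set \<times> 'r) set set set) monoid" where
  "class_group_limit \<S> =
     (product_group (points \<S>) (local_class_group \<S>))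
       \<lparr>carrier := {c \<in> carrier (product_group (points \<S>) (local_class_group \<S>)).
          \<forall>x\<in>points \<S>. \<forall>y\<in>points \<S>. generization \<S> y x \<longrightarrow> class_group_map \<S> y (c x) = c y}\<rparr>"

definition divisor_classes ::
    "('p, 'r) ringed_space \<Rightarrow> ('p \<Rightarrow>\<^sub>0 int) \<Rightarrow> ('p \<Rightarrow> ('p set \<times> 'r) set set set)" where
  "divisor_classes \<S> D = (\<lambda>x\<in>points \<S>. divisor_class_at \<S> x D)"

text \<open>The map induced on the cosets of the Cartier divisors.\<close>

definition canonical_map ::
    "('p, 'r) ringed_space \<Rightarrow> ('p \<Rightarrow>\<^sub>0 int) set \<Rightarrow> ('p \<Rightarrow> ('p set \<times> 'r) set set set)" where
  "canonical_map \<S> C = the_elem (divisor_classes \<S> ` C)"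

end

(* A chart U = Spec A with A Noetherian maps to the function field K, and the local rings of X at
   the points of U are the images of the localizations of A.  The Noetherian and normal hypotheses
   give: the local ring at a codimension-one point is a discrete valuation ring, every local ring is
   the intersection of those at the codimension-one points specializing to its point, and a nonzero
   rational function has, on U, only finitely many zeros and poles.  These facts yield approximation,
   so the divisorial ideal I_x(D) determines D at the codimension-one points specializing to x;
   products, divisorial hulls and extensions to generizations all translate into operations on D.
   Hence the class of D vanishes at x iff D agrees with some div f at the codimension-one points
   specializing to x, and by finiteness D and div f then agree on a neighbourhood of x. *)

theory Submission
  imports Defs
begin

section \<open>Divisorial ideals from a family of valuations\<close>

text \<open>All local rings are compared as subrings of one field, and every condition of
  \<open>divisor_system\<close> concerns the generizations of a single point, hence can be checked
  in one affine chart; this is how non-separated schemes are covered. The commutative algebra rests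
  on the ascending chain condition alone. It yields an element with maximal conductor, whose
  conductor is a prime with principal maximal ideal; it shows that an element stabilizing the
  maximal ideal of a local ring is integral; it makes repeated division by a uniformizer stop; and
  it leaves only finitely many minimal primes over an element. A height-one prime q gets its
  uniformizer by applying the conductor argument to 1/a with a in q: the prime found lies inside q
  and has height one, so it is q. Divisorial ideals are handled through the least value attained at
  each codimension-one point. Since colons, hulls and products only see these least values, any set
  attaining them can stand for the whole ideal, and a class becomes the family of ideals of D + div
  f.\<close>

text \<open>Negation is demanded as multiplication by \<open>\<ominus> \<one>\<close>, the form that
  closure under scalars delivers in \<open>cring_idealI\<close> and
  \<open>is_submoduleI\<close>.\<close>

lemma (in cring) additive_subgroup_if_closed:
  assumes "M \<subseteq> carrier R" "M \<noteq> {}"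
    and add: "\<And>x y. \<lbrakk>x \<in> M; y \<in> M\<rbrakk> \<Longrightarrow> x \<oplus> y \<in> M"
    and neg: "\<And>x. x \<in> M \<Longrightarrow> \<ominus> \<one> \<otimes> x \<in> M"
  shows "additive_subgroup M R"
proof -
  have "\<ominus> x \<in> M" if "x \<in> M" for x
    using neg[OF that] assms(1) that by (auto simp: l_minus)
  then show ?thesis
    unfolding additive_subgroup_def using assms(1,2) add
    by (intro add.subgroupI) (auto simp: a_inv_def[symmetric])
qed

lemma (in cring) cring_idealI:
  assumes "I \<subseteq> carrier R" "I \<noteq> {}"
    and "\<And>x y. \<lbrakk>x \<in> I; y \<in> I\<rbrakk> \<Longrightarrow> x \<oplus> y \<in> I"
    and mult: "\<And>x y. \<lbrakk>x \<in> carrier R; y \<in> I\<rbrakk> \<Longrightarrow> x \<otimes> y \<in> I"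
  shows "ideal I R"
proof (rule idealI[OF ring_axioms])
  show "subgroup I (add_monoid R)"
    using additive_subgroup_if_closed[OF assms(1-3)] mult unfolding additive_subgroup_def by simp
  show "a \<otimes> x \<in> I" if "a \<in> I" "x \<in> carrier R" for a x
    using mult[OF that(2,1)] m_comm[of a x] that assms(1) by auto
qed (rule mult)

lemma is_submoduleI:
  fixes R (structure)
  assumes "cring R" "subring L R" and M: "M \<subseteq> carrier R" "M \<noteq> {}"
    and add: "\<And>x y. \<lbrakk>x \<in> M; y \<in> M\<rbrakk> \<Longrightarrow> x \<oplus> y \<in> M"
    and mult: "\<And>x y. \<lbrakk>x \<in> L; y \<in> M\<rbrakk> \<Longrightarrow> x \<otimes> y \<in> M"
  shows "is_submodule R L M"
proof -
  have "\<ominus> \<one> \<in> L" using subringE(3,5)[OF assms(2)] by blast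
  then show ?thesis
    unfolding is_submodule_def using cring.additive_subgroup_if_closed[OF assms(1) M add] mult by blast
qed

lemma (in field) Units_mult_inv_cancel:
  assumes "f \<in> Units R" "z \<in> carrier R"
  shows "inv f \<otimes> (f \<otimes> z) = z" "f \<otimes> (inv f \<otimes> z) = z"
  using assms by (simp_all add: m_assoc [symmetric] Units_closed del: field_Units)

lemma UN_singleton_image: "(\<Union>x\<in>A. {f x}) = f ` A"
  by blast

lemma (in field) Units_iff_nonzero: "f \<in> Units R \<longleftrightarrow> f \<in> carrier R \<and> f \<noteq> \<zero>"
  by (simp add: field_Units)

lemma (in field) Units_inv_mult:
  assumes "f \<in> Units R" "g \<in> Units R"
  shows "inv (f \<otimes> g) = inv f \<otimes> inv g"
proof -
  have "f \<otimes> g \<otimes> (inv f \<otimes> inv g) = (f \<otimes> inv f) \<otimes> (g \<otimes> inv g)"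
    using assms by (simp only: m_ac Units_closed Units_inv_closed m_closed)
  then show ?thesis using assms by (intro comm_inv_char) auto
qed

text \<open>Intended reading: \<open>P\<close> the points, \<open>Z\<close> the codimension-one
  points, \<open>gen y x\<close> that y is a generization of x, \<open>B x\<close> the local ring at
  x inside the function field, \<open>v\<close> the orders. The condition \<open>separation\<close>
  supplies a function in the local ring at x that vanishes along \<xi> but is a unit at y;
  \<open>hartogs\<close> is the intersection property of normal rings. The ultrametric inequality is
  derived in \<open>v_add\<close>.\<close>

locale divisor_system = field K for K :: "'a ring" (structure) +
  fixes P Z :: "'p set" and gen :: "'p \<Rightarrow> 'p \<Rightarrow> bool" and B :: "'p \<Rightarrow> 'a set"
    and v :: "'p \<Rightarrow> 'a \<Rightarrow> int"
  assumes B_subring: "x \<in> P \<Longrightarrow> subring (B x) K"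
    and B_mono: "\<lbrakk>x \<in> P; y \<in> P; gen y x\<rbrakk> \<Longrightarrow> B x \<subseteq> B y"
    and Z_sub: "Z \<subseteq> P"
    and gen_refl: "x \<in> P \<Longrightarrow> gen x x"
    and gen_trans: "\<lbrakk>gen z y; gen y x\<rbrakk> \<Longrightarrow> gen z x"
    and Z_incomparable: "\<lbrakk>\<xi> \<in> Z; \<zeta> \<in> Z; gen \<xi> \<zeta>\<rbrakk> \<Longrightarrow> \<xi> = \<zeta>"
    and v_mult: "\<lbrakk>\<xi> \<in> Z; f \<in> Units K; g \<in> Units K\<rbrakk> \<Longrightarrow> v \<xi> (f \<otimes> g) = v \<xi> f + v \<xi> g"
    and v_nonneg: "\<lbrakk>\<xi> \<in> Z; f \<in> Units K\<rbrakk> \<Longrightarrow> f \<in> B \<xi> \<longleftrightarrow> 0 \<le> v \<xi> f"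
    and v_uniformizer: "\<xi> \<in> Z \<Longrightarrow> \<exists>\<pi>\<in>Units K. v \<xi> \<pi> = 1"
    and hartogs: "\<lbrakk>x \<in> P; f \<in> Units K; \<And>\<xi>. \<lbrakk>\<xi> \<in> Z; gen \<xi> x\<rbrakk> \<Longrightarrow> 0 \<le> v \<xi> f\<rbrakk> \<Longrightarrow> f \<in> B x"
    and finite_support: "\<lbrakk>x \<in> P; f \<in> Units K\<rbrakk> \<Longrightarrow> finite {\<xi> \<in> Z. gen \<xi> x \<and> v \<xi> f \<noteq> 0}"
    and separation: "\<lbrakk>\<xi> \<in> Z; x \<in> P; y \<in> P; gen \<xi> x; gen y x; \<not> gen \<xi> y\<rbrakk>
      \<Longrightarrow> \<exists>h\<in>B x. h \<in> Units K \<and> 1 \<le> v \<xi> h \<and> inv h \<in> B y"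
begin

lemma v_one: "\<xi> \<in> Z \<Longrightarrow> v \<xi> \<one> = 0"
  using v_mult[of \<xi> \<one> \<one>] by simp

lemma v_inv: "\<lbrakk>\<xi> \<in> Z; f \<in> Units K\<rbrakk> \<Longrightarrow> v \<xi> (inv f) = - v \<xi> f"
  using v_mult[of \<xi> f "inv f"] v_one[of \<xi>] by simp

lemma v_surj:
  assumes "\<xi> \<in> Z"
  shows "\<exists>f\<in>Units K. v \<xi> f = n"
proof -
  obtain \<pi> where \<pi>: "\<pi> \<in> Units K" "v \<xi> \<pi> = 1" using v_uniformizer assms by blast
  have pos: "\<exists>f\<in>Units K. v \<xi> f = int m" for m
  proof (induction m)
    case 0
    show ?case using v_one assms by (intro bexI[of _ \<one>]) auto
  next
    case (Suc m)
    then obtain f where "f \<in> Units K" "v \<xi> f = int m" by blast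
    then show ?case using \<pi> v_mult[OF assms] by (intro bexI[of _ "\<pi> \<otimes> f"]) auto
  qed
  show ?thesis
  proof (cases "0 \<le> n")
    case True
    then show ?thesis using pos[of "nat n"] by simp
  next
    case False
    then obtain f where "f \<in> Units K" "v \<xi> f = - n" using pos[of "nat (- n)"] by auto
    then show ?thesis using v_inv[OF assms] by (intro bexI[of _ "inv f"]) auto
  qed
qed

text \<open>Scaling by an element of value \<open>- n\<close> turns both bounds into membership in
  \<open>B \<xi>\<close>, so the ultrametric inequality is closure of that ring under
  addition.\<close>

lemma v_add:
  assumes \<xi>: "\<xi> \<in> Z" and f: "f \<in> Units K" and g: "g \<in> Units K" and fg: "f \<oplus> g \<in> Units K"
    and n: "n \<le> v \<xi> f" "n \<le> v \<xi> g"
  shows "n \<le> v \<xi> (f \<oplus> g)"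
proof -
  interpret B: subring "B \<xi>" K using B_subring Z_sub \<xi> by blast
  obtain h where h: "h \<in> Units K" "v \<xi> h = - n" using v_surj[OF \<xi>] by blast
  have "h \<otimes> f \<in> B \<xi>" "h \<otimes> g \<in> B \<xi>"
    using h f g n v_nonneg[OF \<xi>] v_mult[OF \<xi>] by auto
  then have "h \<otimes> (f \<oplus> g) \<in> B \<xi>"
    using h f g subringE(7)[OF B.subring_axioms, of "h \<otimes> f" "h \<otimes> g"]
    by (simp add: r_distr Units_closed)
  then show ?thesis
    using h fg v_nonneg[OF \<xi>, of "h \<otimes> (f \<oplus> g)"] v_mult[OF \<xi> h(1) fg] by auto
qed

lemma B_iff:
  assumes "x \<in> P" "f \<in> Units K"
  shows "f \<in> B x \<longleftrightarrow> (\<forall>\<xi>\<in>Z. gen \<xi> x \<longrightarrow> 0 \<le> v \<xi> f)"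
proof
  assume "f \<in> B x"
  then show "\<forall>\<xi>\<in>Z. gen \<xi> x \<longrightarrow> 0 \<le> v \<xi> f"
    using B_mono[OF assms(1)] v_nonneg assms(2) Z_sub by blast
qed (use hartogs assms in blast)

text \<open>The sign convention is that of O(-D): effective divisors give integral ideals. D is an
  arbitrary integer function, so that Weil divisors and divisors of functions are treated
  alike.\<close>

definition div_ideal :: "'p \<Rightarrow> ('p \<Rightarrow> int) \<Rightarrow> 'a set" where
  "div_ideal x D = {f \<in> carrier K. f = \<zero> \<or> (\<forall>\<xi>\<in>Z. gen \<xi> x \<longrightarrow> D \<xi> \<le> v \<xi> f)}"

text \<open>Finiteness is asked only among the generizations of x, which is what
  \<open>finite_support\<close> provides for the divisor of a function.\<close>

definition finite_at :: "'p \<Rightarrow> ('p \<Rightarrow> int) \<Rightarrow> bool" where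
  "finite_at x D \<longleftrightarrow> finite {\<xi> \<in> Z. gen \<xi> x \<and> D \<xi> \<noteq> 0}"

lemma finite_at_add:
  assumes "finite_at x D" "finite_at x E"
  shows "finite_at x (\<lambda>\<xi>. D \<xi> + E \<xi>)"
  unfolding finite_at_def
  by (rule finite_subset[OF _ finite_UnI[OF assms[unfolded finite_at_def]]]) auto

lemma finite_at_uminus: "finite_at x D \<Longrightarrow> finite_at x (\<lambda>\<xi>. - D \<xi>)"
  unfolding finite_at_def by simp

lemma finite_at_v: "\<lbrakk>x \<in> P; f \<in> Units K\<rbrakk> \<Longrightarrow> finite_at x (\<lambda>\<xi>. v \<xi> f)"
  unfolding finite_at_def by (rule finite_support)

lemma finite_at_mono: "\<lbrakk>finite_at x D; gen y x\<rbrakk> \<Longrightarrow> finite_at y D"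
  unfolding finite_at_def by (erule rev_finite_subset) (use gen_trans in blast)

lemma div_ideal_cong:
  "(\<And>\<xi>. \<lbrakk>\<xi> \<in> Z; gen \<xi> x\<rbrakk> \<Longrightarrow> D \<xi> = E \<xi>) \<Longrightarrow> div_ideal x D = div_ideal x E"
  unfolding div_ideal_def by (intro Collect_cong) auto

lemma div_ideal_zero: "x \<in> P \<Longrightarrow> div_ideal x (\<lambda>\<xi>. 0) = B x"
  unfolding div_ideal_def
  using B_iff[of x] Units_iff_nonzero subring.axioms(1)[OF B_subring, of x]
    subringE(1,2)[OF B_subring, of x] by auto

lemma mult_div_ideal:
  assumes x: "x \<in> P" and f: "f \<in> Units K" and a: "a \<in> carrier K"
  shows "f \<otimes> a \<in> div_ideal x (\<lambda>\<xi>. D \<xi> + v \<xi> f) \<longleftrightarrow> a \<in> div_ideal x D"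
proof (cases "a = \<zero>")
  case False
  then have "a \<in> Units K" "f \<otimes> a \<in> Units K" using f a Units_iff_nonzero by auto
  then show ?thesis
    unfolding div_ideal_def using f v_mult Units_iff_nonzero by (auto simp: v_mult)
qed (use f in \<open>auto simp: div_ideal_def\<close>)

lemma image_div_ideal:
  assumes x: "x \<in> P" and f: "f \<in> Units K"
  shows "(\<lambda>a. f \<otimes> a) ` div_ideal x D = div_ideal x (\<lambda>\<xi>. D \<xi> + v \<xi> f)"
proof (intro equalityI subsetI)
  fix b assume b: "b \<in> div_ideal x (\<lambda>\<xi>. D \<xi> + v \<xi> f)"
  then have "b \<in> carrier K" by (simp add: div_ideal_def)
  then have "b = f \<otimes> (inv f \<otimes> b)" "inv f \<otimes> b \<in> carrier K"
    using f by (simp_all add: Units_mult_inv_cancel)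
  then show "b \<in> (\<lambda>a. f \<otimes> a) ` div_ideal x D"
    using mult_div_ideal[OF x f, of "inv f \<otimes> b" D] b by auto
next
  fix b assume "b \<in> (\<lambda>a. f \<otimes> a) ` div_ideal x D"
  then obtain a where "a \<in> div_ideal x D" "b = f \<otimes> a" by blast
  then show "b \<in> div_ideal x (\<lambda>\<xi>. D \<xi> + v \<xi> f)"
    using mult_div_ideal[OF x f, of a D] by (auto simp: div_ideal_def)
qed

lemma principal_eq_div_ideal:
  assumes "x \<in> P" "f \<in> Units K"
  shows "(\<lambda>b. f \<otimes> b) ` B x = div_ideal x (\<lambda>\<xi>. v \<xi> f)"
  using image_div_ideal[OF assms, of "\<lambda>_. 0"] div_ideal_zero[OF assms(1)] by simp

lemma div_ideal_submodule:
  assumes x: "x \<in> P"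
  shows "is_submodule K (B x) (div_ideal x D)"
proof -
  interpret B: subring "B x" K using B_subring x .
  have add: "f \<oplus> g \<in> div_ideal x D" if f: "f \<in> div_ideal x D" and g: "g \<in> div_ideal x D" for f g
  proof (cases "f = \<zero> \<or> g = \<zero> \<or> f \<oplus> g = \<zero>")
    case True
    then show ?thesis using f g by (auto simp: div_ideal_def)
  next
    case False
    then have "f \<in> Units K" "g \<in> Units K" "f \<oplus> g \<in> Units K"
      using f g Units_iff_nonzero by (auto simp: div_ideal_def)
    then show ?thesis using f g False v_add by (auto simp: div_ideal_def)
  qed
  have mult: "b \<otimes> f \<in> div_ideal x D" if b: "b \<in> B x" and f: "f \<in> div_ideal x D" for b f
  proof (cases "b = \<zero> \<or> f = \<zero>")
    case True
    then show ?thesis using b f B.subset by (auto simp: div_ideal_def)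
  next
    case False
    then have u: "b \<in> Units K" "f \<in> Units K"
      using b f B.subset Units_iff_nonzero by (auto simp: div_ideal_def)
    have "0 \<le> v \<xi> b" if "\<xi> \<in> Z" "gen \<xi> x" for \<xi> using B_iff[OF x u(1)] b that by blast
    then show ?thesis using f u False v_mult by (fastforce simp: div_ideal_def)
  qed
  show ?thesis
    by (rule is_submoduleI[OF is_cring B_subring[OF x] _ _ add mult]) (auto simp: div_ideal_def)
qed

section \<open>Approximation: adjusting finitely many values\<close>

lemma separation_power:
  assumes \<xi>: "\<xi> \<in> Z" and x: "x \<in> P" and y: "y \<in> P" and gen: "gen \<xi> x" "gen y x" "\<not> gen \<xi> y"
  shows "\<exists>h\<in>B x. h \<in> Units K \<and> int n \<le> v \<xi> h \<and> inv h \<in> B y"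
proof (induction n)
  case 0
  show ?case using subringE(3)[OF B_subring] x y v_one[OF \<xi>] by (intro bexI[of _ \<one>]) auto
next
  case (Suc n)
  then obtain h where h: "h \<in> B x" "h \<in> Units K" "int n \<le> v \<xi> h" "inv h \<in> B y" by blast
  obtain k where k: "k \<in> B x" "k \<in> Units K" "1 \<le> v \<xi> k" "inv k \<in> B y"
    using separation[OF \<xi> x y gen] by blast
  have "inv (h \<otimes> k) = inv h \<otimes> inv k" using h(2) k(2) by (rule Units_inv_mult)
  then show ?case
    using h k v_mult[OF \<xi> h(2) k(2)] subringE(6)[OF B_subring[OF x]] subringE(6)[OF B_subring[OF y]]
    by (intro bexI[of _ "h \<otimes> k"]) auto
qed

text \<open>The witness is a product of elements from \<open>separation_power\<close>. All factors
  lie in \<open>B x\<close> and so have nonnegative value at every generization of x in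
  \<open>Z\<close>; hence a factor added for \<zeta> cannot spoil a bound already reached.\<close>

lemma separation_finite:
  assumes x: "x \<in> P" and y: "y \<in> P" "gen y x"
    and F: "finite F" "\<And>\<xi>. \<xi> \<in> F \<Longrightarrow> \<xi> \<in> Z \<and> gen \<xi> x \<and> \<not> gen \<xi> y"
  shows "\<exists>h\<in>B x. h \<in> Units K \<and> inv h \<in> B y \<and> (\<forall>\<xi>\<in>F. m \<xi> \<le> v \<xi> h)"
  using F
proof (induction F rule: finite_induct)
  case empty
  show ?case using subringE(3)[OF B_subring] x y by (intro bexI[of _ \<one>]) auto
next
  case (insert \<zeta> F)
  then obtain h where h: "h \<in> B x" "h \<in> Units K" "inv h \<in> B y" "\<forall>\<xi>\<in>F. m \<xi> \<le> v \<xi> h" by blast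
  \<comment> \<open>The exponent \<open>nat (m \<zeta>)\<close> also covers a negative
    bound.\<close>
  obtain k where k: "k \<in> B x" "k \<in> Units K" "int (nat (m \<zeta>)) \<le> v \<zeta> k" "inv k \<in> B y"
    using separation_power[of \<zeta> x y "nat (m \<zeta>)"] insert.prems x y by blast
  have "inv (h \<otimes> k) = inv h \<otimes> inv k" using h(2) k(2) by (rule Units_inv_mult)
  moreover have "m \<xi> \<le> v \<xi> (h \<otimes> k)" if "\<xi> \<in> insert \<zeta> F" for \<xi>
  proof -
    have \<xi>: "\<xi> \<in> Z" "gen \<xi> x" using insert.prems[OF that] by simp_all
    then have "0 \<le> v \<xi> h" "0 \<le> v \<xi> k" using B_iff[OF x h(2)] B_iff[OF x k(2)] h(1) k(1) by auto
    moreover have "v \<xi> (h \<otimes> k) = v \<xi> h + v \<xi> k" by (rule v_mult[OF \<xi>(1) h(2) k(2)])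
    moreover have "m \<xi> \<le> v \<xi> h \<or> m \<xi> \<le> v \<xi> k" using h(4) k(3) that by (auto split: if_splits)
    ultimately show ?thesis by linarith
  qed
  ultimately show ?case
    using h k subringE(6)[OF B_subring[OF x]] subringE(6)[OF B_subring[OF y(1)]]
    by (intro bexI[of _ "h \<otimes> k"]) auto
qed

text \<open>Clearing denominators: the bounds of D that f violates occur at finitely many \<xi>,
  none of which generizes y, so one h that is a unit of \<open>B y\<close> repairs them all. With y
  a codimension-one point this gives exact values (\<open>div_ideal_attains\<close>); with y any
  generization it gives the extension of ideals (\<open>generated_div_ideal\<close>).\<close>

lemma approximation:
  assumes x: "x \<in> P" and y: "y \<in> P" "gen y x" and D: "finite_at x D" and f: "f \<in> Units K"
    and ge: "\<And>\<xi>. \<lbrakk>\<xi> \<in> Z; gen \<xi> y\<rbrakk> \<Longrightarrow> D \<xi> \<le> v \<xi> f"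
  shows "\<exists>h\<in>B x. h \<in> Units K \<and> inv h \<in> B y \<and> h \<otimes> f \<in> div_ideal x D"
proof -
  let ?F = "{\<xi> \<in> Z. gen \<xi> x \<and> v \<xi> f < D \<xi>}"
  have "finite ?F"
    by (rule finite_subset[OF _ finite_UnI[OF D[unfolded finite_at_def] finite_support[OF x f]]]) auto
  moreover have "\<xi> \<in> Z \<and> gen \<xi> x \<and> \<not> gen \<xi> y" if "\<xi> \<in> ?F" for \<xi> using that ge by force
  ultimately obtain h where h: "h \<in> B x" "h \<in> Units K" "inv h \<in> B y"
    "\<forall>\<xi>\<in>?F. D \<xi> - v \<xi> f \<le> v \<xi> h"
    using separation_finite[OF x y, of ?F "\<lambda>\<xi>. D \<xi> - v \<xi> f"] by blast
  have "D \<xi> \<le> v \<xi> (h \<otimes> f)" if "\<xi> \<in> Z" "gen \<xi> x" for \<xi>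
  proof -
    have "0 \<le> v \<xi> h" using B_iff[OF x h(2)] h(1) that by blast
    then show ?thesis using h(4) that v_mult[OF that(1) h(2) f] by (cases "\<xi> \<in> ?F") force+
  qed
  then have "h \<otimes> f \<in> div_ideal x D" using h f by (auto simp: div_ideal_def)
  then show ?thesis using h by blast
qed

text \<open>Take \<open>y = \<xi>\<close> in \<open>approximation\<close>: by incomparability \<xi>
  is the only member of \<open>Z\<close> generizing \<xi>, so the bound to be met at y is just
  \<open>v \<xi> f = D \<xi>\<close>. The corrector h is a unit of \<open>B \<xi>\<close> and leaves
  that value alone.\<close>

lemma div_ideal_attains:
  assumes x: "x \<in> P" and D: "finite_at x D" and \<xi>: "\<xi> \<in> Z" "gen \<xi> x"
  shows "\<exists>f\<in>div_ideal x D. f \<in> Units K \<and> v \<xi> f = D \<xi>"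
proof -
  obtain f where f: "f \<in> Units K" "v \<xi> f = D \<xi>" using v_surj \<xi> by blast
  have \<xi>P: "\<xi> \<in> P" using \<xi> Z_sub by blast
  have "\<exists>h\<in>B x. h \<in> Units K \<and> inv h \<in> B \<xi> \<and> h \<otimes> f \<in> div_ideal x D"
    by (rule approximation[OF x \<xi>P \<xi>(2) D f(1)]) (use Z_incomparable f \<xi> in force)
  then obtain h where h: "h \<in> B x" "h \<in> Units K" "inv h \<in> B \<xi>" "h \<otimes> f \<in> div_ideal x D" by blast
  have "0 \<le> v \<xi> h" using B_iff[OF x h(2)] h(1) \<xi> by blast
  moreover have "0 \<le> v \<xi> (inv h)" using v_nonneg[of \<xi> "inv h"] h \<xi> by simp
  ultimately have "v \<xi> h = 0" using v_inv \<xi> h by simp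
  then have "v \<xi> (h \<otimes> f) = D \<xi>" using f h \<xi> v_mult by simp
  then show ?thesis using h f by (intro bexI[of _ "h \<otimes> f"]) auto
qed

lemma div_ideal_nontrivial:
  assumes x: "x \<in> P" and D: "finite_at x D"
  shows "\<exists>f\<in>div_ideal x D. f \<in> Units K"
proof (cases "\<exists>\<xi>\<in>Z. gen \<xi> x")
  case True
  then show ?thesis using div_ideal_attains[OF x D] by blast
next
  case False
  \<comment> \<open>Without codimension-one generizations, as at the generic point, no bound is
    imposed.\<close>
  then show ?thesis by (intro bexI[of _ \<one>]) (auto simp: div_ideal_def)
qed

text \<open>By \<open>div_ideal_attains\<close> the coefficient of D at \<xi> is the least value of
  \<open>v \<xi>\<close> on the nonzero elements of the ideal, so the ideal remembers D along the
  generizations of x.\<close>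

lemma div_ideal_inject:
  assumes x: "x \<in> P" and D: "finite_at x D" and E: "finite_at x E"
    and eq: "div_ideal x D = div_ideal x E" and \<xi>: "\<xi> \<in> Z" "gen \<xi> x"
  shows "D \<xi> = E \<xi>"
proof -
  have "E' \<xi> \<le> D' \<xi>" if D': "finite_at x D'" and eq: "div_ideal x D' = div_ideal x E'" for D' E'
  proof -
    obtain f where "f \<in> div_ideal x E'" "f \<in> Units K" "v \<xi> f = D' \<xi>"
      using div_ideal_attains[OF x D' \<xi>] eq by blast
    then show ?thesis using \<xi> Units_iff_nonzero by (auto simp: div_ideal_def)
  qed
  from this[OF D eq] this[OF E eq[symmetric]] show ?thesis by simp
qed

text \<open>Elements of \<open>S\<close> attaining the bound at each \<xi> force a nonzero z in the
  colon to have value at least \<open>- D \<xi>\<close>, and \<open>hartogs\<close> gives the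
  converse. \<open>S\<close> may be any subset with such elements, so that products of ideals can be
  treated without knowing them to be divisorial.\<close>

lemma colon_eq_div_ideal:
  assumes x: "x \<in> P" and sub: "S \<subseteq> div_ideal x D"
    and att: "\<And>\<xi>. \<lbrakk>\<xi> \<in> Z; gen \<xi> x\<rbrakk> \<Longrightarrow> \<exists>f\<in>S. f \<in> Units K \<and> v \<xi> f = D \<xi>"
  shows "colon K (B x) S = div_ideal x (\<lambda>\<xi>. - D \<xi>)"
proof (intro equalityI subsetI)
  fix z assume z: "z \<in> colon K (B x) S"
  have "- D \<xi> \<le> v \<xi> z" if \<xi>: "\<xi> \<in> Z" "gen \<xi> x" "z \<noteq> \<zero>" for \<xi>
  proof -
    obtain f where f: "f \<in> S" "f \<in> Units K" "v \<xi> f = D \<xi>" using att \<xi> by blast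
    have "z \<in> Units K" "z \<otimes> f \<in> B x" using z f \<xi> Units_iff_nonzero by (auto simp: colon_def)
    then have "0 \<le> v \<xi> (z \<otimes> f)" using B_iff[OF x, of "z \<otimes> f"] f \<xi> by auto
    then show ?thesis using v_mult \<open>z \<in> Units K\<close> f \<xi> by simp
  qed
  then show "z \<in> div_ideal x (\<lambda>\<xi>. - D \<xi>)" using z by (auto simp: div_ideal_def colon_def)
next
  fix z assume z: "z \<in> div_ideal x (\<lambda>\<xi>. - D \<xi>)"
  interpret B: subring "B x" K using B_subring x .
  have "z \<otimes> f \<in> B x" if "f \<in> S" for f
  proof (cases "z = \<zero> \<or> f = \<zero>")
    case True
    moreover have "z \<in> carrier K" "f \<in> carrier K" using z that sub by (auto simp: div_ideal_def)
    ultimately have "z \<otimes> f = \<zero>" by auto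
    then show ?thesis using subringE(2)[OF B_subring[OF x]] by simp
  next
    case False
    then have u: "z \<in> Units K" "f \<in> Units K"
      using z that sub Units_iff_nonzero by (auto simp: div_ideal_def)
    have "0 \<le> v \<xi> (z \<otimes> f)" if \<xi>: "\<xi> \<in> Z" "gen \<xi> x" for \<xi>
    proof -
      have "- D \<xi> \<le> v \<xi> z" "D \<xi> \<le> v \<xi> f"
        using z sub \<open>f \<in> S\<close> False \<xi> by (auto simp: div_ideal_def)
      then show ?thesis using v_mult u \<xi> by simp
    qed
    then show ?thesis using hartogs[OF x] u by simp
  qed
  then show "z \<in> colon K (B x) S" using z by (auto simp: div_ideal_def colon_def)
qed

text \<open>Taking a colon negates the divisor, so doing it twice restores D, even when
  \<open>S\<close> is smaller than the full ideal.\<close>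

lemma divisorial_hull_eq:
  assumes x: "x \<in> P" and D: "finite_at x D" and sub: "S \<subseteq> div_ideal x D"
    and att: "\<And>\<xi>. \<lbrakk>\<xi> \<in> Z; gen \<xi> x\<rbrakk> \<Longrightarrow> \<exists>f\<in>S. f \<in> Units K \<and> v \<xi> f = D \<xi>"
  shows "divisorial_hull K (B x) S = div_ideal x D"
proof -
  have "divisorial_hull K (B x) S = colon K (B x) (div_ideal x (\<lambda>\<xi>. - D \<xi>))"
    using colon_eq_div_ideal[OF x sub att] by (simp add: divisorial_hull_def)
  also have "\<dots> = div_ideal x (\<lambda>\<xi>. - (- D \<xi>))"
    by (rule colon_eq_div_ideal[OF x subset_refl]) (rule div_ideal_attains[OF x finite_at_uminus[OF D]])
  finally show ?thesis by simp
qed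

section \<open>Products and extensions of divisorial ideals\<close>

lemma subset_generated_submodule: "S \<subseteq> generated_submodule K C S"
  by (auto simp: generated_submodule_def)

lemma generated_submodule_subset:
  "\<lbrakk>is_submodule K C M; S \<subseteq> M\<rbrakk> \<Longrightarrow> generated_submodule K C S \<subseteq> M"
  by (auto simp: generated_submodule_def)

text \<open>Products of elements attaining the bounds of D and of E attain those of D + E, and no
  nonzero product falls below them; the hull then fills up to the full ideal.\<close>

lemma div_ideal_product:
  assumes x: "x \<in> P" and D: "finite_at x D" and E: "finite_at x E"
  shows "div_ideal x D \<otimes>\<^bsub>divisorial_group K (B x)\<^esub> div_ideal x E = div_ideal x (\<lambda>\<xi>. D \<xi> + E \<xi>)"
proof -
  let ?S = "div_ideal x D <#> div_ideal x E"
  have S: "?S \<subseteq> div_ideal x (\<lambda>\<xi>. D \<xi> + E \<xi>)"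
  proof
    fix h assume "h \<in> ?S"
    then obtain f g where h: "f \<in> div_ideal x D" "g \<in> div_ideal x E" "h = f \<otimes> g"
      by (auto simp: set_mult_def)
    show "h \<in> div_ideal x (\<lambda>\<xi>. D \<xi> + E \<xi>)"
    proof (cases "f = \<zero> \<or> g = \<zero>")
      case False
      then have "f \<in> Units K" "g \<in> Units K" using h Units_iff_nonzero by (auto simp: div_ideal_def)
      then show ?thesis using h False v_mult by (auto simp: div_ideal_def intro!: add_mono)
    qed (use h in \<open>auto simp: div_ideal_def\<close>)
  qed
  have "\<exists>h\<in>?S. h \<in> Units K \<and> v \<xi> h = D \<xi> + E \<xi>" if \<xi>: "\<xi> \<in> Z" "gen \<xi> x" for \<xi>
  proof -
    obtain f g where "f \<in> div_ideal x D" "f \<in> Units K" "v \<xi> f = D \<xi>"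
      "g \<in> div_ideal x E" "g \<in> Units K" "v \<xi> g = E \<xi>"
      using div_ideal_attains[OF x D \<xi>] div_ideal_attains[OF x E \<xi>] by metis
    then show ?thesis using v_mult[OF \<xi>(1)]
      by (intro bexI[of _ "f \<otimes> g"]) (auto simp: set_mult_def)
  qed
  then have "divisorial_hull K (B x) (generated_submodule K (B x) ?S) = div_ideal x (\<lambda>\<xi>. D \<xi> + E \<xi>)"
    using generated_submodule_subset[OF div_ideal_submodule[OF x] S] subset_generated_submodule
    by (intro divisorial_hull_eq[OF x finite_at_add[OF D E]]) blast+
  then show ?thesis by (simp add: divisorial_group_def)
qed

lemma div_ideal_divisorial:
  assumes x: "x \<in> P" and D: "finite_at x D"
  shows "div_ideal x D \<in> carrier (divisorial_group K (B x))"
proof -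
  \<comment> \<open>The positive part of - D: an element bounded below by it lies in
    \<open>B x\<close> and is a common denominator for the ideal of D.\<close>
  let ?E = "\<lambda>\<xi>. max 0 (- D \<xi>)"
  have "finite_at x ?E" unfolding finite_at_def
    by (rule finite_subset[OF _ D[unfolded finite_at_def]]) auto
  then obtain d where d: "d \<in> div_ideal x ?E" "d \<in> Units K" using div_ideal_nontrivial[OF x] by blast
  then have ge: "0 \<le> v \<xi> d" "- D \<xi> \<le> v \<xi> d" if "\<xi> \<in> Z" "gen \<xi> x" for \<xi>
    using that Units_iff_nonzero by (auto simp: div_ideal_def)
  have dB: "d \<in> B x" using B_iff[OF x d(2)] ge by blast
  have "d \<otimes> i \<in> B x" if i: "i \<in> div_ideal x D" for i
  proof (cases "i = \<zero>")
    case True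
    then show ?thesis using d(2) subringE(2)[OF B_subring[OF x]] by (simp add: Units_closed)
  next
    case False
    then have iU: "i \<in> Units K" using i Units_iff_nonzero by (auto simp: div_ideal_def)
    have "0 \<le> v \<xi> (d \<otimes> i)" if \<xi>: "\<xi> \<in> Z" "gen \<xi> x" for \<xi>
    proof -
      have "D \<xi> \<le> v \<xi> i" using i False \<xi> by (auto simp: div_ideal_def)
      then show ?thesis using ge[OF \<xi>] v_mult[OF \<xi>(1) d(2) iU] by simp
    qed
    then show ?thesis using hartogs[OF x] d iU by simp
  qed
  then have "fractional_ideal K (B x) (div_ideal x D)"
    unfolding fractional_ideal_def using div_ideal_submodule[OF x] dB d Units_iff_nonzero by blast
  moreover have "div_ideal x D \<noteq> {\<zero>}"
    using div_ideal_nontrivial[OF x D] Units_iff_nonzero by blast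
  moreover have "divisorial_hull K (B x) (div_ideal x D) = div_ideal x D"
    by (rule divisorial_hull_eq[OF x D subset_refl div_ideal_attains[OF x D]])
  ultimately show ?thesis by (simp add: divisorial_group_def)
qed

text \<open>A nonzero f meeting the bounds at y is \<open>inv h \<otimes> (h \<otimes> f)\<close>,
  where \<open>h \<otimes> f\<close> meets them at x and \<open>inv h\<close> lies in
  \<open>B y\<close>.\<close>

lemma generated_div_ideal:
  assumes x: "x \<in> P" and y: "y \<in> P" "gen y x" and D: "finite_at x D"
  shows "generated_submodule K (B y) (div_ideal x D) = div_ideal y D"
proof
  show "generated_submodule K (B y) (div_ideal x D) \<subseteq> div_ideal y D"
    by (rule generated_submodule_subset[OF div_ideal_submodule[OF y(1)]])
      (use gen_trans y in \<open>auto simp: div_ideal_def\<close>)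
  show "div_ideal y D \<subseteq> generated_submodule K (B y) (div_ideal x D)"
  proof
    fix f assume f: "f \<in> div_ideal y D"
    have "f \<in> M" if M: "is_submodule K (B y) M" "div_ideal x D \<subseteq> M" for M
    proof (cases "f = \<zero>")
      case True
      then show ?thesis using M(2) by (auto simp: div_ideal_def)
    next
      case False
      then have fU: "f \<in> Units K" using f Units_iff_nonzero by (auto simp: div_ideal_def)
      then have "\<exists>h\<in>B x. h \<in> Units K \<and> inv h \<in> B y \<and> h \<otimes> f \<in> div_ideal x D"
        by (rule approximation[OF x y D]) (use f False in \<open>auto simp: div_ideal_def\<close>)
      then obtain h where h: "h \<in> Units K" "inv h \<in> B y" "h \<otimes> f \<in> div_ideal x D" by blast
      then have "inv h \<otimes> (h \<otimes> f) \<in> M" using M by (auto simp: is_submodule_def)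
      then show ?thesis using Units_mult_inv_cancel(1)[OF h(1) Units_closed[OF fU]] by simp
    qed
    then show "f \<in> generated_submodule K (B y) (div_ideal x D)"
      by (auto simp: generated_submodule_def)
  qed
qed

section \<open>Divisor classes as families of ideals\<close>

definition class_at :: "'p \<Rightarrow> ('p \<Rightarrow> int) \<Rightarrow> 'a set set" where
  "class_at x D = ideal_class K (B x) (div_ideal x D)"

text \<open>A principal fractional ideal is the divisorial ideal of \<open>div f\<close>, so
  multiplying by it shifts D. The coset becomes an explicit family of ideals on which the later
  operations are computed.\<close>

lemma class_at_eq:
  assumes x: "x \<in> P" and D: "finite_at x D"
  shows "class_at x D = {div_ideal x (\<lambda>\<xi>. D \<xi> + v \<xi> f) |f. f \<in> Units K}"
proof -
  have pr: "principal_fractional_ideals K (B x) = {div_ideal x (\<lambda>\<xi>. v \<xi> f) |f. f \<in> Units K}"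
    unfolding principal_fractional_ideals_def Units_iff_nonzero[symmetric] Setcompr_eq_image
    by (intro image_cong refl) (simp add: principal_eq_div_ideal[OF x])
  have "div_ideal x (\<lambda>\<xi>. v \<xi> f) \<otimes>\<^bsub>divisorial_group K (B x)\<^esub> div_ideal x D
      = div_ideal x (\<lambda>\<xi>. D \<xi> + v \<xi> f)" if "f \<in> Units K" for f
    using div_ideal_product[OF x finite_at_v[OF x that] D] by (simp add: add.commute)
  then have "(\<lambda>I. I \<otimes>\<^bsub>divisorial_group K (B x)\<^esub> div_ideal x D) ` {div_ideal x (\<lambda>\<xi>. v \<xi> f) |f. f \<in> Units K}
      = {div_ideal x (\<lambda>\<xi>. D \<xi> + v \<xi> f) |f. f \<in> Units K}"
    unfolding Setcompr_eq_image image_image by (intro image_cong refl)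
  then show ?thesis
    unfolding class_at_def ideal_class_def r_coset_def pr UN_singleton_image .
qed

lemma class_at_add_v:
  assumes x: "x \<in> P" and D: "finite_at x D" and E: "finite_at x E" and f: "f \<in> Units K"
    and eq: "\<And>\<xi>. \<lbrakk>\<xi> \<in> Z; gen \<xi> x\<rbrakk> \<Longrightarrow> E \<xi> = D \<xi> + v \<xi> f"
  shows "class_at x E = class_at x D"
proof -
  have 1: "div_ideal x (\<lambda>\<xi>. E \<xi> + v \<xi> g) = div_ideal x (\<lambda>\<xi>. D \<xi> + v \<xi> (f \<otimes> g))"
    if "g \<in> Units K" for g
    by (rule div_ideal_cong) (use eq v_mult f that in auto)
  have 2: "div_ideal x (\<lambda>\<xi>. D \<xi> + v \<xi> g) = div_ideal x (\<lambda>\<xi>. E \<xi> + v \<xi> (inv f \<otimes> g))"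
    if "g \<in> Units K" for g
    by (rule div_ideal_cong) (use eq v_mult v_inv f that in auto)
  show ?thesis unfolding class_at_eq[OF x D] class_at_eq[OF x E]
  proof (intro equalityI subsetI)
    fix I assume "I \<in> {div_ideal x (\<lambda>\<xi>. E \<xi> + v \<xi> f) |f. f \<in> Units K}"
    then show "I \<in> {div_ideal x (\<lambda>\<xi>. D \<xi> + v \<xi> f) |f. f \<in> Units K}"
      using 1 f by blast
  next
    fix I assume "I \<in> {div_ideal x (\<lambda>\<xi>. D \<xi> + v \<xi> f) |f. f \<in> Units K}"
    then obtain g where "g \<in> Units K" "I = div_ideal x (\<lambda>\<xi>. D \<xi> + v \<xi> g)" by blast
    then show "I \<in> {div_ideal x (\<lambda>\<xi>. E \<xi> + v \<xi> f) |f. f \<in> Units K}"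
      using 2 f by blast
  qed
qed

text \<open>The class of E contains the ideal of E, the shift by \<open>div \<one> = 0\<close>. As
  this ideal also occurs among the shifts of D, \<open>div_ideal_inject\<close> compares
  coefficients.\<close>

lemma class_at_eqD:
  assumes x: "x \<in> P" and D: "finite_at x D" and E: "finite_at x E"
    and eq: "class_at x E = class_at x D"
  shows "\<exists>f\<in>Units K. \<forall>\<xi>\<in>Z. gen \<xi> x \<longrightarrow> E \<xi> = D \<xi> + v \<xi> f"
proof -
  have "div_ideal x (\<lambda>\<xi>. E \<xi> + v \<xi> \<one>) \<in> class_at x E"
    unfolding class_at_eq[OF x E] by blast
  moreover have "div_ideal x (\<lambda>\<xi>. E \<xi> + v \<xi> \<one>) = div_ideal x E"
    by (rule div_ideal_cong) (simp add: v_one)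
  ultimately have "div_ideal x E \<in> class_at x D" using eq by simp
  then obtain f where f: "f \<in> Units K" "div_ideal x E = div_ideal x (\<lambda>\<xi>. D \<xi> + v \<xi> f)"
    unfolding class_at_eq[OF x D] by blast
  then show ?thesis
    using div_ideal_inject[OF x E finite_at_add[OF D finite_at_v[OF x f(1)]] f(2)] by blast
qed

lemma class_at_carrier:
  assumes x: "x \<in> P" and D: "finite_at x D"
  shows "class_at x D \<in> carrier (class_group K (B x))"
  using div_ideal_divisorial[OF assms]
  by (auto simp: class_at_def ideal_class_def class_group_def FactGroup_def RCOSETS_def)

lemma class_at_mult:
  assumes x: "x \<in> P" and D: "finite_at x D" and E: "finite_at x E"
  shows "class_at x D \<otimes>\<^bsub>class_group K (B x)\<^esub> class_at x E = class_at x (\<lambda>\<xi>. D \<xi> + E \<xi>)"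
proof -
  have *: "div_ideal x (\<lambda>\<xi>. D \<xi> + v \<xi> f) \<otimes>\<^bsub>divisorial_group K (B x)\<^esub> div_ideal x (\<lambda>\<xi>. E \<xi> + v \<xi> g)
      = div_ideal x (\<lambda>\<xi>. D \<xi> + E \<xi> + v \<xi> (f \<otimes> g))" if "f \<in> Units K" "g \<in> Units K" for f g
  proof -
    have "div_ideal x (\<lambda>\<xi>. D \<xi> + v \<xi> f) \<otimes>\<^bsub>divisorial_group K (B x)\<^esub> div_ideal x (\<lambda>\<xi>. E \<xi> + v \<xi> g)
      = div_ideal x (\<lambda>\<xi>. (D \<xi> + v \<xi> f) + (E \<xi> + v \<xi> g))"
      using that by (intro div_ideal_product[OF x] finite_at_add finite_at_v x D E)
    also have "\<dots> = div_ideal x (\<lambda>\<xi>. D \<xi> + E \<xi> + v \<xi> (f \<otimes> g))"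
      by (rule div_ideal_cong) (use that v_mult in auto)
    finally show ?thesis .
  qed
  have "class_at x D \<otimes>\<^bsub>class_group K (B x)\<^esub> class_at x E
      = {I \<otimes>\<^bsub>divisorial_group K (B x)\<^esub> J |I J. I \<in> class_at x D \<and> J \<in> class_at x E}"
    by (auto simp: class_group_def FactGroup_def set_mult_def)
  also have "\<dots> = {div_ideal x (\<lambda>\<xi>. D \<xi> + E \<xi> + v \<xi> (f \<otimes> g)) |f g. f \<in> Units K \<and> g \<in> Units K}"
    unfolding class_at_eq[OF x D] class_at_eq[OF x E]
  proof (intro equalityI subsetI)
    fix I assume "I \<in> {I \<otimes>\<^bsub>divisorial_group K (B x)\<^esub> J |I J. I \<in> {div_ideal x (\<lambda>\<xi>. D \<xi> + v \<xi> f) |f. f \<in> Units K}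
        \<and> J \<in> {div_ideal x (\<lambda>\<xi>. E \<xi> + v \<xi> f) |f. f \<in> Units K}}"
    then obtain f g where "f \<in> Units K" "g \<in> Units K" "I = div_ideal x (\<lambda>\<xi>. D \<xi> + v \<xi> f)
      \<otimes>\<^bsub>divisorial_group K (B x)\<^esub> div_ideal x (\<lambda>\<xi>. E \<xi> + v \<xi> g)" by blast
    then show "I \<in> {div_ideal x (\<lambda>\<xi>. D \<xi> + E \<xi> + v \<xi> (f \<otimes> g)) |f g. f \<in> Units K \<and> g \<in> Units K}"
      using * by blast
  next
    fix I assume "I \<in> {div_ideal x (\<lambda>\<xi>. D \<xi> + E \<xi> + v \<xi> (f \<otimes> g)) |f g. f \<in> Units K \<and> g \<in> Units K}"
    then obtain f g where fg: "f \<in> Units K" "g \<in> Units K"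
      and "I = div_ideal x (\<lambda>\<xi>. D \<xi> + E \<xi> + v \<xi> (f \<otimes> g))" by blast
    then have "I = div_ideal x (\<lambda>\<xi>. D \<xi> + v \<xi> f)
      \<otimes>\<^bsub>divisorial_group K (B x)\<^esub> div_ideal x (\<lambda>\<xi>. E \<xi> + v \<xi> g)" using * by simp
    then show "I \<in> {I \<otimes>\<^bsub>divisorial_group K (B x)\<^esub> J |I J. I \<in> {div_ideal x (\<lambda>\<xi>. D \<xi> + v \<xi> f) |f. f \<in> Units K}
        \<and> J \<in> {div_ideal x (\<lambda>\<xi>. E \<xi> + v \<xi> f) |f. f \<in> Units K}}"
      using fg by blast
  qed
  \<comment> \<open>Shifts by \<open>f \<otimes> g\<close> run through the same ideals as shifts by
    a single f; take \<open>g = \<one>\<close> for one inclusion.\<close>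
  also have "\<dots> = {div_ideal x (\<lambda>\<xi>. D \<xi> + E \<xi> + v \<xi> f) |f. f \<in> Units K}"
  proof (intro equalityI subsetI)
    fix I assume "I \<in> {div_ideal x (\<lambda>\<xi>. D \<xi> + E \<xi> + v \<xi> f) |f. f \<in> Units K}"
    then obtain f where f: "f \<in> Units K" "I = div_ideal x (\<lambda>\<xi>. D \<xi> + E \<xi> + v \<xi> f)" by blast
    then have "I = div_ideal x (\<lambda>\<xi>. D \<xi> + E \<xi> + v \<xi> (f \<otimes> \<one>))" by (simp add: Units_closed)
    with f(1) show "I \<in> {div_ideal x (\<lambda>\<xi>. D \<xi> + E \<xi> + v \<xi> (f \<otimes> g)) |f g. f \<in> Units K \<and> g \<in> Units K}"
      using Units_one_closed by blast
  qed blast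
  also have "\<dots> = class_at x (\<lambda>\<xi>. D \<xi> + E \<xi>)"
    using class_at_eq[OF x finite_at_add[OF D E]] by simp
  finally show ?thesis .
qed

text \<open>Extending the ideal of D + div f to y gives the ideal of the same divisor at y, and
  passing to classes removes \<open>div f\<close>. The image is therefore a singleton, which makes
  \<open>the_elem\<close> meaningful.\<close>

lemma class_at_localize:
  assumes x: "x \<in> P" and y: "y \<in> P" "gen y x" and D: "finite_at x D"
  shows "the_elem ((\<lambda>I. ideal_class K (B y) (generated_submodule K (B y) I)) ` class_at x D) = class_at y D"
proof -
  have "ideal_class K (B y) (generated_submodule K (B y) (div_ideal x (\<lambda>\<xi>. D \<xi> + v \<xi> f))) = class_at y D"
    if f: "f \<in> Units K" for f
  proof -
    have "ideal_class K (B y) (generated_submodule K (B y) (div_ideal x (\<lambda>\<xi>. D \<xi> + v \<xi> f)))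
        = class_at y (\<lambda>\<xi>. D \<xi> + v \<xi> f)"
      unfolding class_at_def
      by (subst generated_div_ideal[OF x y finite_at_add[OF D finite_at_v[OF x f]]]) simp
    also have "\<dots> = class_at y D"
      by (rule class_at_add_v[OF y(1) _ _ f])
        (use finite_at_mono[OF D y(2)] finite_at_add finite_at_v y f in auto)
    finally show ?thesis .
  qed
  moreover have "Units K \<noteq> {}" by blast
  ultimately have "(\<lambda>I. ideal_class K (B y) (generated_submodule K (B y) I)) ` class_at x D = {class_at y D}"
    unfolding class_at_eq[OF x D] by blast
  then show ?thesis by simp
qed

end

section \<open>Noetherian rings mapping to a field\<close>

lemma (in noetherian_ring) ideal_chain_stabilizes:
  assumes I: "\<And>n::nat. ideal (I n) R" and le: "\<And>n. I n \<subseteq> I (Suc n)"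
  shows "\<exists>n. I (Suc n) = I n"
proof -
  have mono: "I m \<subseteq> I n" if "m \<le> n" for m n using that le by (rule lift_Suc_mono_le[rotated])
  have "subset.chain {J. ideal J R} (range I)"
    unfolding subset_chain_def
  proof (intro conjI ballI)
    fix J J' assume "J \<in> range I" "J' \<in> range I"
    then obtain m n where "J = I m" "J' = I n" by blast
    then show "J \<subseteq> J' \<or> J' \<subseteq> J" using mono[of m n] mono[of n m] nle_le[of m n] by blast
  qed (use I in blast)
  then have "\<Union> (range I) \<in> range I" by (intro ideal_chain_is_trivial) auto
  then obtain n where "\<Union> (range I) = I n" by blast
  then show ?thesis using le[of n] by blast
qed

text \<open>Zorn's lemma applies because, by the Noetherian hypothesis, the union of a nonempty
  chain of ideals belongs to the chain.\<close>

lemma (in noetherian_ring) ideal_maximal_element: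
  assumes "\<C> \<noteq> {}" and "\<And>I. I \<in> \<C> \<Longrightarrow> ideal I R"
  shows "\<exists>M\<in>\<C>. \<forall>I\<in>\<C>. M \<subseteq> I \<longrightarrow> I = M"
proof (rule subset_Zorn_nonempty[OF assms(1)])
  fix C assume C: "C \<noteq> {}" "subset.chain \<C> C"
  then have "subset.chain {I. ideal I R} C" using assms(2) by (auto simp: pred_on.chain_def)
  then have "\<Union>C \<in> C" using C(1) by (rule ideal_chain_is_trivial[rotated])
  then show "\<Union>C \<in> \<C>" using C(2) by (auto simp: pred_on.chain_def)
qed

lemma (in cring) not_prime_witness:
  assumes "ideal I R" "\<not> primeideal I R" "I \<noteq> carrier R"
  obtains a b where "a \<in> carrier R" "b \<in> carrier R" "a \<otimes> b \<in> I" "a \<notin> I" "b \<notin> I"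
  using primeidealI[OF assms(1) cring_axioms] assms(2,3) by metis

text \<open>By Noetherian induction: if \<open>a b \<in> I\<close>, a prime containing \<open>I\<close> contains \<open>I + (a)\<close>
  or \<open>I + (b)\<close>.\<close>

lemma finitely_many_primes_below:
  fixes A (structure)
  assumes "noetherian_ring A" "cring A" "ideal I A"
  shows "\<exists>F. finite F \<and> (\<forall>r\<in>F. primeideal r A \<and> I \<subseteq> r)
    \<and> (\<forall>p. primeideal p A \<and> I \<subseteq> p \<longrightarrow> (\<exists>r\<in>F. r \<subseteq> p))" (is "?Q I")
proof (rule ccontr)
  interpret noetherian_ring A by fact
  interpret cring A by fact
  define Q where "Q = (\<lambda>I. \<exists>F. finite F \<and> (\<forall>r\<in>F. primeideal r A \<and> I \<subseteq> r)
    \<and> (\<forall>p. primeideal p A \<and> I \<subseteq> p \<longrightarrow> (\<exists>r\<in>F. r \<subseteq> p)))"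
  let ?bad = "{I. ideal I A \<and> \<not> Q I}"
  assume "\<not> ?Q I"
  then have "I \<in> ?bad" using assms(3) by (simp add: Q_def)
  then have "\<exists>M\<in>?bad. \<forall>I\<in>?bad. M \<subseteq> I \<longrightarrow> I = M" by (intro ideal_maximal_element) auto
  then obtain M where M: "ideal M A" "\<not> Q M"
    and max: "\<forall>I\<in>?bad. M \<subseteq> I \<longrightarrow> I = M" by auto
  have max: "Q I" if "ideal I A" "M \<subset> I" for I using max that by blast
  have "\<not> primeideal M A"
  proof
    assume "primeideal M A"
    then have "Q M" unfolding Q_def by (intro exI[of _ "{M}"]) auto
    with M(2) show False by blast
  qed
  moreover have "M \<noteq> carrier A"
  proof
    assume "M = carrier A"
    then have "\<not> M \<subseteq> p" if "primeideal p A" for p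
      using that primeideal.I_notcarr[OF that] ideal.Icarr[OF primeideal.axioms(1)[OF that]] by blast
    then have "Q M" unfolding Q_def by (intro exI[of _ "{}"]) auto
    with M(2) show False by blast
  qed
  ultimately obtain a b where ab: "a \<in> carrier A" "b \<in> carrier A" "a \<otimes> b \<in> M" "a \<notin> M" "b \<notin> M"
    using not_prime_witness[OF M(1)] by metis
  interpret M: ideal M A by (rule M(1))
  let ?J = "\<lambda>c. M <+>\<^bsub>A\<^esub> PIdl\<^bsub>A\<^esub> c"
  have J: "ideal (?J c) A" "M \<subset> ?J c" if "c \<in> carrier A" "c \<notin> M" for c
  proof -
    have id: "ideal (PIdl c) A" using cgenideal_ideal that by blast
    show "ideal (?J c) A" using add_ideals[OF M(1) id] .
    have z: "\<zero> \<in> PIdl c" using id additive_subgroup.zero_closed ideal.axioms(1) by blast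
    have "M \<subseteq> ?J c"
    proof
      fix m assume "m \<in> M"
      then have "m = m \<oplus> \<zero>" using M.Icarr by simp
      then show "m \<in> ?J c" using \<open>m \<in> M\<close> z unfolding set_add_def' by blast
    qed
    moreover have "c \<in> ?J c"
    proof -
      have "c = \<zero> \<oplus> c" using that by simp
      then show ?thesis using cgenideal_self[OF that(1)] M.zero_closed
        unfolding set_add_def' by blast
    qed
    ultimately show "M \<subset> ?J c" using that by blast
  qed
  obtain F where F: "finite F" "\<forall>r\<in>F. primeideal r A \<and> ?J a \<subseteq> r"
    "\<forall>p. primeideal p A \<and> ?J a \<subseteq> p \<longrightarrow> (\<exists>r\<in>F. r \<subseteq> p)" using max[OF J] ab unfolding Q_def by meson
  obtain G where G: "finite G" "\<forall>r\<in>G. primeideal r A \<and> ?J b \<subseteq> r"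
    "\<forall>p. primeideal p A \<and> ?J b \<subseteq> p \<longrightarrow> (\<exists>r\<in>G. r \<subseteq> p)" using max[OF J] ab unfolding Q_def by meson
  have "\<exists>r\<in>F \<union> G. r \<subseteq> p" if p: "primeideal p A" "M \<subseteq> p" for p
  proof -
    interpret p: primeideal p A by (rule p(1))
    have J_sub: "?J c \<subseteq> p" if "c \<in> p" for c
    proof
      fix x assume "x \<in> ?J c"
      then obtain m y where "m \<in> M" "y \<in> PIdl c" "x = m \<oplus> y"
        unfolding set_add_def' by blast
      moreover have "PIdl c \<subseteq> p" using that by (simp add: cgenideal_minimal p.ideal_axioms)
      ultimately show "x \<in> p" using p(2) p.a_closed by blast
    qed
    have "a \<in> p \<or> b \<in> p" using p.I_prime ab p(2) by blast
    then show ?thesis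
    proof
      assume "a \<in> p"
      then show ?thesis using F(3) p(1) J_sub[of a] by blast
    next
      assume "b \<in> p"
      then show ?thesis using G(3) p(1) J_sub[of b] by blast
    qed
  qed
  moreover have "\<forall>r\<in>F \<union> G. primeideal r A \<and> M \<subseteq> r" using F(2) G(2) J(2) ab by blast
  ultimately have "Q M" unfolding Q_def using F(1) G(1) by (intro exI[of _ "F \<union> G"]) auto
  with M(2) show False by blast
qed

text \<open>The generator of the maximal ideal of a local ring L inside K, phrased by inverses in K:
  \<open>\<pi>\<close> is a nonzero non-unit of L dividing every nonzero non-unit. Discreteness
  comes later, from the chain condition, in \<open>uniformizer_dvr\<close>.\<close>

definition uniformizer :: "'a ring \<Rightarrow> 'a set \<Rightarrow> 'a \<Rightarrow> bool" where
  "uniformizer K L \<pi> \<longleftrightarrow> \<pi> \<in> Units K \<and> \<pi> \<in> L \<and> inv\<^bsub>K\<^esub> \<pi> \<notin> L \<and>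
     (\<forall>y\<in>L \<inter> Units K. inv\<^bsub>K\<^esub> y \<notin> L \<longrightarrow> y \<otimes>\<^bsub>K\<^esub> inv\<^bsub>K\<^esub> \<pi> \<in> L)"

text \<open>\<open>A\<close> need not be a domain; as the kernel of \<open>j\<close> lies in all primes, the primes of \<open>A\<close> are
  those of its image.  Below, \<open>loc p\<close> is the image in \<open>K\<close> of the localization at \<open>p\<close>.\<close>

locale noetherian_frac = field K + A: noetherian_ring A + A: cring A
  for A :: "'a ring" and K :: "'b ring" (structure) +
  fixes j :: "'a \<Rightarrow> 'b"
  assumes j_hom: "j \<in> ring_hom A K"
    and kernel_in_primes: "\<lbrakk>primeideal p A; a \<in> carrier A; j a = \<zero>\<rbrakk> \<Longrightarrow> a \<in> p"
    and frac: "z \<in> carrier K \<Longrightarrow> \<exists>a\<in>carrier A. \<exists>s\<in>carrier A. j s \<noteq> \<zero> \<and> z \<otimes> j s = j a"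
begin

section \<open>Local rings of A as subrings of the field\<close>

lemmas j_simps = ring_hom_closed[OF j_hom] ring_hom_mult[OF j_hom] ring_hom_add[OF j_hom] ring_hom_one[OF j_hom]

lemma j_zero: "j \<zero>\<^bsub>A\<^esub> = \<zero>"
  using ring_hom_zero[OF j_hom A.ring_axioms ring_axioms] .

lemma j_uminus: "a \<in> carrier A \<Longrightarrow> j (\<ominus>\<^bsub>A\<^esub> a) = \<ominus> j a"
  by (intro minus_equality[symmetric])
    (simp_all add: j_simps A.l_neg j_zero flip: ring_hom_add[OF j_hom])

text \<open>The difference of the two elements lies in the kernel of j, hence in every prime. So
  equations checked in K decide membership in primes of A even where j is not injective.\<close>

lemma prime_diff:
  assumes "primeideal p A" "a \<in> carrier A" "b \<in> carrier A" "j a = j b" "a \<in> p"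
  shows "b \<in> p"
proof -
  interpret p: primeideal p A by fact
  have "j (b \<oplus>\<^bsub>A\<^esub> \<ominus>\<^bsub>A\<^esub> a) = \<zero>" using assms by (simp add: j_simps j_uminus r_neg)
  then have "b \<oplus>\<^bsub>A\<^esub> \<ominus>\<^bsub>A\<^esub> a \<in> p" using assms(2,3)
    by (intro kernel_in_primes[OF assms(1)] A.a_closed A.a_inv_closed)
  then have "(b \<oplus>\<^bsub>A\<^esub> \<ominus>\<^bsub>A\<^esub> a) \<oplus>\<^bsub>A\<^esub> a \<in> p" using assms(5) by (rule p.a_closed)
  then show ?thesis using assms by (simp add: A.a_assoc A.l_neg)
qed

definition loc :: "'a set \<Rightarrow> 'b set" where
  "loc p = {z \<in> carrier K. \<exists>a\<in>carrier A. \<exists>s\<in>carrier A - p. z \<otimes> j s = j a}"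

lemma locI: "\<lbrakk>z \<in> carrier K; a \<in> carrier A; s \<in> carrier A; s \<notin> p; z \<otimes> j s = j a\<rbrakk> \<Longrightarrow> z \<in> loc p"
  unfolding loc_def by blast

lemma locE:
  assumes "z \<in> loc p"
  obtains a s where "z \<in> carrier K" "a \<in> carrier A" "s \<in> carrier A" "s \<notin> p" "z \<otimes> j s = j a"
  using assms unfolding loc_def by blast

lemma loc_subset: "loc p \<subseteq> carrier K"
  by (auto simp: loc_def)

lemma loc_mono: "p \<subseteq> q \<Longrightarrow> loc q \<subseteq> loc p"
  by (auto simp: loc_def)

lemma j_Units: "\<lbrakk>primeideal p A; s \<in> carrier A; s \<notin> p\<rbrakk> \<Longrightarrow> j s \<in> Units K"
  using kernel_in_primes Units_iff_nonzero j_simps by blast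

lemma prime_compl:
  assumes "primeideal p A"
  shows "\<one>\<^bsub>A\<^esub> \<in> carrier A - p" "\<lbrakk>s \<in> carrier A - p; t \<in> carrier A - p\<rbrakk> \<Longrightarrow> s \<otimes>\<^bsub>A\<^esub> t \<in> carrier A - p"
proof -
  interpret p: primeideal p A by fact
  show "\<one>\<^bsub>A\<^esub> \<in> carrier A - p" using p.one_imp_carrier p.I_notcarr by blast
  show "s \<otimes>\<^bsub>A\<^esub> t \<in> carrier A - p" if "s \<in> carrier A - p" "t \<in> carrier A - p"
    using p.I_prime that by blast
qed

lemma j_in_loc: "\<lbrakk>primeideal p A; a \<in> carrier A\<rbrakk> \<Longrightarrow> j a \<in> loc p"
  using prime_compl(1)[of p] by (intro locI[of _ a "\<one>\<^bsub>A\<^esub>"]) (auto simp: j_simps)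

lemma inv_j_in_loc: "\<lbrakk>primeideal p A; s \<in> carrier A; s \<notin> p\<rbrakk> \<Longrightarrow> inv (j s) \<in> loc p"
  using j_Units[of p s] by (intro locI[of _ "\<one>\<^bsub>A\<^esub>" s]) (auto simp: j_simps)

lemma loc_subring:
  assumes p: "primeideal p A"
  shows "subring (loc p) K"
proof (rule subringI)
  show "loc p \<subseteq> carrier K" by (rule loc_subset)
  show "\<one> \<in> loc p" using j_in_loc[OF p, of "\<one>\<^bsub>A\<^esub>"] by (simp add: j_simps)
  show "\<ominus> z \<in> loc p" if "z \<in> loc p" for z
  proof -
    obtain a s where "z \<in> carrier K" "a \<in> carrier A" "s \<in> carrier A - p" "z \<otimes> j s = j a"
      using \<open>z \<in> loc p\<close> by (auto simp: loc_def)
    then show ?thesis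
      by (intro locI[of _ "\<ominus>\<^bsub>A\<^esub> a" s]) (auto simp: l_minus j_simps j_uminus)
  qed
  fix y z assume "y \<in> loc p" "z \<in> loc p"
  then obtain a s b t where y: "y \<in> carrier K" "a \<in> carrier A" "s \<in> carrier A - p" "y \<otimes> j s = j a"
    and z: "z \<in> carrier K" "b \<in> carrier A" "t \<in> carrier A - p" "z \<otimes> j t = j b"
    by (auto simp: loc_def)
  have st: "s \<otimes>\<^bsub>A\<^esub> t \<in> carrier A - p" using prime_compl(2)[OF p] y z by blast
  have c: "j s \<in> carrier K" "j t \<in> carrier K" "j a \<in> carrier K" "j b \<in> carrier K"
    using y z by (auto simp: j_simps)
  have "y \<otimes> z \<otimes> j (s \<otimes>\<^bsub>A\<^esub> t) = (y \<otimes> j s) \<otimes> (z \<otimes> j t)"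
    using y(1-3) z(1-3) c by (simp add: j_simps m_ac)
  also have "\<dots> = j (a \<otimes>\<^bsub>A\<^esub> b)" by (simp only: y(4) z(4) ring_hom_mult[OF j_hom y(2) z(2)])
  finally show "y \<otimes> z \<in> loc p"
    using y z st by (intro locI[of _ "a \<otimes>\<^bsub>A\<^esub> b" "s \<otimes>\<^bsub>A\<^esub> t"]) auto
  have "(y \<oplus> z) \<otimes> j (s \<otimes>\<^bsub>A\<^esub> t) = (y \<otimes> j s) \<otimes> j t \<oplus> (z \<otimes> j t) \<otimes> j s"
    using y(1-3) z(1-3) c l_distr[of y z "j s \<otimes> j t"] by (simp add: j_simps m_ac)
  also have "\<dots> = j (a \<otimes>\<^bsub>A\<^esub> t \<oplus>\<^bsub>A\<^esub> b \<otimes>\<^bsub>A\<^esub> s)" using y z by (simp add: j_simps)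
  finally show "y \<oplus> z \<in> loc p"
    using y z st by (intro locI[of _ "a \<otimes>\<^bsub>A\<^esub> t \<oplus>\<^bsub>A\<^esub> b \<otimes>\<^bsub>A\<^esub> s" "s \<otimes>\<^bsub>A\<^esub> t"]) auto
qed

lemma loc_closed:
  assumes "primeideal p A"
  shows "\<zero> \<in> loc p" "\<one> \<in> loc p" "\<lbrakk>y \<in> loc p; z \<in> loc p\<rbrakk> \<Longrightarrow> y \<otimes> z \<in> loc p"
    "\<lbrakk>y \<in> loc p; z \<in> loc p\<rbrakk> \<Longrightarrow> y \<oplus> z \<in> loc p" "z \<in> loc p \<Longrightarrow> \<ominus> z \<in> loc p"
  using subringE[OF loc_subring[OF assms]] by auto

text \<open>If b/t represents \<open>inv z\<close>, then ab and st have the same image and st lies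
  outside p, so a does too. Conversely s/a represents the inverse.\<close>

lemma inv_in_loc_iff:
  assumes p: "primeideal p A" and z: "z \<in> Units K" and a: "a \<in> carrier A"
    and s: "s \<in> carrier A" "s \<notin> p" and eq: "z \<otimes> j s = j a"
  shows "inv z \<in> loc p \<longleftrightarrow> a \<notin> p"
proof
  interpret p: primeideal p A by (rule p)
  have c: "j s \<in> carrier K" "j a \<in> carrier K" "z \<in> carrier K" using a s z by (auto simp: j_simps)
  {
    assume "inv z \<in> loc p"
    then obtain b t where b: "b \<in> carrier A" "t \<in> carrier A - p" "inv z \<otimes> j t = j b"
      by (auto simp: loc_def)
    have tc: "j t \<in> carrier K" using b by (simp add: j_simps)
    have "j (a \<otimes>\<^bsub>A\<^esub> b) = (z \<otimes> j s) \<otimes> (inv z \<otimes> j t)" using a b eq by (simp add: j_simps)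
    also have "\<dots> = (z \<otimes> inv z) \<otimes> (j s \<otimes> j t)"
      using c tc z by (simp only: m_ac m_closed Units_inv_closed)
    also have "\<dots> = j (s \<otimes>\<^bsub>A\<^esub> t)" using z s b by (simp add: j_simps)
    finally have "j (a \<otimes>\<^bsub>A\<^esub> b) = j (s \<otimes>\<^bsub>A\<^esub> t)" .
    moreover have "s \<otimes>\<^bsub>A\<^esub> t \<notin> p" using prime_compl(2)[OF p] s b by blast
    ultimately have "a \<otimes>\<^bsub>A\<^esub> b \<notin> p"
      using prime_diff[OF p, of "a \<otimes>\<^bsub>A\<^esub> b" "s \<otimes>\<^bsub>A\<^esub> t"] a b s by auto
    then show "a \<notin> p" using p.I_r_closed b(1) by blast
  }
  assume "a \<notin> p"
  have "inv z \<otimes> j a = j s" using z c eq by (metis Units_mult_inv_cancel(1))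
  then show "inv z \<in> loc p" using \<open>a \<notin> p\<close> a s z unfolding loc_def by blast
qed

lemma inv_j_in_loc_iff:
  assumes p: "primeideal p A" and a: "a \<in> carrier A" "j a \<noteq> \<zero>"
  shows "inv (j a) \<in> loc p \<longleftrightarrow> a \<notin> p"
  using inv_in_loc_iff[OF p, of "j a" a "\<one>\<^bsub>A\<^esub>"] prime_compl(1)[OF p] a
  by (simp add: Units_iff_nonzero j_simps)

text \<open>A submodule inside \<open>loc p\<close> is recovered from its contraction to A, since
  each of its elements is \<open>inv (j s) \<otimes> j a\<close> with \<open>j a\<close> in the
  submodule and s outside p. Chains therefore stop because their contractions do.\<close>

lemma submodule_chain_stabilizes:
  assumes p: "primeideal p A" and N: "\<And>n::nat. is_submodule K (loc p) (N n)" "\<And>n. N n \<subseteq> loc p"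
    and le: "\<And>n. N n \<subseteq> N (Suc n)"
  shows "\<exists>n. N (Suc n) = N n"
proof -
  let ?J = "\<lambda>n. {a \<in> carrier A. j a \<in> N n}"
  have "ideal (?J n) A" for n
  proof -
    interpret N: additive_subgroup "N n" K using N(1) by (simp add: is_submodule_def)
    have m: "b \<otimes> m \<in> N n" if "b \<in> loc p" "m \<in> N n" for b m
      using N(1) that by (simp add: is_submodule_def)
    have neg: "\<ominus> m \<in> N n" if "m \<in> N n" for m using N.a_inv_closed that by blast
    show ?thesis
    proof (rule idealI[OF A.ring_axioms])
      show "subgroup (?J n) (add_monoid A)"
        by (rule A.add.subgroupI)
          (use neg in \<open>auto simp: j_simps j_zero j_uminus a_inv_def[symmetric] intro!: exI[of _ "\<zero>\<^bsub>A\<^esub>"]\<close>)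
      fix a x assume "a \<in> ?J n" "x \<in> carrier A"
      then show "x \<otimes>\<^bsub>A\<^esub> a \<in> ?J n" "a \<otimes>\<^bsub>A\<^esub> x \<in> ?J n"
        using m[OF j_in_loc[OF p]] by (auto simp: j_simps A.m_comm[of a x])
    qed
  qed
  then obtain n where n: "?J (Suc n) = ?J n"
    using A.ideal_chain_stabilizes[of ?J] le by (smt (verit, ccfv_SIG) Collect_mono subsetD)
  have m: "b \<otimes> m \<in> N k" if "b \<in> loc p" "m \<in> N k" for b m k
    using N(1) that by (simp add: is_submodule_def)
  have "x \<in> N n" if x: "x \<in> N (Suc n)" for x
  proof -
    have "x \<in> loc p" using x N(2) by blast
    then obtain a s where as: "x \<in> carrier K" "a \<in> carrier A" "s \<in> carrier A - p" "x \<otimes> j s = j a"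
      by (auto simp: loc_def)
    then have "j s \<otimes> x = j a" by (simp add: m_comm j_simps)
    then have "j a \<in> N (Suc n)" using m[OF j_in_loc[OF p, of s] x] as by simp
    then have "j a \<in> N n" using n as(2) by blast
    then have "inv (j s) \<otimes> j a \<in> N n" using m inv_j_in_loc[OF p] as by blast
    moreover have "inv (j s) \<otimes> j a = x"
      using Units_mult_inv_cancel(1)[OF j_Units[OF p, of s] as(1)] \<open>j s \<otimes> x = j a\<close> as by simp
    ultimately show ?thesis by simp
  qed
  then show ?thesis using le by blast
qed

end

section \<open>Maximal ideals of the local rings and integrality\<close>

context noetherian_frac
begin

text \<open>The maximal ideal of \<open>loc p\<close>. The implication admits
  \<open>\<zero>\<close>, whose inverse has no meaning.\<close>

definition nonunits :: "'a set \<Rightarrow> 'b set" where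
  "nonunits p = {z \<in> loc p. z \<in> Units K \<longrightarrow> inv z \<notin> loc p}"

lemma nonunits_iff:
  assumes p: "primeideal p A" and z: "z \<in> carrier K" and a: "a \<in> carrier A"
    and s: "s \<in> carrier A" "s \<notin> p" and eq: "z \<otimes> j s = j a"
  shows "z \<in> nonunits p \<longleftrightarrow> a \<in> p"
proof (cases "z = \<zero>")
  case True
  then have "j a = \<zero>" using eq s by (simp add: j_simps)
  then have "a \<in> p" using kernel_in_primes p a by blast
  then show ?thesis using True loc_closed(1)[OF p] by (simp add: nonunits_def Units_iff_nonzero)
next
  case False
  then have "z \<in> Units K" using z Units_iff_nonzero by blast
  then show ?thesis
    using inv_in_loc_iff[OF p _ a s eq] locI[OF z a s eq] by (simp add: nonunits_def)
qed

text \<open>By \<open>nonunits_iff\<close> membership is a condition on the numerator of any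
  presentation as a fraction, namely to lie in p; closure is then that of the ideal p.\<close>

lemma nonunits_submodule:
  assumes p: "primeideal p A"
  shows "is_submodule K (loc p) (nonunits p)"
proof -
  interpret p: primeideal p A by (rule p)
  have add: "y \<oplus> z \<in> nonunits p" if y: "y \<in> nonunits p" and z: "z \<in> nonunits p" for y z
  proof -
    obtain a s where y': "y \<in> carrier K" "a \<in> carrier A" "s \<in> carrier A" "s \<notin> p" "y \<otimes> j s = j a"
      using y by (auto simp: nonunits_def elim: locE)
    obtain b t where z': "z \<in> carrier K" "b \<in> carrier A" "t \<in> carrier A" "t \<notin> p" "z \<otimes> j t = j b"
      using z by (auto simp: nonunits_def elim: locE)
    have "a \<in> p" "b \<in> p" using nonunits_iff[OF p] y y' z z' by blast+
    have c: "j s \<in> carrier K" "j t \<in> carrier K" using y' z' by (auto simp: j_simps)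
    have "(y \<oplus> z) \<otimes> j (s \<otimes>\<^bsub>A\<^esub> t) = (y \<otimes> j s) \<otimes> j t \<oplus> (z \<otimes> j t) \<otimes> j s"
      using y'(1-3) z'(1-3) c l_distr[of y z "j s \<otimes> j t"] by (simp add: j_simps m_ac)
    also have "\<dots> = j (a \<otimes>\<^bsub>A\<^esub> t \<oplus>\<^bsub>A\<^esub> b \<otimes>\<^bsub>A\<^esub> s)" using y' z' by (simp add: j_simps)
    finally have eq: "(y \<oplus> z) \<otimes> j (s \<otimes>\<^bsub>A\<^esub> t) = j (a \<otimes>\<^bsub>A\<^esub> t \<oplus>\<^bsub>A\<^esub> b \<otimes>\<^bsub>A\<^esub> s)" .
    have st: "s \<otimes>\<^bsub>A\<^esub> t \<in> carrier A" "s \<otimes>\<^bsub>A\<^esub> t \<notin> p" using prime_compl(2)[OF p, of s t] y' z' by auto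
    have "a \<otimes>\<^bsub>A\<^esub> t \<oplus>\<^bsub>A\<^esub> b \<otimes>\<^bsub>A\<^esub> s \<in> p"
      using \<open>a \<in> p\<close> \<open>b \<in> p\<close> y'(3) z'(3) p.I_r_closed p.a_closed by blast
    then show ?thesis using nonunits_iff[OF p _ _ st eq] y' z' by auto
  qed
  have mult: "b \<otimes> z \<in> nonunits p" if b: "b \<in> loc p" and z: "z \<in> nonunits p" for b z
  proof -
    obtain a s where z': "z \<in> carrier K" "a \<in> carrier A" "s \<in> carrier A" "s \<notin> p" "z \<otimes> j s = j a"
      using z by (auto simp: nonunits_def elim: locE)
    obtain c t where b': "b \<in> carrier K" "c \<in> carrier A" "t \<in> carrier A" "t \<notin> p" "b \<otimes> j t = j c"
      using b by (auto elim: locE)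
    have "a \<in> p" using nonunits_iff[OF p] z z' by blast
    have k: "j s \<in> carrier K" "j t \<in> carrier K" using z' b' by (auto simp: j_simps)
    have "b \<otimes> z \<otimes> j (t \<otimes>\<^bsub>A\<^esub> s) = (b \<otimes> j t) \<otimes> (z \<otimes> j s)"
      using b'(1-3) z'(1-3) k by (simp add: j_simps m_ac)
    also have "\<dots> = j (c \<otimes>\<^bsub>A\<^esub> a)" by (simp only: b'(5) z'(5) ring_hom_mult[OF j_hom b'(2) z'(2)])
    finally have eq: "b \<otimes> z \<otimes> j (t \<otimes>\<^bsub>A\<^esub> s) = j (c \<otimes>\<^bsub>A\<^esub> a)" .
    have ts: "t \<otimes>\<^bsub>A\<^esub> s \<in> carrier A" "t \<otimes>\<^bsub>A\<^esub> s \<notin> p" using prime_compl(2)[OF p, of t s] z' b' by auto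
    show ?thesis using nonunits_iff[OF p _ _ ts eq] \<open>a \<in> p\<close> z' b' p.I_l_closed by auto
  qed
  have "\<zero> \<in> nonunits p"
    using loc_closed(1)[OF p] by (simp add: nonunits_def Units_iff_nonzero)
  then show ?thesis
    by (intro is_submoduleI[OF cring_axioms loc_subring[OF p]] add mult)
      (use loc_subset in \<open>auto simp: nonunits_def\<close>)
qed

text \<open>The shape of the relation in \<open>integrally_closed_domain\<close>, with the
  coefficients already inside the field, as \<open>integrally_closed_transfer\<close> expects
  it.\<close>

definition integral_over :: "'b set \<Rightarrow> 'b \<Rightarrow> bool" where
  "integral_over L z \<longleftrightarrow> (\<exists>(n::nat) c. (\<forall>i<n. c i \<in> L) \<and>
     (z [^] n) \<oplus> (\<Oplus>i\<in>{..<n}. c i \<otimes> (z [^] i)) = \<zero>)"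

text \<open>Replaces the determinant trick: the chain of submodules spanned by
  \<open>m, w m, \<dots>, w\<^sup>n m\<close> is stationary.\<close>

lemma integral_over_if_stable:
  assumes p: "primeideal p A" and w: "w \<in> carrier K"
    and stable: "\<And>x. x \<in> nonunits p \<Longrightarrow> w \<otimes> x \<in> nonunits p"
    and m: "m \<in> nonunits p" "m \<noteq> \<zero>"
  shows "integral_over (loc p) w"
proof -
  let ?L = "loc p"
  let ?s = "\<lambda>c n. (\<Oplus>i\<in>{..<n::nat}. c i \<otimes> (w [^] i))"
  \<comment> \<open>The powers of w run over exponents below n, so that stationarity from n to
    \<open>Suc n\<close> expresses the n-th power through lower ones.\<close>
  let ?N = "\<lambda>n. {?s c n \<otimes> m |c. c \<in> UNIV \<rightarrow> ?L}"
  have Lc: "z \<in> carrier K" if "z \<in> ?L" for z using that loc_subset by blast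
  have mK: "m \<in> carrier K" "m \<in> Units K" using m Lc Units_iff_nonzero by (auto simp: nonunits_def)
  have cl: "c i \<otimes> (w [^] i) \<in> carrier K" if "c \<in> UNIV \<rightarrow> ?L" for c and i :: nat
    using that Lc w by (auto simp: Pi_iff)
  have scl: "?s c n \<in> carrier K" if "c \<in> UNIV \<rightarrow> ?L" for c n
    using cl[OF that] by (intro finsum_closed) auto
  interpret M: additive_subgroup "nonunits p" K
    using nonunits_submodule[OF p] by (simp add: is_submodule_def)
  have M_mult: "b \<otimes> x \<in> nonunits p" if "b \<in> ?L" "x \<in> nonunits p" for b x
    using nonunits_submodule[OF p] that by (simp add: is_submodule_def)
  have pow: "(w [^] i) \<otimes> m \<in> nonunits p" for i :: nat
  proof (induction i)
    case (Suc i)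
    have "(w [^] Suc i) \<otimes> m = w \<otimes> ((w [^] i) \<otimes> m)" using w mK by (simp add: m_ac)
    then show ?case using stable[OF Suc] by simp
  qed (use m mK in simp)
  have suc: "?s c (Suc n) = c n \<otimes> (w [^] n) \<oplus> ?s c n" if "c \<in> UNIV \<rightarrow> ?L" for c n
    using cl[OF that] by (simp add: lessThan_Suc)
  have in_M: "?s c n \<otimes> m \<in> nonunits p" if c: "c \<in> UNIV \<rightarrow> ?L" for c n
  proof (induction n)
    case 0
    show ?case using mK M.zero_closed by simp
  next
    case (Suc n)
    have "?s c (Suc n) \<otimes> m = c n \<otimes> ((w [^] n) \<otimes> m) \<oplus> ?s c n \<otimes> m"
      unfolding suc[OF c] using cl[OF c, of n] scl[OF c] mK c Lc w
      by (simp add: l_distr m_assoc Pi_iff)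
    then show ?case using Suc M_mult[OF _ pow] M.a_closed c by (simp add: Pi_iff)
  qed
  have add: "?s c n \<oplus> ?s d n = ?s (\<lambda>i. c i \<oplus> d i) n"
    if c: "c \<in> UNIV \<rightarrow> ?L" and d: "d \<in> UNIV \<rightarrow> ?L" for c d n
  proof -
    have "?s c n \<oplus> ?s d n = (\<Oplus>i\<in>{..<n}. c i \<otimes> (w [^] i) \<oplus> d i \<otimes> (w [^] i))"
      using cl[OF c] cl[OF d] by (subst finsum_addf) auto
    also have "\<dots> = ?s (\<lambda>i. c i \<oplus> d i) n"
      using c d Lc w by (intro finsum_cong') (auto simp: l_distr Pi_iff)
    finally show ?thesis .
  qed
  have mult: "b \<otimes> ?s c n = ?s (\<lambda>i. b \<otimes> c i) n" if b: "b \<in> ?L" and c: "c \<in> UNIV \<rightarrow> ?L" for b c n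
  proof -
    have "b \<otimes> ?s c n = (\<Oplus>i\<in>{..<n}. b \<otimes> (c i \<otimes> (w [^] i)))"
      using cl[OF c] Lc b by (intro finsum_rdistr) auto
    also have "\<dots> = ?s (\<lambda>i. b \<otimes> c i) n"
      using c b Lc w by (intro finsum_cong') (auto simp: m_assoc Pi_iff)
    finally show ?thesis .
  qed
  have N_mult: "b \<otimes> x \<in> ?N n" if b: "b \<in> ?L" and x: "x \<in> ?N n" for b x n
  proof -
    obtain c where c: "c \<in> UNIV \<rightarrow> ?L" "x = ?s c n \<otimes> m" using x by blast
    have "b \<otimes> x = ?s (\<lambda>i. b \<otimes> c i) n \<otimes> m"
      unfolding c(2) mult[OF b c(1), symmetric] using scl[OF c(1)] b Lc mK by (simp add: m_assoc)
    moreover have "(\<lambda>i. b \<otimes> c i) \<in> UNIV \<rightarrow> ?L" using b c loc_closed(3)[OF p] by (auto simp: Pi_iff)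
    ultimately show ?thesis by (intro CollectI exI[of _ "\<lambda>i. b \<otimes> c i"] conjI)
  qed
  have N_add: "x \<oplus> y \<in> ?N n" if x: "x \<in> ?N n" and y: "y \<in> ?N n" for x y n
  proof -
    obtain c d where c: "c \<in> UNIV \<rightarrow> ?L" "x = ?s c n \<otimes> m" and d: "d \<in> UNIV \<rightarrow> ?L" "y = ?s d n \<otimes> m"
      using x y by blast
    have "x \<oplus> y = ?s (\<lambda>i. c i \<oplus> d i) n \<otimes> m"
      unfolding c(2) d(2) add[OF c(1) d(1), symmetric] using scl[OF c(1)] scl[OF d(1)] mK
      by (simp add: l_distr)
    moreover have "(\<lambda>i. c i \<oplus> d i) \<in> UNIV \<rightarrow> ?L" using d c loc_closed(4)[OF p] by (auto simp: Pi_iff)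
    ultimately show ?thesis by (intro CollectI exI[of _ "\<lambda>i. c i \<oplus> d i"] conjI)
  qed
  \<comment> \<open>Stability under w keeps the whole chain inside the maximal ideal, hence inside
    \<open>loc p\<close>, where chains of submodules stop.\<close>
  have N_sub: "?N n \<subseteq> nonunits p" for n using in_M by blast
  have N_carr: "?N n \<subseteq> carrier K" for n using N_sub M.a_subset by blast
  have "is_submodule K ?L (?N n)" for n
  proof (rule is_submoduleI[OF cring_axioms loc_subring[OF p] N_carr])
    have "?s (\<lambda>_. \<zero>) n \<otimes> m \<in> ?N n"
      using loc_closed(1)[OF p] by (intro CollectI exI[of _ "\<lambda>_. \<zero>"]) simp
    then show "?N n \<noteq> {}" by blast
  qed (fact N_add, fact N_mult)
  moreover have "?N n \<subseteq> ?L" for n using N_sub by (auto simp: nonunits_def)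
  moreover have "?N n \<subseteq> ?N (Suc n)" for n
  proof
    fix x assume "x \<in> ?N n"
    then obtain c where c: "c \<in> UNIV \<rightarrow> ?L" "x = ?s c n \<otimes> m" by blast
    let ?d = "\<lambda>i. if i < n then c i else \<zero>"
    have d: "?d \<in> UNIV \<rightarrow> ?L" using c loc_closed(1)[OF p] by (auto simp: Pi_iff)
    have "?s ?d n = ?s c n" using cl[OF c(1)] by (intro finsum_cong') auto
    then have "?s ?d (Suc n) = ?s c n" unfolding suc[OF d] using scl[OF c(1)] w by simp
    then have "x = ?s ?d (Suc n) \<otimes> m" using c(2) by simp
    then show "x \<in> ?N (Suc n)" using d by (intro CollectI exI[of _ ?d] conjI)
  qed
  ultimately obtain n where n: "?N (Suc n) = ?N n" using submodule_chain_stabilizes[OF p, of ?N] by blast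
  \<comment> \<open>Coefficients of the top term alone, which place
    \<open>(w [^] n) \<otimes> m\<close> in \<open>?N (Suc n)\<close>.\<close>
  let ?e = "\<lambda>i. if i = n then \<one> else \<zero>"
  have e: "?e \<in> UNIV \<rightarrow> ?L" using loc_closed(1,2)[OF p] by auto
  have "?s ?e n = (\<Oplus>i\<in>{..<n}. \<zero>)" using w by (intro finsum_cong') auto
  then have "?s ?e (Suc n) = w [^] n" unfolding suc[OF e] using w by simp
  then have "(w [^] n) \<otimes> m = ?s ?e (Suc n) \<otimes> m" by simp
  then have "(w [^] n) \<otimes> m \<in> ?N (Suc n)" using e by (intro CollectI exI[of _ ?e] conjI)
  then obtain c where c: "c \<in> UNIV \<rightarrow> ?L" "(w [^] n) \<otimes> m = ?s c n \<otimes> m" unfolding n by blast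
  have eq: "w [^] n = ?s c n"
    using c(2) m_rcancel[OF m(2) mK(1) _ scl[OF c(1)], of "w [^] n" n] w by simp
  \<comment> \<open>After m is cancelled, the lower terms move to the other side and give a monic
    relation.\<close>
  let ?d = "\<lambda>i. \<ominus> \<one> \<otimes> c i"
  have m1: "\<ominus> \<one> \<in> ?L" using loc_closed[OF p] by blast
  have d: "\<forall>i<n. ?d i \<in> ?L" using loc_closed(3)[OF p m1] c(1) by (simp add: Pi_iff)
  have wn: "w [^] n \<in> carrier K" using w by simp
  have "?s ?d n = \<ominus> \<one> \<otimes> (w [^] n)" using mult[OF m1 c(1), of n] eq by simp
  also have "\<dots> = \<ominus> (w [^] n)" using wn by (simp only: l_minus one_closed l_one)
  finally have "(w [^] n) \<oplus> ?s ?d n = \<zero>" using wn by (simp only: r_neg)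
  then show ?thesis unfolding integral_over_def using d by (intro exI[of _ n] exI[of _ ?d] conjI)
qed

end

text \<open>Normality is imposed on all local rings rather than on A, matching the stalkwise
  definition of a normal scheme.\<close>

locale normal_noetherian_frac = noetherian_frac A K j for A and K (structure) and j +
  assumes normal: "\<lbrakk>primeideal p A; z \<in> carrier K; integral_over (loc p) z\<rbrakk> \<Longrightarrow> z \<in> loc p"
begin

text \<open>The maximal conductor of an element of \<open>A z\<close> into \<open>loc p\<close> is a prime ideal, at
  which the local ring is a discrete valuation ring.\<close>

lemma hartogs:
  assumes p: "primeideal p A" and z: "z \<in> carrier K" "z \<notin> loc p"
  shows "\<exists>q \<pi>. primeideal q A \<and> q \<subseteq> p \<and> z \<notin> loc q \<and> uniformizer K (loc q) \<pi>"
proof -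
  \<comment> \<open>\<open>?C w\<close> consists of the denominators bringing w into
    \<open>loc p\<close>; \<open>?W\<close> collects the multiples of z by elements of A that are
    still outside.\<close>
  let ?C = "\<lambda>w. {a \<in> carrier A. j a \<otimes> w \<in> loc p}"
  let ?W = "{j c \<otimes> z |c. c \<in> carrier A \<and> j c \<otimes> z \<notin> loc p}"
  have C_ideal: "ideal (?C w) A" if w: "w \<in> carrier K" for w
  proof (rule A.cring_idealI)
    show "?C w \<noteq> {}" using w loc_closed(1)[OF p] by (auto simp: j_zero intro!: exI[of _ "\<zero>\<^bsub>A\<^esub>"])
    show "a \<oplus>\<^bsub>A\<^esub> b \<in> ?C w" if "a \<in> ?C w" "b \<in> ?C w" for a b
      using that w loc_closed(4)[OF p, of "j a \<otimes> w" "j b \<otimes> w"] by (simp add: j_simps l_distr)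
    show "x \<otimes>\<^bsub>A\<^esub> a \<in> ?C w" if "x \<in> carrier A" "a \<in> ?C w" for a x
      using that w loc_closed(3)[OF p j_in_loc[OF p], of x "j a \<otimes> w"] by (simp add: j_simps m_assoc)
  qed blast
  have W_carr: "w \<in> carrier K" if "w \<in> ?W" for w using that z by (auto simp: j_simps)
  have "j \<one>\<^bsub>A\<^esub> \<otimes> z \<notin> loc p" using z by (simp add: j_simps)
  then have "?C ` ?W \<noteq> {}" by blast
  then have "\<exists>M\<in>?C ` ?W. \<forall>I\<in>?C ` ?W. M \<subseteq> I \<longrightarrow> I = M"
    by (rule A.ideal_maximal_element) (use C_ideal W_carr in blast)
  then obtain w where w: "w \<in> ?W" and "\<forall>I\<in>?C ` ?W. ?C w \<subseteq> I \<longrightarrow> I = ?C w"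
    by (elim bexE imageE) simp
  then have max: "?C w' = ?C w" if "w' \<in> ?W" "?C w \<subseteq> ?C w'" for w'
    using that by (metis (no_types, lifting) imageI)
  obtain c where c: "c \<in> carrier A" "w = j c \<otimes> z" "w \<notin> loc p" using w by blast
  have wK: "w \<in> carrier K" using W_carr w by blast
  define q where "q = ?C w"
  have q: "primeideal q A"
  proof (rule primeidealI)
    show "ideal q A" unfolding q_def using C_ideal wK by blast
    show "cring A" by (rule A.is_cring)
    have "\<one>\<^bsub>A\<^esub> \<notin> q" using c(3) wK by (simp add: q_def j_simps)
    then show "carrier A \<noteq> q" by blast
    fix a b assume a: "a \<in> carrier A" and b: "b \<in> carrier A" and ab: "a \<otimes>\<^bsub>A\<^esub> b \<in> q"
    show "a \<in> q \<or> b \<in> q"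
    proof (rule disjCI)
      assume "b \<notin> q"
      then have nb: "j b \<otimes> w \<notin> loc p" using b by (simp add: q_def)
      have "j b \<otimes> w = j (b \<otimes>\<^bsub>A\<^esub> c) \<otimes> z" using b c z by (simp add: j_simps m_assoc)
      then have bw: "j b \<otimes> w \<in> ?W" using nb b c by (metis (mono_tags, lifting) A.m_closed mem_Collect_eq)
      \<comment> \<open>Passing from w to \<open>j b \<otimes> w\<close> can only enlarge the
        conductor; maximality leaves it unchanged, although it now contains a.\<close>
      have "?C w \<subseteq> ?C (j b \<otimes> w)"
      proof
        fix x assume x: "x \<in> ?C w"
        then have "j b \<otimes> (j x \<otimes> w) \<in> loc p" using j_in_loc[OF p b] loc_closed(3)[OF p] by blast
        then show "x \<in> ?C (j b \<otimes> w)" using x b wK by (simp add: m_lcomm j_simps)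
      qed
      then have "?C (j b \<otimes> w) = ?C w" using max[OF bw] by blast
      moreover have "a \<in> ?C (j b \<otimes> w)" using a b ab wK by (simp add: q_def j_simps m_assoc)
      ultimately show "a \<in> q" unfolding q_def by blast
    qed
  qed
  have "q \<subseteq> p"
  proof
    fix a assume a: "a \<in> q"
    show "a \<in> p"
    proof (rule ccontr)
      assume na: "a \<notin> p"
      have aA: "a \<in> carrier A" "j a \<otimes> w \<in> loc p" using a by (auto simp: q_def)
      have "inv (j a) \<otimes> (j a \<otimes> w) \<in> loc p"
        using inv_j_in_loc[OF p aA(1) na] aA(2) loc_closed(3)[OF p] by blast
      then show False using c(3) Units_mult_inv_cancel(1)[OF j_Units[OF p aA(1) na] wK] by simp
    qed
  qed
  then have pq: "loc p \<subseteq> loc q" by (rule loc_mono)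
  \<comment> \<open>A denominator s outside q would satisfy \<open>j s \<otimes> w = j a\<close>, an
    element of \<open>loc p\<close>, so s would belong to the conductor q.\<close>
  have w_notin: "w \<notin> loc q"
  proof
    assume "w \<in> loc q"
    then obtain a s where s: "a \<in> carrier A" "s \<in> carrier A" "s \<notin> q" "w \<otimes> j s = j a" by (rule locE)
    then have "j s \<otimes> w = j a" using wK by (simp add: m_comm j_simps)
    then show False using s j_in_loc[OF p s(1)] by (simp add: q_def)
  qed
  then have z_notin: "z \<notin> loc q" using c(2) j_in_loc[OF q c(1)] loc_closed(3)[OF q] by blast
  \<comment> \<open>Non-units have numerators in the conductor q, which w carries into
    \<open>loc p\<close> and so into \<open>loc q\<close>.\<close>
  have w_m: "w \<otimes> x \<in> loc q" if x: "x \<in> nonunits q" for x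
  proof -
    obtain a s where as: "x \<in> carrier K" "a \<in> carrier A" "s \<in> carrier A" "s \<notin> q" "x \<otimes> j s = j a"
      using x by (auto simp: nonunits_def elim: locE)
    then have "a \<in> q" using nonunits_iff[OF q] x by blast
    then have aw: "j a \<otimes> w \<in> loc q" using pq by (auto simp: q_def)
    have u: "j s \<in> Units K" using j_Units[OF q as(3,4)] .
    have k: "j s \<in> carrier K" using u by blast
    have "w \<otimes> x = inv (j s) \<otimes> (j s \<otimes> (w \<otimes> x))"
      using Units_mult_inv_cancel(1)[OF u, of "w \<otimes> x"] wK as(1) by simp
    also have "j s \<otimes> (w \<otimes> x) = (x \<otimes> j s) \<otimes> w" using k wK as(1) by (simp add: m_ac)
    also have "\<dots> = j a \<otimes> w" using as(5) by simp
    finally show ?thesis using loc_closed(3)[OF q inv_j_in_loc[OF q as(3,4)] aw] by simp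
  qed
  obtain b s where bs: "b \<in> carrier A" "s \<in> carrier A" "j s \<noteq> \<zero>" "w \<otimes> j s = j b"
    using frac[OF wK] by blast
  have "j s \<otimes> w = j b" using bs wK by (simp add: m_comm j_simps)
  then have "s \<in> q" using bs j_in_loc[OF p] by (simp add: q_def)
  then have m0: "j s \<in> nonunits q"
    using nonunits_iff[OF q, of "j s" s "\<one>\<^bsub>A\<^esub>"] prime_compl(1)[OF q] bs by (simp add: j_simps)
  \<comment> \<open>If w preserved the maximal ideal, it would be integral over \<open>loc q\<close>
    and lie in it by normality. So some \<open>w \<otimes> x\<close> is a unit of
    \<open>loc q\<close>, which puts \<open>inv w\<close> into \<open>loc q\<close> and makes it the
    uniformizer.\<close>
  have "\<not> (\<forall>x\<in>nonunits q. w \<otimes> x \<in> nonunits q)"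
    using integral_over_if_stable[OF q wK _ m0 bs(3)] normal[OF q wK] w_notin by blast
  then obtain x where x: "x \<in> nonunits q" "w \<otimes> x \<notin> nonunits q" by blast
  then have wx: "w \<otimes> x \<in> Units K" "inv (w \<otimes> x) \<in> loc q" using w_m[OF x(1)] by (auto simp: nonunits_def)
  have xK: "x \<in> carrier K" using x loc_subset by (auto simp: nonunits_def)
  have wU: "w \<in> Units K" "x \<in> Units K" using wx(1) xK wK by (auto simp: Units_iff_nonzero)
  have "x \<otimes> inv (w \<otimes> x) = inv w \<otimes> (x \<otimes> inv x)"
    unfolding Units_inv_mult[OF wU] using wU xK by (intro m_lcomm) auto
  then have "inv w = x \<otimes> inv (w \<otimes> x)" using wU by simp
  then have "inv w \<in> loc q" using loc_closed(3)[OF q _ wx(2), of x] x(1) by (simp add: nonunits_def)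
  moreover have "y \<otimes> inv (inv w) \<in> loc q" if "y \<in> loc q \<inter> Units K" "inv y \<notin> loc q" for y
    using w_m[of y] that wU Units_closed by (auto simp: nonunits_def m_comm)
  ultimately have "uniformizer K (loc q) (inv w)"
    unfolding uniformizer_def using wU w_notin by auto
  then show ?thesis using q \<open>q \<subseteq> p\<close> z_notin by blast
qed

end

section \<open>Discrete valuation rings and primes of height one\<close>

context field
begin

text \<open>Integer powers have their laws in the group \<open>units_of R\<close>; this equation
  carries them over to units of the field.\<close>

lemma Units_int_pow_eq:
  assumes x: "x \<in> Units R"
  shows "x [^] (n::int) = x [^]\<^bsub>units_of R\<^esub> n"
proof -
  have "x [^] (k::nat) \<in> Units R" for k
    using x by (induction k) auto
  then show ?thesis using x by (simp add: int_pow_def2 units_of_pow units_of_inv del: pow_nat)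
qed

lemma Units_int_pow_closed: "x \<in> Units R \<Longrightarrow> x [^] (n::int) \<in> Units R"
  using group.int_pow_closed[OF units_group, of x n] by (simp add: Units_int_pow_eq units_of_carrier)

lemma Units_int_pow_add: "x \<in> Units R \<Longrightarrow> x [^] (m + n :: int) = x [^] m \<otimes> x [^] n"
  using group.int_pow_mult[OF units_group, of x m n]
  by (simp add: Units_int_pow_eq units_of_carrier units_of_mult)

lemma Units_int_pow_distrib:
  "\<lbrakk>x \<in> Units R; y \<in> Units R\<rbrakk> \<Longrightarrow> (x \<otimes> y) [^] (n :: int) = x [^] n \<otimes> y [^] n"
  using comm_group.int_pow_distrib[OF units_comm_group, of x y n]
  by (simp add: Units_int_pow_eq units_of_carrier units_of_mult)

lemma Units_int_pow_neg: "x \<in> Units R \<Longrightarrow> x [^] (- n :: int) = inv (x [^] n)"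
  using group.int_pow_neg[OF units_group, of x n] Units_int_pow_closed[of x n]
  by (simp add: Units_int_pow_eq units_of_carrier units_of_inv)

lemma Units_int_pow_one: "x \<in> Units R \<Longrightarrow> x [^] (1 :: int) = x"
  using group.int_pow_1[OF units_group, of x] by (simp add: Units_int_pow_eq units_of_carrier)

end

text \<open>Existence of the factorization is assumed and its uniqueness proved below; together they
  identify \<open>dvr_valuation\<close> with the exponent of \<pi>.\<close>

locale dvr_in_field = field K for K :: "'a ring" (structure) +
  fixes L :: "'a set" and \<pi> :: 'a
  assumes L_subring: "subring L K"
    and unif: "uniformizer K L \<pi>"
    and factor: "f \<in> Units K \<Longrightarrow> \<exists>(n::int). \<exists>u\<in>L \<inter> Units K. inv u \<in> L \<and> f = u \<otimes> \<pi> [^] n"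
begin

abbreviation "U \<equiv> {u \<in> L \<inter> Units K. inv u \<in> L}"

lemma L_closed: "\<one> \<in> L" "\<lbrakk>x \<in> L; y \<in> L\<rbrakk> \<Longrightarrow> x \<otimes> y \<in> L" "L \<subseteq> carrier K" "\<zero> \<in> L"
  using subringE[OF L_subring] by auto

lemma \<pi>: "\<pi> \<in> Units K" "\<pi> \<in> L" "inv \<pi> \<notin> L"
  using unif by (auto simp: uniformizer_def)

lemma U_mult: "\<lbrakk>u \<in> U; w \<in> U\<rbrakk> \<Longrightarrow> u \<otimes> w \<in> U"
  using L_closed(2) by (simp add: Units_inv_mult)

lemma U_inv: "u \<in> U \<Longrightarrow> inv u \<in> U"
  by auto

lemma U_nat_pow: "u \<in> U \<Longrightarrow> u [^] (n::nat) \<in> U"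
proof (induction n)
  case (Suc n)
  then show ?case using U_mult[of "u [^] n" u] by simp
qed (use L_closed in auto)

lemma U_int_pow: "u \<in> U \<Longrightarrow> u [^] (n::int) \<in> U"
  using U_nat_pow U_inv by (simp only: int_pow_def2 split: if_split) blast

lemma \<pi>_pow_in_L: "\<pi> [^] n \<in> L \<longleftrightarrow> 0 \<le> (n::int)"
proof
  have nat: "\<pi> [^] (k::nat) \<in> L" for k
    using \<pi> L_closed by (induction k) auto
  then have nonneg: "\<pi> [^] k \<in> L" if "0 \<le> k" for k :: int
    using that by (simp add: int_pow_def2 del: pow_nat)
  then show "0 \<le> n \<Longrightarrow> \<pi> [^] n \<in> L" .
  show "0 \<le> n" if n: "\<pi> [^] n \<in> L"
  proof (rule ccontr)
    assume "\<not> 0 \<le> n"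
    \<comment> \<open>The exponent \<open>- n - 1\<close> is nonnegative, and the product is the
      inverse of \<pi>.\<close>
    then have "\<pi> [^] (- n - 1) \<otimes> \<pi> [^] n \<in> L" using n nonneg L_closed(2) by simp
    then have "\<pi> [^] (- 1 :: int) \<in> L" using Units_int_pow_add[OF \<pi>(1), of "- n - 1" n] by simp
    then show False using \<pi>(3) Units_int_pow_neg[OF \<pi>(1), of 1] Units_int_pow_one[OF \<pi>(1)] by simp
  qed
qed

lemma U_\<pi>_pow_in_L:
  assumes u: "u \<in> U"
  shows "u \<otimes> \<pi> [^] n \<in> L \<longleftrightarrow> 0 \<le> (n::int)"
proof -
  have c: "u \<in> Units K" "\<pi> [^] n \<in> carrier K" using u Units_int_pow_closed[OF \<pi>(1)] by auto
  have "\<pi> [^] n \<in> L" if "u \<otimes> \<pi> [^] n \<in> L"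
    using L_closed(2)[OF _ that, of "inv u"] u Units_mult_inv_cancel(1)[OF c] by simp
  then show ?thesis using \<pi>_pow_in_L L_closed(2) u by blast
qed

text \<open>Dividing one factorization by the other puts a unit times
  \<open>\<pi> [^] (n - m)\<close> into L, so \<open>m \<le> n\<close>; the situation is
  symmetric.\<close>

lemma \<pi>_pow_unique:
  assumes u: "u \<in> U" and w: "w \<in> U" and eq: "u \<otimes> \<pi> [^] m = w \<otimes> \<pi> [^] (n::int)"
  shows "m = n"
proof -
  have "m \<le> n" if u: "u \<in> U" and w: "w \<in> U" and eq: "u \<otimes> \<pi> [^] m = w \<otimes> \<pi> [^] (n::int)" for u w m n
  proof -
    have c: "u \<in> carrier K" "w \<in> carrier K" "\<pi> [^] k \<in> carrier K" for k :: int
      using u w Units_int_pow_closed[OF \<pi>(1)] by auto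
    have "u = u \<otimes> \<pi> [^] m \<otimes> \<pi> [^] (- m)"
      using c(1,3) Units_int_pow_add[OF \<pi>(1), of m "- m", symmetric] by (simp add: m_assoc)
    also have "\<dots> = w \<otimes> \<pi> [^] (n - m)"
      unfolding eq using c(2,3) Units_int_pow_add[OF \<pi>(1), of n "- m", symmetric] by (simp add: m_assoc)
    finally have "w \<otimes> \<pi> [^] (n - m) \<in> L" using u by auto
    then show ?thesis using U_\<pi>_pow_in_L[OF w] by auto
  qed
  from this[OF u w eq] this[OF w u eq[symmetric]] show ?thesis by simp
qed

lemma Units_L: "Units (K\<lparr>carrier := L\<rparr>) = U"
proof (intro equalityI subsetI)
  fix u assume "u \<in> Units (K\<lparr>carrier := L\<rparr>)"
  then obtain w where w: "u \<in> L" "w \<in> L" "u \<otimes> w = \<one>" "w \<otimes> u = \<one>" by (auto simp: Units_def)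
  then have c: "u \<in> carrier K" "w \<in> carrier K" using L_closed by auto
  then have "u \<in> Units K" using w by (auto simp: Units_def)
  moreover have "inv u = w" using comm_inv_char c w by blast
  ultimately show "u \<in> U" using w by auto
next
  fix u assume "u \<in> U"
  then have "u \<in> L" "inv u \<in> L" "inv u \<otimes> u = \<one>" "u \<otimes> inv u = \<one>" by auto
  then show "u \<in> Units (K\<lparr>carrier := L\<rparr>)" unfolding Units_def by auto
qed

lemma cgenideal_L: "PIdl\<^bsub>K\<lparr>carrier := L\<rparr>\<^esub> x = (\<lambda>y. y \<otimes> x) ` L"
  by (auto simp: cgenideal_def)

text \<open>Links \<open>uniformizer\<close>, stated through inverses in K, with the principal ideal
  that \<open>dvr_valuation\<close> speaks of.\<close>

lemma nonunits_L: "L - U = (\<lambda>y. y \<otimes> \<pi>) ` L"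
proof (intro equalityI subsetI)
  fix y assume y: "y \<in> L - U"
  show "y \<in> (\<lambda>y. y \<otimes> \<pi>) ` L"
  proof (cases "y = \<zero>")
    case True
    then show ?thesis using L_closed \<pi> by (intro image_eqI[of _ _ \<zero>]) auto
  next
    case False
    then have yU: "y \<in> Units K" using y L_closed Units_iff_nonzero by auto
    then have "y \<otimes> inv \<pi> \<in> L" using y unif by (auto simp: uniformizer_def)
    moreover have "y = y \<otimes> inv \<pi> \<otimes> \<pi>" using yU \<pi>(1) by (simp add: m_assoc Units_closed)
    ultimately show ?thesis by blast
  qed
next
  fix y assume "y \<in> (\<lambda>y. y \<otimes> \<pi>) ` L"
  then obtain x where x: "x \<in> L" "y = x \<otimes> \<pi>" by blast
  have xK: "x \<in> carrier K" using x L_closed by blast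
  have "y \<notin> U"
  proof
    assume yU: "y \<in> U"
    then have "y \<noteq> \<zero>" using Units_iff_nonzero by blast
    then have xU: "x \<in> Units K" using x(2) xK \<pi>(1) by (auto simp: Units_iff_nonzero)
    have "x \<otimes> inv y = inv \<pi>"
      unfolding x(2) Units_inv_mult[OF xU \<pi>(1)]
      using Units_mult_inv_cancel(2)[OF xU, of "inv \<pi>"] \<pi>(1) by simp
    moreover have "x \<otimes> inv y \<in> L" using x(1) yU L_closed(2)[of x "inv y"] by simp
    ultimately show False using \<pi>(3) by simp
  qed
  then show "y \<in> L - U" using x \<pi> L_closed by blast
qed

text \<open>The definition of \<open>dvr_valuation\<close> leaves the generator of the maximal ideal
  open. Any other generator is \<open>b \<otimes> \<pi>\<close> with b a unit of L, and
  \<open>b [^] m\<close> is absorbed into the unit factor, so the exponent stays the same.\<close>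

lemma dvr_valuation_eq:
  assumes u: "u \<in> U"
  shows "dvr_valuation K L (u \<otimes> \<pi> [^] (n::int)) = n"
  unfolding dvr_valuation_def Let_def Units_L
proof (rule the_equality)
  show "\<exists>\<pi>'\<in>L. \<exists>w\<in>U. L - U = PIdl\<^bsub>K\<lparr>carrier := L\<rparr>\<^esub> \<pi>' \<and> u \<otimes> \<pi> [^] n = w \<otimes> \<pi>' [^] n"
    using \<pi> u by (intro bexI[of _ \<pi>] bexI[of _ u]) (simp_all only: cgenideal_L nonunits_L)
next
  fix m :: int
  assume "\<exists>\<pi>'\<in>L. \<exists>w\<in>U. L - U = PIdl\<^bsub>K\<lparr>carrier := L\<rparr>\<^esub> \<pi>' \<and> u \<otimes> \<pi> [^] n = w \<otimes> \<pi>' [^] m"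
  then obtain \<pi>' w where w: "\<pi>' \<in> L" "w \<in> U" "L - U = (\<lambda>y. y \<otimes> \<pi>') ` L"
    "u \<otimes> \<pi> [^] n = w \<otimes> \<pi>' [^] m" unfolding cgenideal_L by blast
  have \<pi>'K: "\<pi>' \<in> carrier K" using w(1) L_closed(3) by blast
  have eq: "(\<lambda>y. y \<otimes> \<pi>) ` L = (\<lambda>y. y \<otimes> \<pi>') ` L" using w(3) nonunits_L by (rule trans[OF sym, rotated])
  have "\<pi> \<in> (\<lambda>y. y \<otimes> \<pi>) ` L" using L_closed(1) \<pi>(1) by (intro image_eqI[of _ _ \<one>]) auto
  then obtain a where a: "a \<in> L" "\<pi> = a \<otimes> \<pi>'" unfolding eq by (elim imageE)
  have "\<pi>' \<in> (\<lambda>y. y \<otimes> \<pi>') ` L" using L_closed(1) \<pi>'K by (intro image_eqI[of _ _ \<one>]) auto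
  then obtain b where b: "b \<in> L" "\<pi>' = b \<otimes> \<pi>" unfolding eq[symmetric] by (elim imageE)
  note ab = a(1) b(1) a(2) b(2)
  have c: "a \<in> carrier K" "b \<in> carrier K" using ab L_closed by auto
  have "(a \<otimes> b) \<otimes> \<pi> = a \<otimes> \<pi>'" unfolding b(2) using c \<pi>(1) by (simp add: m_assoc Units_closed)
  also have "\<dots> = \<one> \<otimes> \<pi>" using a(2) \<pi>(1) by (simp add: Units_closed)
  finally have "(a \<otimes> b) \<otimes> \<pi> = \<one> \<otimes> \<pi>" .
  then have ab1: "a \<otimes> b = \<one>"
    using m_rcancel[of \<pi> "a \<otimes> b" \<one>] \<pi>(1)[unfolded Units_iff_nonzero] c by simp
  then have "b \<in> Units K" "inv b = a" using c comm_inv_char[of b a] by (auto simp: Units_def m_comm)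
  then have bU: "b \<in> U" using ab by simp
  have "u \<otimes> \<pi> [^] n = w \<otimes> b [^] m \<otimes> \<pi> [^] m"
    using w(2,4) ab(4) bU \<pi>(1) Units_int_pow_distrib[of b \<pi> m] Units_int_pow_closed[of b m]
      Units_int_pow_closed[of \<pi> m] by (simp add: m_assoc Units_closed)
  then show "m = n" using \<pi>_pow_unique[OF u U_mult[OF w(2) U_int_pow[OF bU, of m]]] by metis
qed

lemma factor_valuation:
  assumes "f \<in> Units K"
  obtains u where "u \<in> U" "f = u \<otimes> \<pi> [^] (dvr_valuation K L f)"
proof -
  obtain n :: int and u where "u \<in> U" "f = u \<otimes> \<pi> [^] n" using factor[OF assms] by blast
  then have "u \<in> U" "f = u \<otimes> \<pi> [^] (dvr_valuation K L f)" using dvr_valuation_eq[of u n] by simp_all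
  then show ?thesis by (rule that)
qed

lemma valuation_mult:
  assumes f: "f \<in> Units K" and g: "g \<in> Units K"
  shows "dvr_valuation K L (f \<otimes> g) = dvr_valuation K L f + dvr_valuation K L g"
proof -
  let ?v = "dvr_valuation K L"
  obtain u where u: "u \<in> U" "f = u \<otimes> \<pi> [^] ?v f" using factor_valuation[OF f] .
  obtain w where w: "w \<in> U" "g = w \<otimes> \<pi> [^] ?v g" using factor_valuation[OF g] .
  have c: "u \<in> carrier K" "w \<in> carrier K" "\<pi> [^] k \<in> carrier K" for k :: int
    using u w Units_int_pow_closed[OF \<pi>(1)] by auto
  have "f \<otimes> g = (u \<otimes> \<pi> [^] ?v f) \<otimes> (w \<otimes> \<pi> [^] ?v g)" using u w by simp
  also have "\<dots> = u \<otimes> w \<otimes> (\<pi> [^] ?v f \<otimes> \<pi> [^] ?v g)" using c by (simp add: m_ac)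
  also have "\<dots> = u \<otimes> w \<otimes> \<pi> [^] (?v f + ?v g)" using Units_int_pow_add[OF \<pi>(1)] by simp
  finally show ?thesis using dvr_valuation_eq[OF U_mult[OF u(1) w(1)]] by simp
qed

lemma valuation_nonneg:
  assumes f: "f \<in> Units K"
  shows "f \<in> L \<longleftrightarrow> 0 \<le> dvr_valuation K L f"
proof -
  obtain u where u: "u \<in> U" "f = u \<otimes> \<pi> [^] dvr_valuation K L f" using factor_valuation[OF f] .
  show ?thesis using U_\<pi>_pow_in_L[OF u(1), of "dvr_valuation K L f"] unfolding u(2)[symmetric] .
qed

lemma valuation_\<pi>: "dvr_valuation K L \<pi> = 1"
proof -
  have "\<one> \<in> U" using L_closed by simp
  from dvr_valuation_eq[OF this, of 1] show ?thesis
    using Units_int_pow_one[OF \<pi>(1)] \<pi>(1) by (simp add: Units_closed)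
qed

lemma valuation_one: "dvr_valuation K L \<one> = 0"
  using valuation_mult[of \<one> \<one>] by simp

lemma valuation_inv: "f \<in> Units K \<Longrightarrow> dvr_valuation K L (inv f) = - dvr_valuation K L f"
  using valuation_mult[of f "inv f"] valuation_one by simp

lemma valuation_nat_pow: "f \<in> Units K \<Longrightarrow> dvr_valuation K L (f [^] (n::nat)) = int n * dvr_valuation K L f"
proof (induction n)
  case (Suc n)
  have "f [^] n \<in> Units K" using Units_pow_closed Suc.prems by blast
  then show ?case using Suc valuation_mult by (simp add: algebra_simps)
qed (simp add: valuation_one)

end

section \<open>Uniformizers, discreteness and height one\<close>

context noetherian_frac
begin

text \<open>A nonzero y in \<open>loc q\<close> is divided by \<pi> as long as it is a non-unit.
  Were this never to end, the cyclic submodules spanned by the quotients would ascend; where they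
  become stationary, \<open>inv \<pi>\<close> falls into \<open>loc q\<close>. General elements of
  the field are quotients of elements of \<open>loc q\<close>.\<close>

lemma uniformizer_dvr:
  assumes q: "primeideal q A" and \<pi>: "uniformizer K (loc q) \<pi>"
  shows "dvr_in_field K (loc q) \<pi>"
proof -
  let ?L = "loc q"
  have \<pi>U: "\<pi> \<in> Units K" "\<pi> \<in> ?L" "inv \<pi> \<notin> ?L" using \<pi> by (auto simp: uniformizer_def)
  have Lc: "x \<in> carrier K" if "x \<in> ?L" for x using that loc_subset by blast
  have step: "y \<otimes> inv \<pi> \<in> ?L" if "y \<in> ?L" "y \<in> Units K" "inv y \<notin> ?L" for y
    using that \<pi> by (auto simp: uniformizer_def)
  have pw: "\<pi> [^] (k::int) \<in> Units K" for k using Units_int_pow_closed[OF \<pi>U(1)] .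
  have pwc: "\<pi> [^] (k::int) \<in> carrier K" for k using pw by blast
  have in_loc: "\<exists>n::int. \<exists>u\<in>?L \<inter> Units K. inv u \<in> ?L \<and> y = u \<otimes> \<pi> [^] n" if y: "y \<in> ?L" "y \<in> Units K" for y
  proof (rule ccontr)
    assume no: "\<not> ?thesis"
    let ?y = "\<lambda>n::nat. y \<otimes> \<pi> [^] (- int n)"
    have yU: "?y n \<in> Units K" for n using y pw by blast
    have ysuc: "?y (Suc n) = ?y n \<otimes> inv \<pi>" for n
    proof -
      have "\<pi> [^] (- int (Suc n)) = \<pi> [^] (- int n) \<otimes> inv \<pi>"
        using Units_int_pow_add[OF \<pi>U(1), of "- int n" "- 1"] Units_int_pow_neg[OF \<pi>U(1), of 1]
          Units_int_pow_one[OF \<pi>U(1)] by (simp add: algebra_simps)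
      then show ?thesis using y(2) pwc \<pi>U by (simp add: m_assoc Units_closed)
    qed
    have yL: "?y n \<in> ?L" for n
    proof (induction n)
      case 0
      then show ?case using y by (simp add: Units_closed)
    next
      case (Suc n)
      have "inv (?y n) \<notin> ?L"
      proof
        assume i: "inv (?y n) \<in> ?L"
        have "y = ?y n \<otimes> \<pi> [^] int n"
          using y(2) pwc Units_int_pow_add[OF \<pi>U(1), of "- int n" "int n", symmetric]
          by (simp add: m_assoc Units_closed)
        then show False using no i Suc yU by blast
      qed
      then show ?case unfolding ysuc using step Suc yU by blast
    qed
    let ?N = "\<lambda>n. (\<lambda>b. b \<otimes> ?y n) ` ?L"
    have "is_submodule K ?L (?N n)" for n
    proof (rule is_submoduleI[OF cring_axioms loc_subring[OF q]])
      show "?N n \<subseteq> carrier K" using yU Lc by auto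
      show "?N n \<noteq> {}" using loc_closed(1)[OF q] by blast
      show "x \<oplus> z \<in> ?N n" if xz: "x \<in> ?N n" "z \<in> ?N n" for x z
      proof -
        obtain b c where "b \<in> ?L" "x = b \<otimes> ?y n" "c \<in> ?L" "z = c \<otimes> ?y n" using xz by blast
        then show ?thesis using loc_closed(4)[OF q, of b c] Lc Units_closed[OF yU[of n]]
          by (intro image_eqI[of _ _ "b \<oplus> c"]) (simp_all add: l_distr)
      qed
      show "c \<otimes> x \<in> ?N n" if cx: "c \<in> ?L" "x \<in> ?N n" for c x
      proof -
        obtain b where "b \<in> ?L" "x = b \<otimes> ?y n" using cx by blast
        then show ?thesis using loc_closed(3)[OF q, of c b] cx(1) Lc Units_closed[OF yU[of n]]
          by (intro image_eqI[of _ _ "c \<otimes> b"]) (simp_all add: m_assoc)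
      qed
    qed
    moreover have "?N n \<subseteq> ?L" for n using yL loc_closed(3)[OF q] by blast
    moreover have "?N n \<subseteq> ?N (Suc n)" for n
    proof
      fix x assume "x \<in> ?N n"
      then obtain b where b: "b \<in> ?L" "x = b \<otimes> ?y n" by blast
      have yc: "?y n \<in> carrier K" using yU by blast
      have "(b \<otimes> \<pi>) \<otimes> ?y (Suc n) = b \<otimes> (\<pi> \<otimes> (inv \<pi> \<otimes> ?y n))"
        unfolding ysuc m_comm[OF yc Units_inv_closed[OF \<pi>U(1)]]
        using Lc[OF b(1)] yc \<pi>U(1) by (intro m_assoc) auto
      also have "\<dots> = x" using Units_mult_inv_cancel(2)[OF \<pi>U(1) yc] b(2) by simp
      finally have "x = (b \<otimes> \<pi>) \<otimes> ?y (Suc n)" by simp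
      then show "x \<in> ?N (Suc n)" using loc_closed(3)[OF q b(1) \<pi>U(2)] by blast
    qed
    ultimately obtain n where "?N (Suc n) = ?N n" using submodule_chain_stabilizes[OF q, of ?N] by blast
    moreover have "\<one> \<otimes> ?y (Suc n) \<in> ?N (Suc n)" using loc_closed(2)[OF q] by blast
    ultimately obtain b where b: "b \<in> ?L" "\<one> \<otimes> ?y (Suc n) = b \<otimes> ?y n" by auto
    \<comment> \<open>Stationarity writes the next quotient as a multiple b of the present one;
      cancelling the latter leaves \<open>inv \<pi> = b\<close>.\<close>
    then have "inv \<pi> \<otimes> ?y n = b \<otimes> ?y n"
      unfolding ysuc using Units_closed[OF yU[of n]] \<pi>U(1) by (simp add: m_comm)
    then have "inv \<pi> = b"
      using m_rcancel[of "?y n" "inv \<pi>" b] yU[of n] Lc[OF b(1)] \<pi>U(1) Units_iff_nonzero by auto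
    then show False using b \<pi>U by simp
  qed
  have "\<exists>n::int. \<exists>u\<in>?L \<inter> Units K. inv u \<in> ?L \<and> f = u \<otimes> \<pi> [^] n" if f: "f \<in> Units K" for f
  proof -
    obtain a s where as: "a \<in> carrier A" "s \<in> carrier A" "j s \<noteq> \<zero>" "f \<otimes> j s = j a"
      using frac[of f] f by blast
    have sU: "j s \<in> Units K" using as by (simp add: Units_iff_nonzero j_simps)
    then have aU: "j a \<in> Units K" using as(4) f by (metis Units_m_closed)
    obtain m :: int and u where u: "u \<in> ?L" "u \<in> Units K" "inv u \<in> ?L" "j a = u \<otimes> \<pi> [^] m"
      using in_loc[OF j_in_loc[OF q as(1)] aU] by blast
    obtain n :: int and w where w: "w \<in> ?L" "w \<in> Units K" "inv w \<in> ?L" "j s = w \<otimes> \<pi> [^] n"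
      using in_loc[OF j_in_loc[OF q as(2)] sU] by blast
    have c: "u \<in> carrier K" "inv w \<in> carrier K" "\<pi> [^] k \<in> carrier K" for k :: int
      using u w pwc by auto
    have "inv (j s) = inv w \<otimes> \<pi> [^] (- n)"
      unfolding w(4) using Units_inv_mult[OF w(2) pw] Units_int_pow_neg[OF \<pi>U(1)] by simp
    moreover have "f = j a \<otimes> inv (j s)"
      using as(4)[symmetric] f sU by (simp add: m_assoc Units_closed)
    ultimately have "f = (u \<otimes> \<pi> [^] m) \<otimes> (inv w \<otimes> \<pi> [^] (- n))" using u(4) by simp
    also have "\<dots> = u \<otimes> inv w \<otimes> (\<pi> [^] m \<otimes> \<pi> [^] (- n))" using c by (simp add: m_ac)
    also have "\<dots> = u \<otimes> inv w \<otimes> \<pi> [^] (m - n)" using Units_int_pow_add[OF \<pi>U(1), of m "- n"] by simp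
    finally have "f = u \<otimes> inv w \<otimes> \<pi> [^] (m - n)" .
    moreover have "u \<otimes> inv w \<in> ?L \<inter> Units K" using u w loc_closed(3)[OF q] by simp
    moreover have "inv (u \<otimes> inv w) \<in> ?L"
      using u w loc_closed(3)[OF q] Units_inv_mult[of u "inv w"] by simp
    ultimately show ?thesis by blast
  qed
  then show ?thesis
    by (intro dvr_in_field.intro dvr_in_field_axioms.intro field_axioms loc_subring q \<pi>)
qed

text \<open>The kernel of j, which lies in every prime, stands in for the zero ideal, so this is
  height one in the image of A.\<close>

definition height_one :: "'a set \<Rightarrow> bool" where
  "height_one q \<longleftrightarrow> primeideal q A \<and> (\<exists>a\<in>q. j a \<noteq> \<zero>) \<and>
     (\<forall>r. primeideal r A \<and> r \<subseteq> q \<longrightarrow> r = q \<or> (\<forall>a\<in>r. j a = \<zero>))"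

lemma height_one_incomparable: "\<lbrakk>height_one q; height_one r; r \<subseteq> q\<rbrakk> \<Longrightarrow> r = q"
  unfolding height_one_def by blast

lemma prime_pow_closed:
  assumes "primeideal r A" "b \<in> carrier A" "b [^]\<^bsub>A\<^esub> (n::nat) \<in> r"
  shows "b \<in> r"
  using assms(3)
proof (induction n)
  case 0
  then show ?case using prime_compl(1)[OF assms(1)] by simp
next
  case (Suc n)
  then have "b [^]\<^bsub>A\<^esub> n \<otimes>\<^bsub>A\<^esub> b \<in> r" by simp
  then have "b [^]\<^bsub>A\<^esub> n \<in> r \<or> b \<in> r"
    using primeideal.I_prime[OF assms(1)] assms(2) by simp
  then show ?case using Suc.IH by blast
qed

lemma j_nat_pow: "b \<in> carrier A \<Longrightarrow> j (b [^]\<^bsub>A\<^esub> (n::nat)) = j b [^] n"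
  by (induction n) (simp_all add: j_simps)

text \<open>Let r be a prime inside q containing some a with nonzero image, and let b be in q with
  nonzero image. As b has positive value, a power b^n is divisible by a in \<open>loc q\<close>;
  clearing the denominator t, which is outside q, gives b^n t in r and hence b in r.\<close>

lemma height_one_if_uniformizer:
  assumes q: "primeideal q A" and \<pi>: "uniformizer K (loc q) \<pi>"
  shows "height_one q"
proof -
  interpret dvr_in_field K "loc q" \<pi> by (rule uniformizer_dvr[OF q \<pi>])
  let ?v = "dvr_valuation K (loc q)"
  interpret q: primeideal q A by (rule q)
  obtain a s where as: "\<pi> \<in> carrier K" "a \<in> carrier A" "s \<in> carrier A" "s \<notin> q" "\<pi> \<otimes> j s = j a"
    using \<pi>(2) by (rule locE)
  have "a \<in> q" using inv_in_loc_iff[OF q \<pi>(1) as(2-5)] \<pi>(3) by blast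
  moreover have "j a \<noteq> \<zero>"
    using as(5) Units_m_closed[OF \<pi>(1) j_Units[OF q as(3,4)]] Units_iff_nonzero by metis
  moreover have "q \<subseteq> r" if r: "primeideal r A" "r \<subseteq> q" and a: "a \<in> r" "j a \<noteq> \<zero>" for r a
  proof
    fix b assume b: "b \<in> q"
    have bA: "b \<in> carrier A" using b q.Icarr by blast
    have aA: "a \<in> carrier A" using a(1) r(2) q.Icarr by blast
    show "b \<in> r"
    proof (cases "j b = \<zero>")
      case True
      then show ?thesis using kernel_in_primes[OF r(1) bA] by blast
    next
      case False
      have aU: "j a \<in> Units K" and bU: "j b \<in> Units K"
        using aA bA a(2) False by (auto simp: Units_iff_nonzero j_simps)
      have "inv (j b) \<notin> loc q" using inv_j_in_loc_iff[OF q bA False] b by blast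
      then have "\<not> 0 \<le> ?v (inv (j b))" using valuation_nonneg bU by blast
      then have vb: "1 \<le> ?v (j b)" using valuation_inv[OF bU] by simp
      define n where "n = nat (?v (j a))"
      have "?v (j a) \<le> int n" by (simp add: n_def)
      also have "\<dots> \<le> int n * ?v (j b)" using vb by (simp add: mult_le_cancel_left1)
      finally have "0 \<le> ?v (j b [^] n \<otimes> inv (j a))"
        using valuation_nat_pow[OF bU, of n] valuation_mult[of "j b [^] n" "inv (j a)"]
          valuation_inv[OF aU] aU bU by (simp add: Units_pow_closed)
      then have "j b [^] n \<otimes> inv (j a) \<in> loc q"
        using valuation_nonneg aU bU by (simp add: Units_pow_closed)
      then obtain c t where ct: "c \<in> carrier A" "t \<in> carrier A" "t \<notin> q"
        "j b [^] n \<otimes> inv (j a) \<otimes> j t = j c" by (rule locE)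
      have k: "j b [^] n \<in> carrier K" "j a \<in> carrier K" "j t \<in> carrier K"
        using aA bA ct by (auto simp: j_simps)
      have "j (a \<otimes>\<^bsub>A\<^esub> c) = j a \<otimes> (j b [^] n \<otimes> inv (j a) \<otimes> j t)"
        using aA ct by (simp add: j_simps)
      also have "\<dots> = (j a \<otimes> inv (j a)) \<otimes> (j b [^] n \<otimes> j t)"
        using k aU by (simp only: m_ac m_closed Units_inv_closed)
      also have "\<dots> = j (b [^]\<^bsub>A\<^esub> n \<otimes>\<^bsub>A\<^esub> t)"
        using k aU bA ct by (simp add: j_simps j_nat_pow)
      finally have "j (a \<otimes>\<^bsub>A\<^esub> c) = j (b [^]\<^bsub>A\<^esub> n \<otimes>\<^bsub>A\<^esub> t)" .
      moreover have "a \<otimes>\<^bsub>A\<^esub> c \<in> r"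
        using a(1) ct(1) ideal.I_r_closed[OF primeideal.axioms(1)[OF r(1)]] by blast
      ultimately have "b [^]\<^bsub>A\<^esub> n \<otimes>\<^bsub>A\<^esub> t \<in> r"
        using prime_diff[OF r(1), of "a \<otimes>\<^bsub>A\<^esub> c" "b [^]\<^bsub>A\<^esub> n \<otimes>\<^bsub>A\<^esub> t"] aA bA ct by simp
      then have "b [^]\<^bsub>A\<^esub> n \<in> r"
        using primeideal.I_prime[OF r(1), of "b [^]\<^bsub>A\<^esub> n" t] bA ct r(2) by auto
      then show ?thesis using prime_pow_closed[OF r(1) bA] by blast
    qed
  qed
  ultimately have "\<exists>a\<in>q. j a \<noteq> \<zero>" "\<forall>r. primeideal r A \<and> r \<subseteq> q \<longrightarrow> r = q \<or> (\<forall>a\<in>r. j a = \<zero>)"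
    by (blast, metis subset_antisym)
  then show ?thesis unfolding height_one_def using q by simp
qed

text \<open>A height-one prime containing a is minimal over the ideal of a, so it occurs in the
  finite family of \<open>finitely_many_primes_below\<close>.\<close>

lemma finite_height_one:
  assumes a: "a \<in> carrier A" "j a \<noteq> \<zero>"
  shows "finite {q. height_one q \<and> a \<in> q}"
proof -
  have "ideal (PIdl\<^bsub>A\<^esub> a) A" using A.cgenideal_ideal a(1) by blast
  then obtain F where F: "finite F" "\<forall>r\<in>F. primeideal r A \<and> PIdl\<^bsub>A\<^esub> a \<subseteq> r"
    "\<forall>p. primeideal p A \<and> PIdl\<^bsub>A\<^esub> a \<subseteq> p \<longrightarrow> (\<exists>r\<in>F. r \<subseteq> p)"
    using finitely_many_primes_below[OF A.noetherian_ring_axioms A.is_cring] by metis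
  have "q \<in> F" if q: "height_one q" "a \<in> q" for q
  proof -
    have "primeideal q A" using q(1) by (simp add: height_one_def)
    moreover from this have "PIdl\<^bsub>A\<^esub> a \<subseteq> q" using A.cgenideal_minimal primeideal.axioms(1) q(2) by blast
    ultimately obtain r where r: "r \<in> F" "r \<subseteq> q" using F(3) by blast
    then have "a \<in> r" using F(2) A.cgenideal_self[OF a(1)] by blast
    moreover have "primeideal r A" using F(2) r(1) by blast
    ultimately have "r = q" using q(1) r(2) a(2) unfolding height_one_def by metis
    then show ?thesis using r(1) by simp
  qed
  then have "{q. height_one q \<and> a \<in> q} \<subseteq> F" by blast
  then show ?thesis using F(1) by (rule finite_subset)
qed

end

section \<open>Valuations at the height-one primes of a normal Noetherian ring\<close>

context normal_noetherian_frac
begin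

text \<open>For a in q with nonzero image, \<open>inv (j a)\<close> is missing from
  \<open>loc q\<close>. So \<open>hartogs\<close> produces inside q a prime with a uniformizer; it
  has height one and therefore equals q.\<close>

lemma uniformizer_if_height_one:
  assumes q: "height_one q"
  shows "\<exists>\<pi>. uniformizer K (loc q) \<pi>"
proof -
  obtain a where a: "a \<in> q" "j a \<noteq> \<zero>" and pq: "primeideal q A" using q by (auto simp: height_one_def)
  have aA: "a \<in> carrier A" using a(1) ideal.Icarr[OF primeideal.axioms(1)[OF pq]] by blast
  have "inv (j a) \<notin> loc q" using inv_j_in_loc_iff[OF pq aA a(2)] a(1) by blast
  moreover have "inv (j a) \<in> carrier K" using aA a(2) by (simp add: Units_iff_nonzero j_simps)
  ultimately obtain r \<pi> where r: "primeideal r A" "r \<subseteq> q" "uniformizer K (loc r) \<pi>"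
    using hartogs[OF pq] by blast
  have "r = q" using height_one_incomparable[OF q height_one_if_uniformizer[OF r(1,3)] r(2)] .
  then show ?thesis using r by blast
qed

lemma height_one_dvr:
  assumes "height_one q"
  obtains \<pi> where "dvr_in_field K (loc q) \<pi>"
  using uniformizer_if_height_one[OF assms] uniformizer_dvr assms unfolding height_one_def by blast

abbreviation val :: "'a set \<Rightarrow> 'b \<Rightarrow> int" where
  "val q \<equiv> dvr_valuation K (loc q)"

lemma val_mult: "\<lbrakk>height_one q; f \<in> Units K; g \<in> Units K\<rbrakk> \<Longrightarrow> val q (f \<otimes> g) = val q f + val q g"
  using height_one_dvr dvr_in_field.valuation_mult by metis

lemma val_nonneg: "\<lbrakk>height_one q; f \<in> Units K\<rbrakk> \<Longrightarrow> f \<in> loc q \<longleftrightarrow> 0 \<le> val q f"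
  using height_one_dvr dvr_in_field.valuation_nonneg by metis

lemma val_uniformizer: "height_one q \<Longrightarrow> \<exists>\<pi>\<in>Units K. val q \<pi> = 1"
  using height_one_dvr dvr_in_field.valuation_\<pi> dvr_in_field.\<pi>(1) by metis

lemma val_inv: "\<lbrakk>height_one q; f \<in> Units K\<rbrakk> \<Longrightarrow> val q (inv f) = - val q f"
  using height_one_dvr dvr_in_field.valuation_inv by metis

lemma val_j:
  assumes q: "height_one q" and a: "a \<in> carrier A" "j a \<noteq> \<zero>"
  shows "1 \<le> val q (j a) \<longleftrightarrow> a \<in> q" "0 \<le> val q (j a)"
proof -
  have pq: "primeideal q A" using q by (simp add: height_one_def)
  have U: "j a \<in> Units K" using a by (simp add: Units_iff_nonzero j_simps)
  show ge: "0 \<le> val q (j a)" using val_nonneg[OF q U] j_in_loc[OF pq a(1)] by blast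
  show "1 \<le> val q (j a) \<longleftrightarrow> a \<in> q"
    using val_nonneg[OF q, of "inv (j a)"] inv_j_in_loc_iff[OF pq a] val_inv[OF q U] U by auto
qed

text \<open>The prime by which \<open>hartogs\<close> witnesses \<open>z \<notin> loc p\<close>
  carries a uniformizer, hence has height one and falls under the assumption.\<close>

lemma val_hartogs:
  assumes p: "primeideal p A" and z: "z \<in> Units K"
    and ge: "\<And>q. \<lbrakk>height_one q; q \<subseteq> p\<rbrakk> \<Longrightarrow> 0 \<le> val q z"
  shows "z \<in> loc p"
proof (rule ccontr)
  assume "z \<notin> loc p"
  then obtain q \<pi> where q: "primeideal q A" "q \<subseteq> p" "z \<notin> loc q" "uniformizer K (loc q) \<pi>"
    using hartogs[OF p] z by blast
  then have h: "height_one q" using height_one_if_uniformizer by blast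
  show False using val_nonneg[OF h z] ge[OF h q(2)] q(3) by blast
qed

text \<open>Write z as a/s: a nonzero value at q puts a or s into q, and
  \<open>finite_height_one\<close> bounds both sets of primes.\<close>

lemma val_finite:
  assumes z: "z \<in> Units K"
  shows "finite {q. height_one q \<and> val q z \<noteq> 0}"
proof -
  obtain a s where as: "a \<in> carrier A" "s \<in> carrier A" "j s \<noteq> \<zero>" "z \<otimes> j s = j a"
    using frac[of z] z by blast
  have sU: "j s \<in> Units K" using as by (simp add: Units_iff_nonzero j_simps)
  then have aU: "j a \<noteq> \<zero>" using as(4) z by (metis Units_m_closed Units_iff_nonzero)
  have "a \<in> q \<or> s \<in> q" if q: "height_one q" "val q z \<noteq> 0" for q
  proof -
    have "val q z + val q (j s) = val q (j a)" using val_mult[OF q(1) z sU] as(4) by simp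
    then show ?thesis using val_j[OF q(1) as(2,3)] val_j[OF q(1) as(1) aU] q(2) by linarith
  qed
  then have "{q. height_one q \<and> val q z \<noteq> 0} \<subseteq> {q. height_one q \<and> a \<in> q} \<union> {q. height_one q \<and> s \<in> q}"
    by blast
  then show ?thesis
    using finite_subset finite_UnI[OF finite_height_one[OF as(1) aU] finite_height_one[OF as(2,3)]] by blast
qed

text \<open>The image of any a in q but not in r will do: it lies in every local ring, has positive
  value at q and is invertible at r.\<close>

lemma val_separation:
  assumes q: "height_one q" and p: "primeideal p A" and r: "primeideal r A" "\<not> q \<subseteq> r"
  shows "\<exists>h\<in>loc p. h \<in> Units K \<and> 1 \<le> val q h \<and> inv h \<in> loc r"
proof -
  obtain a where a: "a \<in> q" "a \<notin> r" using r(2) by blast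
  have "primeideal q A" using q by (simp add: height_one_def)
  then have aA: "a \<in> carrier A" using a(1) ideal.Icarr primeideal.axioms(1) by metis
  have "j a \<noteq> \<zero>" using kernel_in_primes[OF r(1) aA] a(2) by blast
  then show ?thesis
    using j_in_loc[OF p aA] val_j(1)[OF q aA] a inv_j_in_loc[OF r(1) aA] aA
    by (intro bexI[of _ "j a"] conjI) (simp_all add: Units_iff_nonzero j_simps)
qed

end

section \<open>Localizations\<close>

locale mult_subset = cring A for A :: "'a ring" (structure) +
  fixes S :: "'a set"
  assumes S_subset: "S \<subseteq> carrier A"
    and S_one: "\<one> \<in> S"
    and S_mult: "\<lbrakk>s \<in> S; t \<in> S\<rbrakk> \<Longrightarrow> s \<otimes> t \<in> S"
begin

lemma S_carrier: "s \<in> S \<Longrightarrow> s \<in> carrier A"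
  using S_subset by blast

lemma mem_fraction: "(b, t) \<in> fraction A S a s \<longleftrightarrow>
    b \<in> carrier A \<and> t \<in> S \<and> (\<exists>u\<in>S. u \<otimes> (a \<otimes> t) = u \<otimes> (b \<otimes> s))"
  by (simp add: fraction_def)

lemma mem_fraction_self: "\<lbrakk>a \<in> carrier A; s \<in> S\<rbrakk> \<Longrightarrow> (a, s) \<in> fraction A S a s"
  using S_one by (auto simp: mem_fraction)

text \<open>The common multiplier is \<open>u \<otimes> w \<otimes> t\<close>; the factor t has to
  stay in it, since A may have zero divisors.\<close>

lemma fraction_trans:
  assumes c: "a \<in> carrier A" "s \<in> S" "b \<in> carrier A" "t \<in> S" "d \<in> carrier A" "r \<in> S"
    and 1: "(b, t) \<in> fraction A S a s" and 2: "(d, r) \<in> fraction A S b t"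
  shows "(d, r) \<in> fraction A S a s"
proof -
  obtain u w where u: "u \<in> S" "u \<otimes> (a \<otimes> t) = u \<otimes> (b \<otimes> s)" and w: "w \<in> S" "w \<otimes> (b \<otimes> r) = w \<otimes> (d \<otimes> t)"
    using 1 2 by (auto simp: mem_fraction)
  note k = c(1,3,5) S_carrier[OF c(2)] S_carrier[OF c(4)] S_carrier[OF c(6)] S_carrier[OF u(1)] S_carrier[OF w(1)]
  have "(u \<otimes> w \<otimes> t) \<otimes> (a \<otimes> r) = (u \<otimes> (a \<otimes> t)) \<otimes> (w \<otimes> r)" using k by (simp only: m_ac m_closed)
  also have "\<dots> = (u \<otimes> s) \<otimes> (w \<otimes> (b \<otimes> r))" unfolding u(2) using k by (simp only: m_ac m_closed)
  also have "\<dots> = (u \<otimes> w \<otimes> t) \<otimes> (d \<otimes> s)" unfolding w(2) using k by (simp only: m_ac m_closed)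
  finally show ?thesis unfolding mem_fraction using c u w S_mult by blast
qed

lemma fraction_sym:
  assumes "a \<in> carrier A" "s \<in> S" "(b, t) \<in> fraction A S a s"
  shows "(a, s) \<in> fraction A S b t"
  using assms unfolding mem_fraction by metis

lemma fraction_eqI:
  assumes "a \<in> carrier A" "s \<in> S" "(b, t) \<in> fraction A S a s"
  shows "fraction A S b t = fraction A S a s"
proof -
  have b: "b \<in> carrier A" "t \<in> S" using assms by (auto simp: mem_fraction)
  have "(d, r) \<in> fraction A S b t \<longleftrightarrow> (d, r) \<in> fraction A S a s" for d r
    using fraction_trans[of a s b t d r] fraction_trans[of b t a s d r] assms b
      fraction_sym[OF assms] mem_fraction by metis
  then show ?thesis by auto
qed

lemma fraction_eq_iff:
  assumes "a \<in> carrier A" "s \<in> S" "b \<in> carrier A" "t \<in> S"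
  shows "fraction A S a s = fraction A S b t \<longleftrightarrow> (\<exists>u\<in>S. u \<otimes> (a \<otimes> t) = u \<otimes> (b \<otimes> s))"
proof
  assume "fraction A S a s = fraction A S b t"
  then have "(b, t) \<in> fraction A S a s" using mem_fraction_self[OF assms(3,4)] by simp
  then show "\<exists>u\<in>S. u \<otimes> (a \<otimes> t) = u \<otimes> (b \<otimes> s)" by (simp only: mem_fraction)
next
  assume "\<exists>u\<in>S. u \<otimes> (a \<otimes> t) = u \<otimes> (b \<otimes> s)"
  then have "(b, t) \<in> fraction A S a s" using assms(3,4) by (simp only: mem_fraction simp_thms)
  then show "fraction A S a s = fraction A S b t" using fraction_eqI[OF assms(1,2)] by simp
qed

text \<open>The operations of \<open>localization\<close> are unions over all representatives. Once
  the result is independent of the choice, this is a union of equal sets over a nonempty index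
  set.\<close>

lemma fraction_binop:
  assumes a: "a \<in> carrier A" "s \<in> S" and b: "b \<in> carrier A" "t \<in> S"
    and "\<And>a' s' b' t'. \<lbrakk>(a', s') \<in> fraction A S a s; (b', t') \<in> fraction A S b t\<rbrakk> \<Longrightarrow> G a' s' b' t' = G a s b t"
  shows "(\<Union>(a', s')\<in>fraction A S a s. \<Union>(b', t')\<in>fraction A S b t. G a' s' b' t') = G a s b t"
  using assms mem_fraction_self[OF a] mem_fraction_self[OF b] by fast

lemma fraction_mult:
  assumes a: "a \<in> carrier A" "s \<in> S" and b: "b \<in> carrier A" "t \<in> S"
  shows "fraction A S a s \<otimes>\<^bsub>localization A S\<^esub> fraction A S b t = fraction A S (a \<otimes> b) (s \<otimes> t)"
  unfolding localization_def monoid.simps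
proof (rule fraction_binop[OF a b, where G = "\<lambda>a s b t. fraction A S (a \<otimes> b) (s \<otimes> t)"])
  fix a' s' b' t' assume "(a', s') \<in> fraction A S a s" "(b', t') \<in> fraction A S b t"
  then obtain u w where a': "a' \<in> carrier A" "s' \<in> S" and b': "b' \<in> carrier A" "t' \<in> S"
    and u: "u \<in> S" "u \<otimes> (a \<otimes> s') = u \<otimes> (a' \<otimes> s)"
    and w: "w \<in> S" "w \<otimes> (b \<otimes> t') = w \<otimes> (b' \<otimes> t)" by (auto simp: mem_fraction)
  note k = a(1) b(1) a'(1) b'(1) S_carrier[OF a(2)] S_carrier[OF b(2)] S_carrier[OF a'(2)]
    S_carrier[OF b'(2)] S_carrier[OF u(1)] S_carrier[OF w(1)]
  have "(u \<otimes> w) \<otimes> ((a \<otimes> b) \<otimes> (s' \<otimes> t')) = (u \<otimes> (a \<otimes> s')) \<otimes> (w \<otimes> (b \<otimes> t'))"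
    using k by (simp only: m_ac m_closed)
  also have "\<dots> = (u \<otimes> w) \<otimes> ((a' \<otimes> b') \<otimes> (s \<otimes> t))"
    unfolding u(2) w(2) using k by (simp only: m_ac m_closed)
  finally have "(a' \<otimes> b', s' \<otimes> t') \<in> fraction A S (a \<otimes> b) (s \<otimes> t)"
    unfolding mem_fraction using a' b' u w S_mult by blast
  then show "fraction A S (a' \<otimes> b') (s' \<otimes> t') = fraction A S (a \<otimes> b) (s \<otimes> t)"
    using a b S_mult by (intro fraction_eqI) auto
qed

lemma fraction_add:
  assumes a: "a \<in> carrier A" "s \<in> S" and b: "b \<in> carrier A" "t \<in> S"
  shows "fraction A S a s \<oplus>\<^bsub>localization A S\<^esub> fraction A S b t
    = fraction A S ((a \<otimes> t) \<oplus> (b \<otimes> s)) (s \<otimes> t)"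
  unfolding localization_def ring_record_simps
proof (rule fraction_binop[OF a b, where G = "\<lambda>a s b t. fraction A S ((a \<otimes> t) \<oplus> (b \<otimes> s)) (s \<otimes> t)"])
  fix a' s' b' t' assume "(a', s') \<in> fraction A S a s" "(b', t') \<in> fraction A S b t"
  then obtain u w where a': "a' \<in> carrier A" "s' \<in> S" and b': "b' \<in> carrier A" "t' \<in> S"
    and u: "u \<in> S" "u \<otimes> (a \<otimes> s') = u \<otimes> (a' \<otimes> s)"
    and w: "w \<in> S" "w \<otimes> (b \<otimes> t') = w \<otimes> (b' \<otimes> t)" by (auto simp: mem_fraction)
  note k = a(1) b(1) a'(1) b'(1) S_carrier[OF a(2)] S_carrier[OF b(2)] S_carrier[OF a'(2)]
    S_carrier[OF b'(2)] S_carrier[OF u(1)] S_carrier[OF w(1)]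
  have "(u \<otimes> w) \<otimes> (((a \<otimes> t) \<oplus> (b \<otimes> s)) \<otimes> (s' \<otimes> t'))
      = (u \<otimes> (a \<otimes> s')) \<otimes> (w \<otimes> t \<otimes> t') \<oplus> (w \<otimes> (b \<otimes> t')) \<otimes> (u \<otimes> s \<otimes> s')"
    using k by (simp only: m_ac m_closed l_distr r_distr a_closed)
  also have "\<dots> = (u \<otimes> w) \<otimes> (((a' \<otimes> t') \<oplus> (b' \<otimes> s')) \<otimes> (s \<otimes> t))"
    unfolding u(2) w(2) using k by (simp only: m_ac m_closed l_distr r_distr a_closed)
  finally have "((a' \<otimes> t') \<oplus> (b' \<otimes> s'), s' \<otimes> t') \<in> fraction A S ((a \<otimes> t) \<oplus> (b \<otimes> s)) (s \<otimes> t)"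
    unfolding mem_fraction using a' b' u w S_mult S_carrier by blast
  then show "fraction A S ((a' \<otimes> t') \<oplus> (b' \<otimes> s')) (s' \<otimes> t') = fraction A S ((a \<otimes> t) \<oplus> (b \<otimes> s)) (s \<otimes> t)"
    using a b S_mult S_carrier by (intro fraction_eqI) auto
qed

lemma localization_simps:
  "carrier (localization A S) = {fraction A S a s |a s. a \<in> carrier A \<and> s \<in> S}"
  "\<one>\<^bsub>localization A S\<^esub> = fraction A S \<one> \<one>"
  "\<zero>\<^bsub>localization A S\<^esub> = fraction A S \<zero> \<one>"
  by (simp_all add: localization_def)

lemma fraction_closed: "\<lbrakk>a \<in> carrier A; s \<in> S\<rbrakk> \<Longrightarrow> fraction A S a s \<in> carrier (localization A S)"
  by (auto simp: localization_simps)

end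

lemma mult_subset_prime:
  assumes "primeideal p A"
  shows "mult_subset A (carrier A - p)"
proof -
  interpret primeideal p A by fact
  show ?thesis using one_imp_carrier I_notcarr I_prime by unfold_locales blast+
qed

lemma mult_subset_nonzero:
  assumes "domain A"
  shows "mult_subset A (nonzero_elements A)"
proof -
  interpret domain A by fact
  show ?thesis using integral by unfold_locales auto
qed

text \<open>The relation is transported along the isomorphism of \<open>F\<close> with the field of fractions of \<open>D\<close>.\<close>

lemma integrally_closed_transfer:
  fixes D :: "'a ring" and F :: "'b ring"
  assumes D: "integrally_closed_domain D" and F: "field F" and \<kappa>: "\<kappa> \<in> ring_hom D F"
    and inj: "\<And>a. \<lbrakk>a \<in> carrier D; \<kappa> a = \<zero>\<^bsub>F\<^esub>\<rbrakk> \<Longrightarrow> a = \<zero>\<^bsub>D\<^esub>"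
    and frac: "\<And>z. z \<in> carrier F \<Longrightarrow> \<exists>a\<in>carrier D. \<exists>s\<in>carrier D. \<kappa> s \<noteq> \<zero>\<^bsub>F\<^esub> \<and> z \<otimes>\<^bsub>F\<^esub> \<kappa> s = \<kappa> a"
    and z: "z \<in> carrier F" and c: "\<And>i. i < n \<Longrightarrow> c i \<in> \<kappa> ` carrier D"
    and rel: "(z [^]\<^bsub>F\<^esub> (n::nat)) \<oplus>\<^bsub>F\<^esub> (\<Oplus>\<^bsub>F\<^esub>i\<in>{..<n}. c i \<otimes>\<^bsub>F\<^esub> (z [^]\<^bsub>F\<^esub> i)) = \<zero>\<^bsub>F\<^esub>"
  shows "z \<in> \<kappa> ` carrier D"
proof -
  have dom: "domain D" using D by (simp add: integrally_closed_domain_def)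
  let ?S = "nonzero_elements D" and ?Q = "fraction_field D"
  interpret D: domain D by (rule dom)
  interpret F: field F by (rule F)
  interpret S: mult_subset D ?S by (rule mult_subset_nonzero[OF dom])
  note h = ring_hom_closed[OF \<kappa>] ring_hom_mult[OF \<kappa>] ring_hom_add[OF \<kappa>] ring_hom_one[OF \<kappa>]
    ring_hom_zero[OF \<kappa> D.ring_axioms F.ring_axioms]
  have \<kappa>_inj: "a = b" if "a \<in> carrier D" "b \<in> carrier D" "\<kappa> a = \<kappa> b" for a b
  proof -
    have "\<kappa> (a \<ominus>\<^bsub>D\<^esub> b) \<oplus>\<^bsub>F\<^esub> \<kappa> b = \<kappa> b"
      using that ring_hom_add[OF \<kappa>, of "a \<ominus>\<^bsub>D\<^esub> b" b] by (simp add: D.minus_eq D.a_assoc D.l_neg)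
    then have "\<kappa> (a \<ominus>\<^bsub>D\<^esub> b) = \<zero>\<^bsub>F\<^esub>" using that h(1) by (simp add: F.add.r_cancel_one)
    then show ?thesis using inj[of "a \<ominus>\<^bsub>D\<^esub> b"] that by simp
  qed
  have SU: "\<kappa> s \<in> carrier F" "\<kappa> s \<noteq> \<zero>\<^bsub>F\<^esub>" if "s \<in> ?S" for s using that h(1) inj by auto
  have eq_iff: "fraction D ?S a s = fraction D ?S b t \<longleftrightarrow> \<kappa> a \<otimes>\<^bsub>F\<^esub> \<kappa> t = \<kappa> b \<otimes>\<^bsub>F\<^esub> \<kappa> s"
    if abst: "a \<in> carrier D" "b \<in> carrier D" "s \<in> ?S" "t \<in> ?S" for a b s t
  proof -
    have "fraction D ?S a s = fraction D ?S b t \<longleftrightarrow> a \<otimes>\<^bsub>D\<^esub> t = b \<otimes>\<^bsub>D\<^esub> s"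
    proof
      assume "fraction D ?S a s = fraction D ?S b t"
      then obtain u where u: "u \<in> ?S" "u \<otimes>\<^bsub>D\<^esub> (a \<otimes>\<^bsub>D\<^esub> t) = u \<otimes>\<^bsub>D\<^esub> (b \<otimes>\<^bsub>D\<^esub> s)"
        using S.fraction_eq_iff[OF abst(1,3,2,4)] by blast
      then show "a \<otimes>\<^bsub>D\<^esub> t = b \<otimes>\<^bsub>D\<^esub> s"
        using D.m_lcancel[of u "a \<otimes>\<^bsub>D\<^esub> t" "b \<otimes>\<^bsub>D\<^esub> s"] abst by auto
    next
      assume "a \<otimes>\<^bsub>D\<^esub> t = b \<otimes>\<^bsub>D\<^esub> s"
      then show "fraction D ?S a s = fraction D ?S b t"
        using S.fraction_eq_iff[OF abst(1,3,2,4)] S.S_one by metis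
    qed
    also have "\<dots> \<longleftrightarrow> \<kappa> (a \<otimes>\<^bsub>D\<^esub> t) = \<kappa> (b \<otimes>\<^bsub>D\<^esub> s)" using \<kappa>_inj abst by auto
    finally show ?thesis using abst by (simp add: h)
  qed
  \<comment> \<open>An element z goes to the fraction a/s for any presentation of z by
    \<open>\<kappa> a\<close> and \<open>\<kappa> s\<close>; \<open>eq_iff\<close> makes the choice
    immaterial.\<close>
  define \<Psi> where "\<Psi> = (\<lambda>z. THE q. \<exists>a\<in>carrier D. \<exists>s\<in>?S. z \<otimes>\<^bsub>F\<^esub> \<kappa> s = \<kappa> a \<and> q = fraction D ?S a s)"
  have \<Psi>: "\<Psi> z = fraction D ?S a s"
    if z: "z \<in> carrier F" and a: "a \<in> carrier D" and s: "s \<in> ?S" and eq: "z \<otimes>\<^bsub>F\<^esub> \<kappa> s = \<kappa> a" for z a s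
    unfolding \<Psi>_def
  proof (rule the_equality)
    fix q assume "\<exists>a\<in>carrier D. \<exists>s\<in>?S. z \<otimes>\<^bsub>F\<^esub> \<kappa> s = \<kappa> a \<and> q = fraction D ?S a s"
    then obtain b t where b: "b \<in> carrier D" "t \<in> ?S" "z \<otimes>\<^bsub>F\<^esub> \<kappa> t = \<kappa> b" "q = fraction D ?S b t" by blast
    have "\<kappa> b \<otimes>\<^bsub>F\<^esub> \<kappa> s = \<kappa> a \<otimes>\<^bsub>F\<^esub> \<kappa> t"
      unfolding b(3)[symmetric] eq[symmetric] using z SU[OF s] SU[OF b(2)] by (simp add: F.m_ac)
    then show "q = fraction D ?S a s" unfolding b(4) using eq_iff a b s by blast
  qed (use that in blast)
  have ex: "\<exists>a\<in>carrier D. \<exists>s\<in>?S. z \<otimes>\<^bsub>F\<^esub> \<kappa> s = \<kappa> a \<and> \<Psi> z = fraction D ?S a s" if z: "z \<in> carrier F" for z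
  proof -
    obtain a s where "a \<in> carrier D" "s \<in> carrier D" "\<kappa> s \<noteq> \<zero>\<^bsub>F\<^esub>" "z \<otimes>\<^bsub>F\<^esub> \<kappa> s = \<kappa> a" using frac[OF z] by blast
    moreover from this have "s \<in> ?S" using h(5) by auto
    ultimately show ?thesis using \<Psi>[OF z] by blast
  qed
  have \<Psi>\<kappa>: "\<Psi> (\<kappa> a) = fraction D ?S a \<one>\<^bsub>D\<^esub>" if "a \<in> carrier D" for a
    using that h by (intro \<Psi>) auto
  have hom: "\<Psi> \<in> ring_iso F ?Q"
  proof (rule ring_iso_memI)
    show "\<Psi> \<one>\<^bsub>F\<^esub> = \<one>\<^bsub>?Q\<^esub>" using \<Psi>\<kappa>[of "\<one>\<^bsub>D\<^esub>"] by (simp add: h S.localization_simps)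
    show closed: "\<Psi> x \<in> carrier ?Q" if "x \<in> carrier F" for x
      using ex[OF that] S.fraction_closed by metis
    fix x y assume x: "x \<in> carrier F" and y: "y \<in> carrier F"
    obtain a s where a: "a \<in> carrier D" "s \<in> ?S" "x \<otimes>\<^bsub>F\<^esub> \<kappa> s = \<kappa> a" "\<Psi> x = fraction D ?S a s" using ex[OF x] by blast
    obtain b t where b: "b \<in> carrier D" "t \<in> ?S" "y \<otimes>\<^bsub>F\<^esub> \<kappa> t = \<kappa> b" "\<Psi> y = fraction D ?S b t" using ex[OF y] by blast
    note k = x y SU(1)[OF a(2)] SU(1)[OF b(2)]
    have ds: "s \<in> carrier D" "t \<in> carrier D" using a b by auto
    have st: "s \<otimes>\<^bsub>D\<^esub> t \<in> ?S" by (rule S.S_mult[OF a(2) b(2)])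
    have "x \<otimes>\<^bsub>F\<^esub> y \<otimes>\<^bsub>F\<^esub> \<kappa> (s \<otimes>\<^bsub>D\<^esub> t) = (x \<otimes>\<^bsub>F\<^esub> \<kappa> s) \<otimes>\<^bsub>F\<^esub> (y \<otimes>\<^bsub>F\<^esub> \<kappa> t)"
      unfolding h(2)[OF ds] using k by (simp only: F.m_ac F.m_closed)
    also have "\<dots> = \<kappa> (a \<otimes>\<^bsub>D\<^esub> b)" using a b h by simp
    finally show "\<Psi> (x \<otimes>\<^bsub>F\<^esub> y) = \<Psi> x \<otimes>\<^bsub>?Q\<^esub> \<Psi> y"
      unfolding a(4) b(4) S.fraction_mult[OF a(1,2) b(1,2)] using x y a b st by (intro \<Psi>) auto
    have "(x \<oplus>\<^bsub>F\<^esub> y) \<otimes>\<^bsub>F\<^esub> \<kappa> (s \<otimes>\<^bsub>D\<^esub> t) = (x \<otimes>\<^bsub>F\<^esub> \<kappa> s) \<otimes>\<^bsub>F\<^esub> \<kappa> t \<oplus>\<^bsub>F\<^esub> (y \<otimes>\<^bsub>F\<^esub> \<kappa> t) \<otimes>\<^bsub>F\<^esub> \<kappa> s"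
      unfolding h(2)[OF ds] using k by (simp only: F.m_ac F.m_closed F.l_distr F.r_distr F.a_closed)
    also have "\<dots> = \<kappa> ((a \<otimes>\<^bsub>D\<^esub> t) \<oplus>\<^bsub>D\<^esub> (b \<otimes>\<^bsub>D\<^esub> s))" using a b ds h by simp
    finally show "\<Psi> (x \<oplus>\<^bsub>F\<^esub> y) = \<Psi> x \<oplus>\<^bsub>?Q\<^esub> \<Psi> y"
      unfolding a(4) b(4) S.fraction_add[OF a(1,2) b(1,2)] using x y a b ds st by (intro \<Psi>) auto
  next
    have "inj_on \<Psi> (carrier F)"
    proof (rule inj_onI)
      fix x y assume x: "x \<in> carrier F" and y: "y \<in> carrier F" and eq: "\<Psi> x = \<Psi> y"
      obtain a s where a: "a \<in> carrier D" "s \<in> ?S" "x \<otimes>\<^bsub>F\<^esub> \<kappa> s = \<kappa> a" "\<Psi> x = fraction D ?S a s" using ex[OF x] by blast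
      obtain b t where b: "b \<in> carrier D" "t \<in> ?S" "y \<otimes>\<^bsub>F\<^esub> \<kappa> t = \<kappa> b" "\<Psi> y = fraction D ?S b t" using ex[OF y] by blast
      note k = SU[OF a(2)] SU[OF b(2)]
      have "x \<otimes>\<^bsub>F\<^esub> (\<kappa> s \<otimes>\<^bsub>F\<^esub> \<kappa> t) = \<kappa> a \<otimes>\<^bsub>F\<^esub> \<kappa> t" unfolding a(3)[symmetric] using x k by (simp add: F.m_assoc)
      also have "\<dots> = \<kappa> b \<otimes>\<^bsub>F\<^esub> \<kappa> s" using eq eq_iff a b by metis
      also have "\<dots> = y \<otimes>\<^bsub>F\<^esub> (\<kappa> s \<otimes>\<^bsub>F\<^esub> \<kappa> t)" unfolding b(3)[symmetric] using y k by (simp add: F.m_ac)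
      finally show "x = y"
        using F.m_rcancel[of "\<kappa> s \<otimes>\<^bsub>F\<^esub> \<kappa> t" x y] F.integral_iff[of "\<kappa> s" "\<kappa> t"] k x y by simp
    qed
    moreover have "\<Psi> ` carrier F = carrier ?Q"
    proof (intro equalityI subsetI)
      fix q assume "q \<in> \<Psi> ` carrier F"
      then show "q \<in> carrier ?Q" using ex S.fraction_closed by (metis imageE)
    next
      fix q assume "q \<in> carrier ?Q"
      then obtain a s where a: "a \<in> carrier D" "s \<in> ?S" "q = fraction D ?S a s" by (auto simp: S.localization_simps)
      have U: "\<kappa> s \<in> Units F" using SU[OF a(2)] by (simp add: F.field_Units)
      then have "\<kappa> a \<otimes>\<^bsub>F\<^esub> inv\<^bsub>F\<^esub> \<kappa> s \<otimes>\<^bsub>F\<^esub> \<kappa> s = \<kappa> a" using h(1)[OF a(1)] by (simp add: F.m_assoc F.Units_closed)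
      then have "\<Psi> (\<kappa> a \<otimes>\<^bsub>F\<^esub> inv\<^bsub>F\<^esub> \<kappa> s) = q" unfolding a(3) using h(1)[OF a(1)] U a by (intro \<Psi>) auto
      then show "q \<in> \<Psi> ` carrier F" using h(1)[OF a(1)] U by blast
    qed
    ultimately show "bij_betw \<Psi> (carrier F) (carrier ?Q)" by (simp add: bij_betw_def)
  qed
  have \<Psi>0: "\<Psi> \<zero>\<^bsub>F\<^esub> = \<zero>\<^bsub>?Q\<^esub>" using \<Psi>\<kappa>[of "\<zero>\<^bsub>D\<^esub>"] by (simp add: h S.localization_simps)
  \<comment> \<open>The ring axioms of the fraction field are carried over from F along the
    bijection; by \<open>\<Psi>0\<close> the update of \<open>zero\<close> changes nothing.\<close>
  have "cring (?Q\<lparr>ring.zero := \<Psi> \<zero>\<^bsub>F\<^esub>\<rparr>)" by (rule F.ring_iso_imp_img_cring[OF hom])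
  then have Q: "cring ?Q" by (simp add: \<Psi>0)
  interpret Q: cring ?Q by (rule Q)
  interpret \<Psi>: ring_hom_cring F ?Q \<Psi>
    using hom by unfold_locales (simp add: ring_iso_def)
  \<comment> \<open>Preimages of the coefficients, because \<open>integrally_closed_domain\<close>
    takes them in D itself.\<close>
  define e where "e = (\<lambda>i. SOME a. a \<in> carrier D \<and> c i = \<kappa> a)"
  have e: "e i \<in> carrier D" "c i = \<kappa> (e i)" if "i < n" for i
    using someI_ex[of "\<lambda>a. a \<in> carrier D \<and> c i = \<kappa> a"] c[OF that] unfolding e_def by blast+
  have cF: "c i \<in> carrier F" if "i < n" for i using e[OF that] h(1) by simp
  have "\<Psi> ((z [^]\<^bsub>F\<^esub> n) \<oplus>\<^bsub>F\<^esub> (\<Oplus>\<^bsub>F\<^esub>i\<in>{..<n}. c i \<otimes>\<^bsub>F\<^esub> (z [^]\<^bsub>F\<^esub> i))) = \<zero>\<^bsub>?Q\<^esub>" unfolding rel \<Psi>0 ..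
  moreover have "\<Psi> ((z [^]\<^bsub>F\<^esub> n) \<oplus>\<^bsub>F\<^esub> (\<Oplus>\<^bsub>F\<^esub>i\<in>{..<n}. c i \<otimes>\<^bsub>F\<^esub> (z [^]\<^bsub>F\<^esub> i)))
      = (\<Psi> z [^]\<^bsub>?Q\<^esub> n) \<oplus>\<^bsub>?Q\<^esub> \<Psi> (\<Oplus>\<^bsub>F\<^esub>i\<in>{..<n}. c i \<otimes>\<^bsub>F\<^esub> (z [^]\<^bsub>F\<^esub> i))"
    using z cF by (subst \<Psi>.hom_add) (auto simp: \<Psi>.ring.hom_nat_pow intro!: F.finsum_closed)
  moreover have "\<Psi> (\<Oplus>\<^bsub>F\<^esub>i\<in>{..<n}. c i \<otimes>\<^bsub>F\<^esub> (z [^]\<^bsub>F\<^esub> i))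
      = (\<Oplus>\<^bsub>?Q\<^esub>i\<in>{..<n}. fraction D ?S (e i) \<one>\<^bsub>D\<^esub> \<otimes>\<^bsub>?Q\<^esub> (\<Psi> z [^]\<^bsub>?Q\<^esub> i))"
  proof -
    have "\<Psi> (\<Oplus>\<^bsub>F\<^esub>i\<in>{..<n}. c i \<otimes>\<^bsub>F\<^esub> (z [^]\<^bsub>F\<^esub> i))
        = (\<Oplus>\<^bsub>?Q\<^esub>i\<in>{..<n}. (\<Psi> \<circ> (\<lambda>i. c i \<otimes>\<^bsub>F\<^esub> (z [^]\<^bsub>F\<^esub> i))) i)"
      using z cF by (intro \<Psi>.hom_finsum) auto
    also have "\<dots> = (\<Oplus>\<^bsub>?Q\<^esub>i\<in>{..<n}. fraction D ?S (e i) \<one>\<^bsub>D\<^esub> \<otimes>\<^bsub>?Q\<^esub> (\<Psi> z [^]\<^bsub>?Q\<^esub> i))"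
    proof (rule Q.finsum_cong'[OF refl])
      show "(\<lambda>i. fraction D ?S (e i) \<one>\<^bsub>D\<^esub> \<otimes>\<^bsub>?Q\<^esub> (\<Psi> z [^]\<^bsub>?Q\<^esub> i)) \<in> {..<n} \<rightarrow> carrier ?Q"
        using z e(1) S.fraction_closed[OF _ S.S_one] by auto
      show "(\<Psi> \<circ> (\<lambda>i. c i \<otimes>\<^bsub>F\<^esub> (z [^]\<^bsub>F\<^esub> i))) i = fraction D ?S (e i) \<one>\<^bsub>D\<^esub> \<otimes>\<^bsub>?Q\<^esub> (\<Psi> z [^]\<^bsub>?Q\<^esub> i)"
        if "i \<in> {..<n}" for i
        using z that cF[of i] e[of i] \<Psi>\<kappa>[of "e i"] by (simp add: \<Psi>.ring.hom_nat_pow)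
    qed
    finally show ?thesis .
  qed
  ultimately have "(\<Psi> z [^]\<^bsub>?Q\<^esub> n) \<oplus>\<^bsub>?Q\<^esub>
      (\<Oplus>\<^bsub>?Q\<^esub>i\<in>{..<n}. fraction D ?S (e i) \<one>\<^bsub>D\<^esub> \<otimes>\<^bsub>?Q\<^esub> (\<Psi> z [^]\<^bsub>?Q\<^esub> i)) = \<zero>\<^bsub>?Q\<^esub>" by simp
  then have "\<Psi> z \<in> (\<lambda>a. fraction D ?S a \<one>\<^bsub>D\<^esub>) ` carrier D"
    using D \<Psi>.hom_closed[OF z] e(1) unfolding integrally_closed_domain_def Let_def by blast
  then obtain d where d: "d \<in> carrier D" "\<Psi> z = \<Psi> (\<kappa> d)" using \<Psi>\<kappa> by auto
  have "z = \<kappa> d"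
    using ring_iso_memE(5)[OF hom] d z h(1) by (auto simp: bij_betw_def dest: inj_onD)
  then show ?thesis using d(1) by blast
qed

section \<open>Stalks\<close>

context is_ringed_space
begin

abbreviation "opn \<equiv> openin (topo \<S>)"

lemma res_closed: "\<lbrakk>opn U; opn V; V \<subseteq> U; s \<in> carrier (sect \<S> U)\<rbrakk> \<Longrightarrow> res \<S> U V s \<in> carrier (sect \<S> V)"
  using res_hom ring_hom_closed by metis

lemma mem_germ: "(V, t) \<in> germ \<S> x U s \<longleftrightarrow> opn V \<and> x \<in> V \<and> t \<in> carrier (sect \<S> V) \<and>
    (\<exists>W. opn W \<and> x \<in> W \<and> W \<subseteq> U \<inter> V \<and> res \<S> U W s = res \<S> V W t)"
  by (simp add: germ_def)

lemma mem_germ_self: "\<lbrakk>opn U; x \<in> U; s \<in> carrier (sect \<S> U)\<rbrakk> \<Longrightarrow> (U, s) \<in> germ \<S> x U s"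
  by (auto simp: mem_germ)

lemma mem_germ_trans:
  assumes U: "opn U" "x \<in> U" "s \<in> carrier (sect \<S> U)"
    and 1: "(V, t) \<in> germ \<S> x U s" and 2: "(V', t') \<in> germ \<S> x V t"
  shows "(V', t') \<in> germ \<S> x U s"
proof -
  obtain W where W: "opn W" "x \<in> W" "W \<subseteq> U \<inter> V" "res \<S> U W s = res \<S> V W t"
    and V: "opn V" "x \<in> V" "t \<in> carrier (sect \<S> V)" using 1 by (auto simp: mem_germ)
  obtain W' where W': "opn W'" "x \<in> W'" "W' \<subseteq> V \<inter> V'" "res \<S> V W' t = res \<S> V' W' t'"
    and V': "opn V'" "x \<in> V'" "t' \<in> carrier (sect \<S> V')" using 2 by (auto simp: mem_germ)
  let ?W = "W \<inter> W'"
  have o: "opn ?W" using W W' by blast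
  have "res \<S> U ?W s = res \<S> W ?W (res \<S> U W s)"
    by (rule res_trans[OF U(1) W(1) o _ _ U(3), symmetric]) (use W in auto)
  also have "\<dots> = res \<S> V ?W t" unfolding W(4) by (rule res_trans[OF V(1) W(1) o _ _ V(3)]) (use W in auto)
  also have "\<dots> = res \<S> W' ?W (res \<S> V W' t)"
    by (rule res_trans[OF V(1) W'(1) o _ _ V(3), symmetric]) (use W' in auto)
  also have "\<dots> = res \<S> V' ?W t'" unfolding W'(4) by (rule res_trans[OF V'(1) W'(1) o _ _ V'(3)]) (use W' in auto)
  finally have "res \<S> U ?W s = res \<S> V' ?W t'" .
  moreover have "?W \<subseteq> U \<inter> V'" "x \<in> ?W" using W W' by auto
  ultimately show ?thesis unfolding mem_germ using V' o by blast
qed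

lemma mem_germ_sym:
  assumes "opn U" "x \<in> U" "s \<in> carrier (sect \<S> U)" "(V, t) \<in> germ \<S> x U s"
  shows "(U, s) \<in> germ \<S> x V t"
proof -
  have V: "opn V" "x \<in> V" "\<exists>W. opn W \<and> x \<in> W \<and> W \<subseteq> U \<inter> V \<and> res \<S> U W s = res \<S> V W t"
    using assms(4) unfolding mem_germ by simp_all
  then have "\<exists>W. opn W \<and> x \<in> W \<and> W \<subseteq> V \<inter> U \<and> res \<S> V W t = res \<S> U W s"
    by (metis Int_commute)
  then show ?thesis unfolding mem_germ using assms(1-3) by simp
qed

lemma germ_eqI:
  assumes U: "opn U" "x \<in> U" "s \<in> carrier (sect \<S> U)" and t: "(V, t) \<in> germ \<S> x U s"
  shows "germ \<S> x V t = germ \<S> x U s"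
proof -
  have V: "opn V" "x \<in> V" "t \<in> carrier (sect \<S> V)" using t by (auto simp: mem_germ)
  show ?thesis
    using mem_germ_trans[OF U t] mem_germ_trans[OF V mem_germ_sym[OF U t]] by auto
qed

lemma germ_eq_iff:
  assumes U: "opn U" "x \<in> U" "s \<in> carrier (sect \<S> U)" and V: "opn V" "x \<in> V" "t \<in> carrier (sect \<S> V)"
  shows "germ \<S> x U s = germ \<S> x V t \<longleftrightarrow> (\<exists>W. opn W \<and> x \<in> W \<and> W \<subseteq> U \<inter> V \<and> res \<S> U W s = res \<S> V W t)"
proof
  assume "germ \<S> x U s = germ \<S> x V t"
  then have "(V, t) \<in> germ \<S> x U s" using mem_germ_self[OF V] by simp
  then show "\<exists>W. opn W \<and> x \<in> W \<and> W \<subseteq> U \<inter> V \<and> res \<S> U W s = res \<S> V W t" unfolding mem_germ by simp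
next
  assume "\<exists>W. opn W \<and> x \<in> W \<and> W \<subseteq> U \<inter> V \<and> res \<S> U W s = res \<S> V W t"
  then have "(V, t) \<in> germ \<S> x U s" unfolding mem_germ using V by simp
  then show "germ \<S> x U s = germ \<S> x V t" using germ_eqI[OF U] by simp
qed

lemma germ_res:
  assumes "opn U" "opn V" "V \<subseteq> U" "x \<in> V" "s \<in> carrier (sect \<S> U)"
  shows "germ \<S> x V (res \<S> U V s) = germ \<S> x U s"
proof (rule germ_eqI)
  have "res \<S> U V s = res \<S> V V (res \<S> U V s)" using res_id[OF assms(2) res_closed] assms by simp
  then show "(V, res \<S> U V s) \<in> germ \<S> x U s"
    unfolding mem_germ using assms res_closed by blast
qed (use assms in auto)

lemma germ_closed: "\<lbrakk>opn U; x \<in> U; s \<in> carrier (sect \<S> U)\<rbrakk> \<Longrightarrow> germ \<S> x U s \<in> carrier (stalk \<S> x)"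
  by (auto simp: stalk_def)

lemma stalk_cases:
  assumes "a \<in> carrier (stalk \<S> x)"
  obtains U s where "opn U" "x \<in> U" "s \<in> carrier (sect \<S> U)" "a = germ \<S> x U s"
  using assms by (auto simp: stalk_def)

text \<open>Addition and multiplication of germs have the same form, so both are covered by an
  operation m compatible with restriction. Independence of representatives is witnessed on the
  intersection of the neighbourhoods where the old and new representatives agree.\<close>

lemma germ_binop:
  assumes U: "opn U" "x \<in> U" "s \<in> carrier (sect \<S> U)" and V: "opn V" "x \<in> V" "t \<in> carrier (sect \<S> V)"
    and closed: "\<And>W a b. \<lbrakk>opn W; a \<in> carrier (sect \<S> W); b \<in> carrier (sect \<S> W)\<rbrakk> \<Longrightarrow> m W a b \<in> carrier (sect \<S> W)"
    and hom: "\<And>W W' a b. \<lbrakk>opn W; opn W'; W' \<subseteq> W; a \<in> carrier (sect \<S> W); b \<in> carrier (sect \<S> W)\<rbrakk>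
      \<Longrightarrow> res \<S> W W' (m W a b) = m W' (res \<S> W W' a) (res \<S> W W' b)"
  shows "(\<Union>(U', s')\<in>germ \<S> x U s. \<Union>(V', t')\<in>germ \<S> x V t.
      germ \<S> x (U' \<inter> V') (m (U' \<inter> V') (res \<S> U' (U' \<inter> V') s') (res \<S> V' (U' \<inter> V') t')))
    = germ \<S> x (U \<inter> V) (m (U \<inter> V) (res \<S> U (U \<inter> V) s) (res \<S> V (U \<inter> V) t))" (is "?L = ?G U s V t")
proof -
  have "?G U' s' V' t' = ?G U s V t" if st: "(U', s') \<in> germ \<S> x U s" "(V', t') \<in> germ \<S> x V t" for U' s' V' t'
  proof -
    obtain W where W: "opn W" "x \<in> W" "W \<subseteq> U \<inter> U'" "res \<S> U W s = res \<S> U' W s'"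
      and U': "opn U'" "x \<in> U'" "s' \<in> carrier (sect \<S> U')" using st(1) by (auto simp: mem_germ)
    obtain W' where W': "opn W'" "x \<in> W'" "W' \<subseteq> V \<inter> V'" "res \<S> V W' t = res \<S> V' W' t'"
      and V': "opn V'" "x \<in> V'" "t' \<in> carrier (sect \<S> V')" using st(2) by (auto simp: mem_germ)
    let ?W = "W \<inter> W'"
    have o: "opn ?W" using W W' by blast
    have r: "res \<S> (P \<inter> Q) ?W (m (P \<inter> Q) (res \<S> P (P \<inter> Q) a) (res \<S> Q (P \<inter> Q) b))
        = m ?W (res \<S> P ?W a) (res \<S> Q ?W b)"
      if P: "opn P" "a \<in> carrier (sect \<S> P)" and Q: "opn Q" "b \<in> carrier (sect \<S> Q)"
        and "?W \<subseteq> P \<inter> Q" for P Q a b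
    proof -
      have PQ: "opn (P \<inter> Q)" using P Q by blast
      show ?thesis
        using hom[OF PQ o that(5) res_closed[OF P(1) PQ _ P(2)] res_closed[OF Q(1) PQ _ Q(2)]]
          res_trans[OF P(1) PQ o that(5) _ P(2)] res_trans[OF Q(1) PQ o that(5) _ Q(2)] by simp
    qed
    have "res \<S> U ?W s = res \<S> U' ?W s'"
      using res_trans[OF U(1) W(1) o _ _ U(3)] res_trans[OF U'(1) W(1) o _ _ U'(3)] W(3,4) by auto
    moreover have "res \<S> V ?W t = res \<S> V' ?W t'"
      using res_trans[OF V(1) W'(1) o _ _ V(3)] res_trans[OF V'(1) W'(1) o _ _ V'(3)] W'(3,4) by auto
    moreover have s: "?W \<subseteq> U \<inter> V" "?W \<subseteq> U' \<inter> V'" "x \<in> ?W" using W W' by auto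
    ultimately have eq: "res \<S> (U' \<inter> V') ?W (m (U' \<inter> V') (res \<S> U' (U' \<inter> V') s') (res \<S> V' (U' \<inter> V') t'))
        = res \<S> (U \<inter> V) ?W (m (U \<inter> V) (res \<S> U (U \<inter> V) s) (res \<S> V (U \<inter> V) t))"
      using r[OF U(1,3) V(1,3)] r[OF U'(1,3) V'(1,3)] by simp
    have c: "opn (P \<inter> Q) \<and> m (P \<inter> Q) (res \<S> P (P \<inter> Q) a) (res \<S> Q (P \<inter> Q) b) \<in> carrier (sect \<S> (P \<inter> Q))"
      if "opn P" "a \<in> carrier (sect \<S> P)" "opn Q" "b \<in> carrier (sect \<S> Q)" for P Q a b
      using that by (intro conjI closed res_closed openin_Int) auto
    show ?thesis
      using c[OF U'(1,3) V'(1,3)] c[OF U(1,3) V(1,3)] U V U' V' eq s o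
      by (subst germ_eq_iff) (auto intro!: exI[of _ ?W])
  qed
  then show ?thesis using mem_germ_self[OF U] mem_germ_self[OF V] by fast
qed

lemma stalk_mult:
  assumes U: "opn U" "x \<in> U" "s \<in> carrier (sect \<S> U)" and V: "opn V" "x \<in> V" "t \<in> carrier (sect \<S> V)"
  shows "germ \<S> x U s \<otimes>\<^bsub>stalk \<S> x\<^esub> germ \<S> x V t
    = germ \<S> x (U \<inter> V) (res \<S> U (U \<inter> V) s \<otimes>\<^bsub>sect \<S> (U \<inter> V)\<^esub> res \<S> V (U \<inter> V) t)"
  unfolding stalk_def monoid.simps
  by (rule germ_binop[OF U V, where m = "\<lambda>U. (\<otimes>\<^bsub>sect \<S> U\<^esub>)"])
    (use ring_hom_mult[OF res_hom] in \<open>auto intro!: monoid.m_closed[OF ring.is_monoid[OF cring.axioms(1)]] sect_cring\<close>)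

lemma stalk_add:
  assumes U: "opn U" "x \<in> U" "s \<in> carrier (sect \<S> U)" and V: "opn V" "x \<in> V" "t \<in> carrier (sect \<S> V)"
  shows "germ \<S> x U s \<oplus>\<^bsub>stalk \<S> x\<^esub> germ \<S> x V t
    = germ \<S> x (U \<inter> V) (res \<S> U (U \<inter> V) s \<oplus>\<^bsub>sect \<S> (U \<inter> V)\<^esub> res \<S> V (U \<inter> V) t)"
  unfolding stalk_def ring_record_simps
  by (rule germ_binop[OF U V, where m = "\<lambda>U. (\<oplus>\<^bsub>sect \<S> U\<^esub>)"])
    (use ring_hom_add[OF res_hom] in \<open>auto intro!: ring.ring_simprules(1) cring.axioms(1) sect_cring\<close>)

lemma stalk_one: "\<one>\<^bsub>stalk \<S> x\<^esub> = germ \<S> x (points \<S>) \<one>\<^bsub>sect \<S> (points \<S>)\<^esub>"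
  by (simp add: stalk_def)

lemma germ_hom:
  assumes U: "opn U" "x \<in> U"
  shows "germ \<S> x U \<in> ring_hom (sect \<S> U) (stalk \<S> x)"
proof (rule ring_hom_memI)
  interpret R: cring "sect \<S> U" using sect_cring U by blast
  interpret T: cring "sect \<S> (points \<S>)" using sect_cring by blast
  show "germ \<S> x U s \<in> carrier (stalk \<S> x)" if "s \<in> carrier (sect \<S> U)" for s
    using germ_closed U that by blast
  fix s t assume s: "s \<in> carrier (sect \<S> U)" and t: "t \<in> carrier (sect \<S> U)"
  show "germ \<S> x U (s \<otimes>\<^bsub>sect \<S> U\<^esub> t) = germ \<S> x U s \<otimes>\<^bsub>stalk \<S> x\<^esub> germ \<S> x U t"
    unfolding stalk_mult[OF U s U t] using res_id[OF U(1)] s t by simp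
  show "germ \<S> x U (s \<oplus>\<^bsub>sect \<S> U\<^esub> t) = germ \<S> x U s \<oplus>\<^bsub>stalk \<S> x\<^esub> germ \<S> x U t"
    unfolding stalk_add[OF U s U t] using res_id[OF U(1)] s t by simp
next
  interpret T: cring "sect \<S> (points \<S>)" using sect_cring by blast
  have "U \<subseteq> points \<S>" using U openin_subset by blast
  then show "germ \<S> x U \<one>\<^bsub>sect \<S> U\<^esub> = \<one>\<^bsub>stalk \<S> x\<^esub>"
    unfolding stalk_one using germ_res[of "points \<S>" U x "\<one>\<^bsub>sect \<S> (points \<S>)\<^esub>"] U
      ring_hom_one[OF res_hom, of "points \<S>" U] by simp
qed

text \<open>Every neighbourhood of x contains y, so an open set on which two representatives agree
  near x also serves at y. The union defining \<open>cospecialization\<close> thus runs over equal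
  germs.\<close>

lemma cospecialization_germ:
  assumes y: "\<And>W. \<lbrakk>opn W; x \<in> W\<rbrakk> \<Longrightarrow> y \<in> W" and U: "opn U" "x \<in> U" "s \<in> carrier (sect \<S> U)"
  shows "cospecialization \<S> x y (germ \<S> x U s) = germ \<S> y U s"
proof -
  have "germ \<S> y V t = germ \<S> y U s" if Vt: "(V, t) \<in> germ \<S> x U s" for V t
  proof -
    obtain W where W: "opn W" "x \<in> W" "W \<subseteq> U \<inter> V" "res \<S> U W s = res \<S> V W t"
      and V: "opn V" "x \<in> V" "t \<in> carrier (sect \<S> V)" using Vt by (auto simp: mem_germ)
    then have "(V, t) \<in> germ \<S> y U s" unfolding mem_germ using y by blast
    then show ?thesis using germ_eqI[OF U(1) _ U(3)] y U by blast
  qed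
  then show ?thesis unfolding cospecialization_def using mem_germ_self[OF U] by fast
qed

lemma cospecialization_hom:
  assumes y: "\<And>W. \<lbrakk>opn W; x \<in> W\<rbrakk> \<Longrightarrow> y \<in> W" and x: "x \<in> points \<S>"
  shows "cospecialization \<S> x y \<in> ring_hom (stalk \<S> x) (stalk \<S> y)"
proof (rule ring_hom_memI)
  have c: "cospecialization \<S> x y (germ \<S> x U s) = germ \<S> y U s"
    if "opn U" "x \<in> U" "s \<in> carrier (sect \<S> U)" for U s
    using that by (rule cospecialization_germ[rotated]) (rule y)
  show "cospecialization \<S> x y a \<in> carrier (stalk \<S> y)" if "a \<in> carrier (stalk \<S> x)" for a
    using that by (rule stalk_cases) (use c germ_closed y in auto)
  have "opn (points \<S>)" by simp
  moreover have "\<one>\<^bsub>sect \<S> (points \<S>)\<^esub> \<in> carrier (sect \<S> (points \<S>))"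
    using sect_cring[of "points \<S>"] cring.axioms(1) ring.ring_simprules(6) by blast
  ultimately show "cospecialization \<S> x y \<one>\<^bsub>stalk \<S> x\<^esub> = \<one>\<^bsub>stalk \<S> y\<^esub>"
    unfolding stalk_one using c x by blast
  fix a b assume "a \<in> carrier (stalk \<S> x)" "b \<in> carrier (stalk \<S> x)"
  then obtain U s V t where U: "opn U" "x \<in> U" "s \<in> carrier (sect \<S> U)" "a = germ \<S> x U s"
    and V: "opn V" "x \<in> V" "t \<in> carrier (sect \<S> V)" "b = germ \<S> x V t"
    by (meson stalk_cases)
  interpret R: cring "sect \<S> (U \<inter> V)" using sect_cring U V by blast
  have yUV: "y \<in> U" "y \<in> V" using y U V by blast+
  have o: "opn (U \<inter> V)" "x \<in> U \<inter> V" using U V by auto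
  have r: "res \<S> U (U \<inter> V) s \<in> carrier (sect \<S> (U \<inter> V))" "res \<S> V (U \<inter> V) t \<in> carrier (sect \<S> (U \<inter> V))"
    using res_closed U V o by auto
  show "cospecialization \<S> x y (a \<otimes>\<^bsub>stalk \<S> x\<^esub> b)
      = cospecialization \<S> x y a \<otimes>\<^bsub>stalk \<S> y\<^esub> cospecialization \<S> x y b"
    unfolding U(4) V(4) stalk_mult[OF U(1-3) V(1-3)] c[OF U(1-3)] c[OF V(1-3)]
      stalk_mult[OF U(1) yUV(1) U(3) V(1) yUV(2) V(3)] by (rule c[OF o]) (use r in auto)
  show "cospecialization \<S> x y (a \<oplus>\<^bsub>stalk \<S> x\<^esub> b)
      = cospecialization \<S> x y a \<oplus>\<^bsub>stalk \<S> y\<^esub> cospecialization \<S> x y b"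
    unfolding U(4) V(4) stalk_add[OF U(1-3) V(1-3)] c[OF U(1-3)] c[OF V(1-3)]
      stalk_add[OF U(1) yUV(1) U(3) V(1) yUV(2) V(3)] by (rule c[OF o]) (use r in auto)
qed

end

section \<open>Affine charts\<close>

lemma openin_spec:
  "openin (spec_topology A) U \<longleftrightarrow> (\<exists>E. E \<subseteq> carrier A \<and> U = {p. primeideal p A \<and> \<not> E \<subseteq> p})"
  unfolding spec_topology_def topology_inverse'[OF istopology_spec] ..

lemma openin_basic: "a \<in> carrier A \<Longrightarrow> openin (spec_topology A) {p. primeideal p A \<and> a \<notin> p}"
  unfolding openin_spec by (intro exI[of _ "{a}"]) auto

lemma prime_proper:
  assumes "primeideal p A"
  shows "p \<subseteq> carrier A" "\<not> carrier A \<subseteq> p"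
  using primeideal.I_notcarr[OF assms] additive_subgroup.a_subset[OF ideal.axioms(1)[OF primeideal.axioms(1)[OF assms]]]
  by auto

lemma topspace_spec: "topspace (spec_topology A) = {p. primeideal p A}"
proof
  show "topspace (spec_topology A) \<subseteq> {p. primeideal p A}"
    unfolding topspace_def openin_spec by blast
  have "openin (spec_topology A) {p. primeideal p A}"
    unfolding openin_spec using prime_proper(2) by (intro exI[of _ "carrier A"]) auto
  then show "{p. primeideal p A} \<subseteq> topspace (spec_topology A)" by (rule openin_subset)
qed

lemma spec_prime: "\<lbrakk>openin (spec_topology A) V; p \<in> V\<rbrakk> \<Longrightarrow> primeideal p A"
  using openin_subset topspace_spec by blast

lemma openin_spec_basis:
  assumes "openin (spec_topology A) V" "p \<in> V"
  obtains a where "a \<in> carrier A" "a \<notin> p" "{q. primeideal q A \<and> a \<notin> q} \<subseteq> V"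
  using assms unfolding openin_spec by blast

definition frac_section :: "'a ring \<Rightarrow> 'a set set \<Rightarrow> 'a \<Rightarrow> 'a \<Rightarrow> 'a set \<Rightarrow> ('a \<times> 'a) set" where
  "frac_section A V a h = (\<lambda>p\<in>V. fraction A (carrier A - p) a h)"

lemma Spec_simps:
  "topo (Spec A) = spec_topology A"
  "carrier (sect (Spec A) V) = spec_sections A V"
  "\<one>\<^bsub>sect (Spec A) V\<^esub> = (\<lambda>p\<in>V. \<one>\<^bsub>localization_at A p\<^esub>)"
  "\<zero>\<^bsub>sect (Spec A) V\<^esub> = (\<lambda>p\<in>V. \<zero>\<^bsub>localization_at A p\<^esub>)"
  "s \<otimes>\<^bsub>sect (Spec A) V\<^esub> t = (\<lambda>p\<in>V. s p \<otimes>\<^bsub>localization_at A p\<^esub> t p)"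
  "s \<oplus>\<^bsub>sect (Spec A) V\<^esub> t = (\<lambda>p\<in>V. s p \<oplus>\<^bsub>localization_at A p\<^esub> t p)"
  "res (Spec A) V W s = restrict s W"
  by (simp_all add: Spec_def)

lemma restrict_frac_section: "W \<subseteq> V \<Longrightarrow> restrict (frac_section A V a h) W = frac_section A W a h"
  by (auto simp: frac_section_def restrict_def fun_eq_iff)

lemma frac_section_closed:
  assumes V: "openin (spec_topology A) V" and a: "a \<in> carrier A" "h \<in> carrier A" and h: "\<And>p. p \<in> V \<Longrightarrow> h \<notin> p"
  shows "frac_section A V a h \<in> spec_sections A V"
proof -
  have "frac_section A V a h \<in> (\<Pi>\<^sub>E p\<in>V. carrier (localization_at A p))"
    unfolding frac_section_def
    using mult_subset.fraction_closed[OF mult_subset_prime[OF spec_prime[OF V]]] a h by auto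
  moreover have "\<forall>q\<in>V. h \<notin> q \<and> frac_section A V a h q = fraction A (carrier A - q) a h"
    using h by (simp add: frac_section_def)
  ultimately show ?thesis unfolding spec_sections_def using V a by blast
qed

lemma spec_section_cases:
  assumes s: "s \<in> spec_sections A V" and p: "p \<in> V"
  obtains W a h where "openin (spec_topology A) W" "p \<in> W" "W \<subseteq> V" "a \<in> carrier A" "h \<in> carrier A"
    "\<And>q. q \<in> W \<Longrightarrow> h \<notin> q" "restrict s W = frac_section A W a h"
proof -
  obtain W a h where W: "openin (spec_topology A) W" "p \<in> W" "W \<subseteq> V" "a \<in> carrier A" "h \<in> carrier A"
    and q: "\<forall>q\<in>W. h \<notin> q \<and> s q = fraction A (carrier A - q) a h"
  proof -
    have "\<forall>p\<in>V. \<exists>W. openin (spec_topology A) W \<and> p \<in> W \<and> W \<subseteq> V \<and>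
        (\<exists>a\<in>carrier A. \<exists>h\<in>carrier A. \<forall>q\<in>W. h \<notin> q \<and> s q = fraction A (carrier A - q) a h)"
      using s unfolding spec_sections_def mem_Collect_eq by (rule conjunct2)
    from bspec[OF this p] show ?thesis by (elim exE bexE conjE) (rule that)
  qed
  have "restrict s W = frac_section A W a h" using q by (auto simp: frac_section_def restrict_def fun_eq_iff)
  moreover have "\<And>q. q \<in> W \<Longrightarrow> h \<notin> q" using q by blast
  ultimately show ?thesis using that W by metis
qed

lemma frac_section_mult:
  assumes V: "openin (spec_topology A) V" and a: "a \<in> carrier A" "h \<in> carrier A" "\<And>p. p \<in> V \<Longrightarrow> h \<notin> p"
    and b: "b \<in> carrier A" "k \<in> carrier A" "\<And>p. p \<in> V \<Longrightarrow> k \<notin> p"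
  shows "frac_section A V a h \<otimes>\<^bsub>sect (Spec A) V\<^esub> frac_section A V b k
    = frac_section A V (a \<otimes>\<^bsub>A\<^esub> b) (h \<otimes>\<^bsub>A\<^esub> k)"
  unfolding Spec_simps frac_section_def
  by (rule restrict_ext) (use mult_subset.fraction_mult[OF mult_subset_prime[OF spec_prime[OF V]]] a b in simp)

lemma frac_section_add:
  assumes V: "openin (spec_topology A) V" and a: "a \<in> carrier A" "h \<in> carrier A" "\<And>p. p \<in> V \<Longrightarrow> h \<notin> p"
    and b: "b \<in> carrier A" "k \<in> carrier A" "\<And>p. p \<in> V \<Longrightarrow> k \<notin> p"
  shows "frac_section A V a h \<oplus>\<^bsub>sect (Spec A) V\<^esub> frac_section A V b k
    = frac_section A V ((a \<otimes>\<^bsub>A\<^esub> k) \<oplus>\<^bsub>A\<^esub> (b \<otimes>\<^bsub>A\<^esub> h)) (h \<otimes>\<^bsub>A\<^esub> k)"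
  unfolding Spec_simps frac_section_def
  by (rule restrict_ext) (use mult_subset.fraction_add[OF mult_subset_prime[OF spec_prime[OF V]]] a b in simp)

lemma frac_section_eqI:
  assumes A: "cring A" and V: "openin (spec_topology A) V" and a: "a \<in> carrier A" "h \<in> carrier A" "\<And>p. p \<in> V \<Longrightarrow> h \<notin> p"
    and b: "b \<in> carrier A" "k \<in> carrier A" "\<And>p. p \<in> V \<Longrightarrow> k \<notin> p"
    and eq: "a \<otimes>\<^bsub>A\<^esub> k = b \<otimes>\<^bsub>A\<^esub> h"
  shows "frac_section A V a h = frac_section A V b k"
  unfolding frac_section_def
proof (rule restrict_ext)
  fix p assume p: "p \<in> V"
  interpret mult_subset A "carrier A - p" using mult_subset_prime spec_prime V p by blast
  show "fraction A (carrier A - p) a h = fraction A (carrier A - p) b k"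
    using S_one a b p eq by (subst fraction_eq_iff) auto
qed

text \<open>The existential data of \<open>is_spec_of\<close> are fixed as parameters; \<phi> maps
  sections on the spectrum to sections on the scheme, opposite to f.\<close>

locale affine_chart = is_ringed_space \<S> for \<S> :: "('p, 'r) ringed_space" +
  fixes U :: "'p set" and A :: "'r ring" and f :: "'p \<Rightarrow> 'r set"
    and \<phi> :: "'r set set \<Rightarrow> ('r set \<Rightarrow> ('r \<times> 'r) set) \<Rightarrow> 'r"
  assumes U_open: "opn U"
    and A_cring: "cring A"
    and homeo: "homeomorphic_map (subtopology (topo \<S>) U) (spec_topology A) f"
    and \<phi>_iso: "openin (spec_topology A) V \<Longrightarrow> \<phi> V \<in> ring_iso (sect (Spec A) V) (sect \<S> {x \<in> U. f x \<in> V})"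
    and \<phi>_res: "\<lbrakk>openin (spec_topology A) V; openin (spec_topology A) W; W \<subseteq> V; s \<in> spec_sections A V\<rbrakk>
      \<Longrightarrow> \<phi> W (restrict s W) = res \<S> {x \<in> U. f x \<in> V} {x \<in> U. f x \<in> W} (\<phi> V s)"

lemma is_spec_of_chart:
  assumes "is_ringed_space \<S>" "is_spec_of \<S> U A"
  obtains f \<phi> where "affine_chart \<S> U A f \<phi>"
proof -
  have U: "openin (topo \<S>) U" and A: "cring A" using assms(2) by (auto simp: is_spec_of_def)
  have pts: "points (open_subspace \<S> U) = U"
    using openin_subset[OF U] by (auto simp: open_subspace_def)
  have sub: "topo (open_subspace \<S> U) = subtopology (topo \<S>) U"
    "sect (open_subspace \<S> U) = sect \<S>" "res (open_subspace \<S> U) = res \<S>"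
    by (simp_all add: open_subspace_def)
  have iso: "isomorphic_ringed_spaces (open_subspace \<S> U) (Spec A)" using assms(2) by (simp add: is_spec_of_def)
  obtain f \<phi> where f: "homeomorphic_map (subtopology (topo \<S>) U) (spec_topology A) f"
    and \<phi>: "\<forall>V. openin (spec_topology A) V \<longrightarrow> \<phi> V \<in> ring_iso (sect (Spec A) V) (sect \<S> {x \<in> U. f x \<in> V})"
    "\<forall>V W s. openin (spec_topology A) V \<and> openin (spec_topology A) W \<and> W \<subseteq> V \<and> s \<in> carrier (sect (Spec A) V) \<longrightarrow>
       \<phi> W (res (Spec A) V W s) = res \<S> {x \<in> U. f x \<in> V} {x \<in> U. f x \<in> W} (\<phi> V s)"
    using iso unfolding isomorphic_ringed_spaces_def Spec_simps(1) pts unfolding sub by (elim exE conjE) (rule that)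
  have "affine_chart \<S> U A f \<phi>"
    by (intro affine_chart.intro assms(1) affine_chart_axioms.intro U A f)
      (use \<phi> in \<open>auto simp: Spec_simps\<close>)
  then show ?thesis by (rule that)
qed

section \<open>Germs of fractions in an affine chart\<close>

context affine_chart
begin

sublocale A: cring A by (rule A_cring)

abbreviation "primes \<equiv> {p. primeideal p A}"
abbreviation "sopen \<equiv> openin (spec_topology A)"

definition pre :: "'r set set \<Rightarrow> 'p set" where
  "pre V = {x \<in> U. f x \<in> V}"

lemma mem_pre: "x \<in> pre V \<longleftrightarrow> x \<in> U \<and> f x \<in> V"
  by (simp add: pre_def)

lemma topspace_U: "topspace (subtopology (topo \<S>) U) = U"
  using openin_subset[OF U_open] by auto

lemma f_bij: "bij_betw f U primes"
  using homeo unfolding homeomorphic_eq_everything_map topspace_U topspace_spec bij_betw_def by blast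

lemma f_prime: "x \<in> U \<Longrightarrow> primeideal (f x) A"
  using f_bij bij_betwE by blast

lemma prime_point: "primeideal p A \<Longrightarrow> \<exists>x\<in>U. f x = p"
  using f_bij by (metis (mono_tags, lifting) bij_betw_imp_surj_on image_iff mem_Collect_eq)

lemma openin_U: "openin (subtopology (topo \<S>) U) W \<longleftrightarrow> opn W \<and> W \<subseteq> U"
  using openin_open_subtopology[OF U_open] .

lemma pre_open: "sopen V \<Longrightarrow> opn (pre V)"
  using openin_continuous_map_preimage[OF homeomorphic_imp_continuous_map[OF homeo], of V] openin_U
  unfolding topspace_U pre_def by blast

lemma image_open: "\<lbrakk>opn W; W \<subseteq> U\<rbrakk> \<Longrightarrow> sopen (f ` W)"
  using homeomorphic_imp_open_map[OF homeo] openin_U unfolding open_map_def by blast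

lemma pre_image: "W \<subseteq> U \<Longrightarrow> pre (f ` W) = W"
  using f_bij unfolding pre_def bij_betw_def inj_on_def by blast

lemma pre_primes: "pre primes = U"
  using f_prime by (auto simp: pre_def)

lemma sopen_primes: "sopen primes"
  using openin_topspace[of "spec_topology A"] unfolding topspace_spec .

lemma primes_nonunit: "p \<in> primes \<Longrightarrow> \<one>\<^bsub>A\<^esub> \<notin> p"
  using mult_subset.S_one[OF mult_subset_prime] by blast

lemma \<phi>_hom: "sopen V \<Longrightarrow> \<phi> V \<in> ring_hom (sect (Spec A) V) (sect \<S> (pre V))"
  using \<phi>_iso unfolding ring_iso_def pre_def by blast

lemma \<phi>_closed: "\<lbrakk>sopen V; s \<in> spec_sections A V\<rbrakk> \<Longrightarrow> \<phi> V s \<in> carrier (sect \<S> (pre V))"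
  using ring_hom_closed[OF \<phi>_hom] by (simp add: Spec_simps)

definition frac_germ :: "'p \<Rightarrow> 'r set set \<Rightarrow> 'r \<Rightarrow> 'r \<Rightarrow> ('p set \<times> 'r) set" where
  "frac_germ x V a h = germ \<S> x (pre V) (\<phi> V (frac_section A V a h))"

text \<open>The canonical map from A through the sections over the chart to the stalk at x. At the
  generic point it becomes the map j of \<open>noetherian_frac\<close>.\<close>

definition \<sigma> :: "'p \<Rightarrow> 'r \<Rightarrow> ('p set \<times> 'r) set" where
  "\<sigma> x a = frac_germ x primes a \<one>\<^bsub>A\<^esub>"

lemma germ_\<phi>_restrict:
  assumes "sopen V" "sopen W" "W \<subseteq> V" "x \<in> pre W" "s \<in> spec_sections A V"
  shows "germ \<S> x (pre W) (\<phi> W (restrict s W)) = germ \<S> x (pre V) (\<phi> V s)"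
proof -
  have "pre W \<subseteq> pre V" using assms(3) by (auto simp: mem_pre)
  then show ?thesis
    using germ_res[OF pre_open[OF assms(1)] pre_open[OF assms(2)] _ assms(4) \<phi>_closed[OF assms(1,5)]]
      \<phi>_res[OF assms(1-3,5)] unfolding pre_def by simp
qed

lemma frac_germ_restrict:
  assumes V: "sopen V" "sopen W" "W \<subseteq> V" and x: "x \<in> pre W" and a: "a \<in> carrier A" "h \<in> carrier A"
    and h: "\<And>p. p \<in> V \<Longrightarrow> h \<notin> p"
  shows "frac_germ x W a h = frac_germ x V a h"
  using germ_\<phi>_restrict[OF V x frac_section_closed[OF V(1) a h]] restrict_frac_section[OF V(3)]
  unfolding frac_germ_def by simp

lemma germ_\<phi>_hom:
  assumes "sopen V" "x \<in> pre V"
  shows "(\<lambda>s. germ \<S> x (pre V) (\<phi> V s)) \<in> ring_hom (sect (Spec A) V) (stalk \<S> x)"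
  using ring_hom_trans[OF \<phi>_hom[OF assms(1)] germ_hom[OF pre_open[OF assms(1)] assms(2)]]
  by (simp add: comp_def)

lemma frac_germ_closed:
  assumes "sopen V" "x \<in> pre V" "a \<in> carrier A" "h \<in> carrier A" "\<And>p. p \<in> V \<Longrightarrow> h \<notin> p"
  shows "frac_germ x V a h \<in> carrier (stalk \<S> x)"
  unfolding frac_germ_def
  using ring_hom_closed[OF germ_\<phi>_hom[OF assms(1,2)]] frac_section_closed[OF assms(1,3,4,5)] by (simp add: Spec_simps)

lemma frac_germ_mult:
  assumes "sopen V" "x \<in> pre V" and a: "a \<in> carrier A" "h \<in> carrier A" "\<And>p. p \<in> V \<Longrightarrow> h \<notin> p"
    and b: "b \<in> carrier A" "k \<in> carrier A" "\<And>p. p \<in> V \<Longrightarrow> k \<notin> p"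
  shows "frac_germ x V a h \<otimes>\<^bsub>stalk \<S> x\<^esub> frac_germ x V b k = frac_germ x V (a \<otimes>\<^bsub>A\<^esub> b) (h \<otimes>\<^bsub>A\<^esub> k)"
  unfolding frac_germ_def
  using ring_hom_mult[OF germ_\<phi>_hom[OF assms(1,2)], of "frac_section A V a h" "frac_section A V b k"]
    frac_section_closed[OF assms(1) a] frac_section_closed[OF assms(1) b] frac_section_mult[OF assms(1) a b]
  by (simp only: Spec_simps(2))

lemma frac_section_one: "sopen V \<Longrightarrow> frac_section A V \<one>\<^bsub>A\<^esub> \<one>\<^bsub>A\<^esub> = \<one>\<^bsub>sect (Spec A) V\<^esub>"
  unfolding Spec_simps frac_section_def
  by (rule restrict_ext) (use mult_subset.localization_simps(2)[OF mult_subset_prime[OF spec_prime]] in metis)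

lemma frac_section_hom: "(\<lambda>a. frac_section A primes a \<one>\<^bsub>A\<^esub>) \<in> ring_hom A (sect (Spec A) primes)"
  by (rule ring_hom_memI)
    (use frac_section_closed[OF sopen_primes] frac_section_mult[OF sopen_primes]
      frac_section_add[OF sopen_primes] frac_section_one[OF sopen_primes] primes_nonunit
      in \<open>simp_all add: Spec_simps(2)\<close>)

lemma global_hom: "(\<lambda>a. \<phi> primes (frac_section A primes a \<one>\<^bsub>A\<^esub>)) \<in> ring_hom A (sect \<S> U)"
  using ring_hom_trans[OF frac_section_hom \<phi>_hom[OF sopen_primes]] by (simp add: comp_def pre_primes)

lemma \<sigma>_hom: "x \<in> U \<Longrightarrow> \<sigma> x \<in> ring_hom A (stalk \<S> x)"
  using ring_hom_trans[OF global_hom germ_hom[OF U_open]]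
  unfolding \<sigma>_def[abs_def] frac_germ_def pre_primes by (simp add: comp_def)

text \<open>As sections, (a/h)(h/1) = a/1; this describes the germ of a/h through \<sigma> alone,
  without dividing in the stalk.\<close>

lemma frac_germ_eq:
  assumes V: "sopen V" "x \<in> pre V" and a: "a \<in> carrier A" "h \<in> carrier A" "\<And>p. p \<in> V \<Longrightarrow> h \<notin> p"
  shows "frac_germ x V a h \<otimes>\<^bsub>stalk \<S> x\<^esub> \<sigma> x h = \<sigma> x a"
proof -
  have Vp: "V \<subseteq> primes" using spec_prime[OF V(1)] by blast
  have \<sigma>: "\<sigma> x b = frac_germ x V b \<one>\<^bsub>A\<^esub>" if "b \<in> carrier A" for b
    unfolding \<sigma>_def
    using frac_germ_restrict[OF sopen_primes V(1) Vp V(2) that A.one_closed primes_nonunit] by simp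
  have one: "\<one>\<^bsub>A\<^esub> \<notin> p" if "p \<in> V" for p using primes_nonunit Vp that by blast
  have "frac_germ x V a h \<otimes>\<^bsub>stalk \<S> x\<^esub> \<sigma> x h = frac_germ x V (a \<otimes>\<^bsub>A\<^esub> h) (h \<otimes>\<^bsub>A\<^esub> \<one>\<^bsub>A\<^esub>)"
    unfolding \<sigma>[OF a(2)] using frac_germ_mult[OF V a a(2) A.one_closed one] .
  also have "\<dots> = frac_germ x V a \<one>\<^bsub>A\<^esub>"
    unfolding frac_germ_def
    using frac_section_eqI[OF A_cring V(1), of "a \<otimes>\<^bsub>A\<^esub> h" "h \<otimes>\<^bsub>A\<^esub> \<one>\<^bsub>A\<^esub>" a "\<one>\<^bsub>A\<^esub>"] a one by simp
  finally show ?thesis using \<sigma>[OF a(1)] by simp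
qed

text \<open>A germ is represented on an open set inside the chart, comes from a section on the
  spectrum by surjectivity of \<phi>, and is a fraction near \<open>f x\<close> by the definition of
  the structure sheaf.\<close>

lemma stalk_frac:
  assumes x: "x \<in> U" and t: "t \<in> carrier (stalk \<S> x)"
  shows "\<exists>a\<in>carrier A. \<exists>h\<in>carrier A - f x. t \<otimes>\<^bsub>stalk \<S> x\<^esub> \<sigma> x h = \<sigma> x a"
proof -
  obtain W s where W: "opn W" "x \<in> W" "s \<in> carrier (sect \<S> W)" "t = germ \<S> x W s"
    using t by (rule stalk_cases)
  let ?W = "W \<inter> U" and ?V = "f ` (W \<inter> U)"
  have o: "opn ?W" "x \<in> ?W" "?W \<subseteq> U" using W U_open x by auto
  have V: "sopen ?V" and pV: "pre ?V = ?W" using image_open[OF o(1,3)] pre_image[OF o(3)] by auto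
  have "res \<S> W ?W s \<in> carrier (sect \<S> (pre ?V))" unfolding pV using res_closed W o by blast
  then obtain r where r: "r \<in> spec_sections A ?V" "\<phi> ?V r = res \<S> W ?W s"
    using ring_iso_memE(5)[OF \<phi>_iso[OF V]] unfolding bij_betw_def Spec_simps pre_def[symmetric]
    by (metis imageE)
  have t': "t = germ \<S> x (pre ?V) (\<phi> ?V r)"
    unfolding W(4) r(2) pV using germ_res[OF W(1) o(1) _ o(2) W(3)] by simp
  have fx: "f x \<in> ?V" using o by blast
  obtain V' a h where V': "sopen V'" "f x \<in> V'" "V' \<subseteq> ?V" and a: "a \<in> carrier A" "h \<in> carrier A"
    "\<And>q. q \<in> V' \<Longrightarrow> h \<notin> q" and eq: "restrict r V' = frac_section A V' a h"
    by (rule spec_section_cases[OF r(1) fx]) (rule that)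
  have xV: "x \<in> pre V'" using V' x by (simp add: mem_pre)
  have "t = frac_germ x V' a h"
    unfolding t' frac_germ_def eq[symmetric] using germ_\<phi>_restrict[OF V V'(1,3) xV r(1)] by simp
  then show ?thesis using frac_germ_eq[OF V'(1) xV a] a V'(2) by blast
qed

text \<open>The inverse is the germ of 1/h on the basic open set where h does not vanish.\<close>

lemma \<sigma>_Units:
  assumes x: "x \<in> U" and h: "h \<in> carrier A" "h \<notin> f x"
  shows "\<exists>t\<in>carrier (stalk \<S> x). t \<otimes>\<^bsub>stalk \<S> x\<^esub> \<sigma> x h = \<one>\<^bsub>stalk \<S> x\<^esub>"
proof -
  let ?V = "{p. primeideal p A \<and> h \<notin> p}"
  have V: "sopen ?V" "x \<in> pre ?V" using openin_basic h f_prime x by (auto simp: mem_pre)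
  have "frac_germ x ?V \<one>\<^bsub>A\<^esub> h \<otimes>\<^bsub>stalk \<S> x\<^esub> \<sigma> x h = \<sigma> x \<one>\<^bsub>A\<^esub>" using frac_germ_eq[OF V _ h(1)] by simp
  moreover have "frac_germ x ?V \<one>\<^bsub>A\<^esub> h \<in> carrier (stalk \<S> x)" using frac_germ_closed[OF V _ h(1)] by simp
  ultimately show ?thesis using ring_hom_one[OF \<sigma>_hom[OF x]] by auto
qed

text \<open>Equality of germs becomes equality of sections on a neighbourhood, by injectivity of
  \<phi> there; evaluated at \<open>f x\<close> it is an equality of fractions, and u is its
  multiplier.\<close>

lemma \<sigma>_zeroD:
  assumes x: "x \<in> U" and a: "a \<in> carrier A" and eq: "\<sigma> x a = \<sigma> x \<zero>\<^bsub>A\<^esub>"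
  shows "\<exists>u\<in>carrier A - f x. u \<otimes>\<^bsub>A\<^esub> a = \<zero>\<^bsub>A\<^esub>"
proof -
  let ?s = "\<lambda>a. frac_section A primes a \<one>\<^bsub>A\<^esub>"
  have c: "?s b \<in> spec_sections A primes" if "b \<in> carrier A" for b
    using frac_section_closed[OF sopen_primes that A.one_closed primes_nonunit] .
  have c': "\<phi> primes (?s b) \<in> carrier (sect \<S> U)" if "b \<in> carrier A" for b
    using \<phi>_closed[OF sopen_primes c[OF that]] by (simp only: pre_primes)
  obtain W where W: "opn W" "x \<in> W" "W \<subseteq> U" "res \<S> U W (\<phi> primes (?s a)) = res \<S> U W (\<phi> primes (?s \<zero>\<^bsub>A\<^esub>))"
    using eq germ_eq_iff[OF U_open x c'[OF a] U_open x c'[OF A.zero_closed]]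
    unfolding \<sigma>_def frac_germ_def pre_primes by auto
  let ?V = "f ` W"
  have V: "sopen ?V" "pre ?V = W" "?V \<subseteq> primes"
    using image_open[OF W(1,3)] pre_image[OF W(3)] f_prime W(3) by auto
  have "\<phi> ?V (restrict (?s b) ?V) = res \<S> U W (\<phi> primes (?s b))" if "b \<in> carrier A" for b
    using \<phi>_res[OF sopen_primes V(1,3) c[OF that]] V(2) pre_primes unfolding pre_def by simp
  then have "\<phi> ?V (frac_section A ?V a \<one>\<^bsub>A\<^esub>) = \<phi> ?V (frac_section A ?V \<zero>\<^bsub>A\<^esub> \<one>\<^bsub>A\<^esub>)"
    using W(4) a restrict_frac_section[OF V(3)] by simp
  moreover have "frac_section A ?V b \<one>\<^bsub>A\<^esub> \<in> carrier (sect (Spec A) ?V)" if "b \<in> carrier A" for b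
    unfolding Spec_simps using frac_section_closed[OF V(1) that A.one_closed] primes_nonunit V(3) by blast
  ultimately have "frac_section A ?V a \<one>\<^bsub>A\<^esub> = frac_section A ?V \<zero>\<^bsub>A\<^esub> \<one>\<^bsub>A\<^esub>"
    using ring_iso_memE(5)[OF \<phi>_iso[OF V(1)]] a unfolding bij_betw_def by (meson A.zero_closed inj_onD)
  then have "frac_section A ?V a \<one>\<^bsub>A\<^esub> (f x) = frac_section A ?V \<zero>\<^bsub>A\<^esub> \<one>\<^bsub>A\<^esub> (f x)" by simp
  then have "fraction A (carrier A - f x) a \<one>\<^bsub>A\<^esub> = fraction A (carrier A - f x) \<zero>\<^bsub>A\<^esub> \<one>\<^bsub>A\<^esub>"
    using W(2) by (simp add: frac_section_def)
  then obtain u where "u \<in> carrier A - f x" "u \<otimes>\<^bsub>A\<^esub> (a \<otimes>\<^bsub>A\<^esub> \<one>\<^bsub>A\<^esub>) = u \<otimes>\<^bsub>A\<^esub> (\<zero>\<^bsub>A\<^esub> \<otimes>\<^bsub>A\<^esub> \<one>\<^bsub>A\<^esub>)"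
    using mult_subset.fraction_eq_iff[OF mult_subset_prime[OF f_prime[OF x]]] a
      mult_subset.S_one[OF mult_subset_prime[OF f_prime[OF x]]] by (metis A.zero_closed)
  then show ?thesis using a by auto
qed

end

section \<open>Krull dimension and the generic point\<close>

text \<open>Chains can be truncated, so the set of chain lengths is downward closed and lengths 1
  and 2 alone decide whether its supremum is 1.\<close>

lemma krull_dim_eq_1_iff:
  "krull_dim A = 1 \<longleftrightarrow> (\<exists>p q. primeideal p A \<and> primeideal q A \<and> p \<subset> q) \<and>
     \<not> (\<exists>p q r. primeideal p A \<and> primeideal q A \<and> primeideal r A \<and> p \<subset> q \<and> q \<subset> r)"
proof -
  let ?C = "\<lambda>n. \<exists>p. (\<forall>i\<le>n. primeideal (p i) A) \<and> (\<forall>i<n. p i \<subset> p (Suc i))"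
  have C1: "?C 1 \<longleftrightarrow> (\<exists>p q. primeideal p A \<and> primeideal q A \<and> p \<subset> q)"
  proof
    assume "\<exists>p q. primeideal p A \<and> primeideal q A \<and> p \<subset> q"
    then obtain p q where "primeideal p A" "primeideal q A" "p \<subset> q" by blast
    then show "?C 1" by (intro exI[of _ "\<lambda>i. if i = 0 then p else q"]) auto
  next
    assume "?C 1"
    then obtain p where "\<forall>i\<le>1. primeideal (p i) A" "\<forall>i<1. p i \<subset> p (Suc i)" by blast
    then have "primeideal (p 0) A" "primeideal (p 1) A" "p 0 \<subset> p 1" by simp_all
    then show "\<exists>p q. primeideal p A \<and> primeideal q A \<and> p \<subset> q" by blast
  qed
  have C2: "?C 2 \<longleftrightarrow> (\<exists>p q r. primeideal p A \<and> primeideal q A \<and> primeideal r A \<and> p \<subset> q \<and> q \<subset> r)"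
  proof
    assume "\<exists>p q r. primeideal p A \<and> primeideal q A \<and> primeideal r A \<and> p \<subset> q \<and> q \<subset> r"
    then obtain p q r where "primeideal p A" "primeideal q A" "primeideal r A" "p \<subset> q" "q \<subset> r" by blast
    then show "?C 2" by (intro exI[of _ "\<lambda>i. if i = 0 then p else if i = 1 then q else r"])
      (auto simp: less_Suc_eq numeral_2_eq_2)
  next
    assume "?C 2"
    then obtain p where p: "\<forall>i\<le>2. primeideal (p i) A" "\<forall>i<2. p i \<subset> p (Suc i)" by blast
    have "primeideal (p 0) A" "primeideal (p 1) A" "primeideal (p 2) A" using p(1) by simp_all
    moreover have "p 0 \<subset> p 1" "p 1 \<subset> p 2"
      using p(2)[rule_format, of 0] p(2)[rule_format, of 1] by (simp_all add: numeral_2_eq_2)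
    ultimately show "\<exists>p q r. primeideal p A \<and> primeideal q A \<and> primeideal r A \<and> p \<subset> q \<and> q \<subset> r" by blast
  qed
  have mono: "?C m" if n: "?C n" "m \<le> n" for m n
  proof -
    obtain p where "\<forall>i\<le>n. primeideal (p i) A" "\<forall>i<n. p i \<subset> p (Suc i)" using n(1) by blast
    then show ?thesis using n(2) by (intro exI[of _ p]) auto
  qed
  have dim: "krull_dim A = Sup {enat n |n. ?C n}" by (simp add: krull_dim_def)
  have "krull_dim A = 1 \<longleftrightarrow> ?C 1 \<and> \<not> ?C 2"
  proof
    assume 1: "krull_dim A = 1"
    have "\<not> ?C 2"
    proof
      assume "?C 2"
      then have "enat 2 \<le> krull_dim A" unfolding dim by (intro Sup_upper) blast
      then show False using 1 by (simp add: one_enat_def)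
    qed
    moreover have "?C 1"
    proof (rule ccontr)
      assume "\<not> ?C 1"
      then have "n = 0" if "?C n" for n using mono[OF that, of 1] by (cases n) auto
      then have "krull_dim A \<le> 0" unfolding dim by (intro Sup_least) (auto simp: zero_enat_def)
      then show False using 1 by simp
    qed
    ultimately show "?C 1 \<and> \<not> ?C 2" by blast
  next
    assume C: "?C 1 \<and> \<not> ?C 2"
    have "krull_dim A \<le> 1" unfolding dim
    proof (rule Sup_least)
      fix d assume "d \<in> {enat n |n. ?C n}"
      then obtain n where n: "?C n" "d = enat n" by blast
      have "n \<le> 1"
      proof (rule ccontr)
        assume "\<not> n \<le> 1"
        then show False using mono[OF n(1), of 2] C by simp
      qed
      then show "d \<le> 1" using n(2) by (simp add: one_enat_def)
    qed
    moreover have "enat 1 \<le> krull_dim A" unfolding dim using C by (intro Sup_upper) blast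
    ultimately show "krull_dim A = 1" by (simp add: one_enat_def)
  qed
  then show ?thesis unfolding C1 C2 .
qed

locale normal_noetherian_scheme =
  fixes \<S> :: "('p, 'r) ringed_space"
  assumes integral: "integral_scheme \<S>" and noetherian: "noetherian_scheme \<S>" and normal: "normal_scheme \<S>"

sublocale normal_noetherian_scheme \<subseteq> is_ringed_space \<S>
  using integral by (simp add: integral_scheme_def scheme_def locally_ringed_space_def)

context normal_noetherian_scheme
begin

lemma sect_domain: "\<lbrakk>opn W; W \<noteq> {}\<rbrakk> \<Longrightarrow> domain (sect \<S> W)"
  using integral by (simp add: integral_scheme_def)

lemma stalk_cring: "x \<in> points \<S> \<Longrightarrow> cring (stalk \<S> x)"
  using integral by (simp add: integral_scheme_def scheme_def locally_ringed_space_def is_local_ring_def)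

lemma stalk_normal: "x \<in> points \<S> \<Longrightarrow> integrally_closed_domain (stalk \<S> x)"
  using normal by (simp add: normal_scheme_def)

lemma noetherian_chart:
  assumes "x \<in> points \<S>"
  obtains U A f \<phi> where "x \<in> U" "affine_chart \<S> U A f \<phi>" "noetherian_ring A"
proof -
  obtain \<U> where \<U>: "\<Union>\<U> = points \<S>" "\<forall>U\<in>\<U>. \<exists>A. is_spec_of \<S> U A \<and> noetherian_ring A"
    using noetherian unfolding noetherian_scheme_def by blast
  then obtain U A where "x \<in> U" "is_spec_of \<S> U A" "noetherian_ring A" using assms by blast
  then show ?thesis using is_spec_of_chart[OF is_ringed_space_axioms] that by metis
qed

text \<open>Over two disjoint nonempty open sets, gluing 1 with 0 and 0 with 1 would give two
  nonzero sections with product zero in a domain.\<close>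

lemma irreducible:
  assumes V: "opn V" "V \<noteq> {}" and W: "opn W" "W \<noteq> {}"
  shows "V \<inter> W \<noteq> {}"
proof
  assume disj: "V \<inter> W = {}"
  then have VW: "V \<noteq> W" using V by blast
  have V_UN: "\<Union>{V, W} = V \<union> W" by simp
  have o: "opn (V \<union> W)" using V W by blast
  interpret D: domain "sect \<S> (V \<union> W)" using sect_domain o V by blast
  interpret DV: domain "sect \<S> V" using sect_domain V by blast
  interpret DW: domain "sect \<S> W" using sect_domain W by blast
  \<comment> \<open>Locality for the empty cover leaves at most one section over the empty set, so
    gluing over disjoint sets is unobstructed.\<close>
  have empty: "s = t" if "s \<in> carrier (sect \<S> {})" "t \<in> carrier (sect \<S> {})" for s t
    using locality[of "{}" s t] that by simp
  have glue: "\<exists>e\<in>carrier (sect \<S> (V \<union> W)). res \<S> (V \<union> W) V e = a \<and> res \<S> (V \<union> W) W e = b"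
    if a: "a \<in> carrier (sect \<S> V)" and b: "b \<in> carrier (sect \<S> W)" for a b
  proof -
    let ?\<sigma> = "\<lambda>Y. if Y = V then a else b"
    have "\<exists>s\<in>carrier (sect \<S> (\<Union>{V, W})). \<forall>Y\<in>{V, W}. res \<S> (\<Union>{V, W}) Y s = ?\<sigma> Y"
    proof (rule gluing)
      show "opn Y" if "Y \<in> {V, W}" for Y using that V W by blast
      show "?\<sigma> Y \<in> carrier (sect \<S> Y)" if "Y \<in> {V, W}" for Y using that a b by auto
      show "res \<S> Y (Y \<inter> Y') (?\<sigma> Y) = res \<S> Y' (Y \<inter> Y') (?\<sigma> Y')"
        if "Y \<in> {V, W}" "Y' \<in> {V, W}" for Y Y'
      proof (cases "Y = Y'")
        case False
        then have e: "Y \<inter> Y' = {}" using that disj by blast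
        show ?thesis unfolding e using that a b V W
          by (intro empty res_closed) auto
      qed simp
    qed
    then show ?thesis using VW unfolding V_UN by auto
  qed
  obtain e where e: "e \<in> carrier (sect \<S> (V \<union> W))"
    "res \<S> (V \<union> W) V e = \<one>\<^bsub>sect \<S> V\<^esub>" "res \<S> (V \<union> W) W e = \<zero>\<^bsub>sect \<S> W\<^esub>"
    using glue[OF DV.one_closed DW.zero_closed] by blast
  obtain e' where e': "e' \<in> carrier (sect \<S> (V \<union> W))"
    "res \<S> (V \<union> W) V e' = \<zero>\<^bsub>sect \<S> V\<^esub>" "res \<S> (V \<union> W) W e' = \<one>\<^bsub>sect \<S> W\<^esub>"
    using glue[OF DV.zero_closed DW.one_closed] by blast
  have hV: "res \<S> (V \<union> W) V \<in> ring_hom (sect \<S> (V \<union> W)) (sect \<S> V)"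
    and hW: "res \<S> (V \<union> W) W \<in> ring_hom (sect \<S> (V \<union> W)) (sect \<S> W)" using res_hom o V W by auto
  note z = ring_hom_zero[OF hV D.ring_axioms DV.ring_axioms] ring_hom_zero[OF hW D.ring_axioms DW.ring_axioms]
  have "e \<otimes>\<^bsub>sect \<S> (V \<union> W)\<^esub> e' = \<zero>\<^bsub>sect \<S> (V \<union> W)\<^esub>"
  proof (rule locality[of "{V, W}", unfolded V_UN])
    show "res \<S> (V \<union> W) Y (e \<otimes>\<^bsub>sect \<S> (V \<union> W)\<^esub> e') = res \<S> (V \<union> W) Y \<zero>\<^bsub>sect \<S> (V \<union> W)\<^esub>"
      if "Y \<in> {V, W}" for Y
      using that ring_hom_mult[OF hV e(1) e'(1)] ring_hom_mult[OF hW e(1) e'(1)] e e' z by auto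
  qed (use V W e e' in auto)
  then have "e = \<zero>\<^bsub>sect \<S> (V \<union> W)\<^esub> \<or> e' = \<zero>\<^bsub>sect \<S> (V \<union> W)\<^esub>" using D.integral e e' by blast
  then show False using e e' z DV.one_not_zero DW.one_not_zero by auto
qed

lemma generization_iff:
  "generization \<S> y x \<longleftrightarrow> y \<in> points \<S> \<and> x \<in> points \<S> \<and> (\<forall>W. opn W \<and> x \<in> W \<longrightarrow> y \<in> W)"
  unfolding generization_def in_closure_of by auto

lemma closure_eq_points_iff:
  "\<eta> \<in> points \<S> \<and> topo \<S> closure_of {\<eta>} = points \<S> \<longleftrightarrow> \<eta> \<in> points \<S> \<and> (\<forall>W. opn W \<and> W \<noteq> {} \<longrightarrow> \<eta> \<in> W)"
proof -
  have "topo \<S> closure_of {\<eta>} = points \<S> \<longleftrightarrow> points \<S> \<subseteq> topo \<S> closure_of {\<eta>}"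
    using closure_of_subset_topspace[of "topo \<S>" "{\<eta>}"] by blast
  also have "\<dots> \<longleftrightarrow> (\<forall>W. opn W \<and> W \<noteq> {} \<longrightarrow> \<eta> \<in> W)"
  proof
    assume *: "points \<S> \<subseteq> topo \<S> closure_of {\<eta>}"
    show "\<forall>W. opn W \<and> W \<noteq> {} \<longrightarrow> \<eta> \<in> W"
    proof (intro allI impI)
      fix W assume W: "opn W \<and> W \<noteq> {}"
      then obtain x where "x \<in> W" by blast
      moreover from this have "x \<in> topo \<S> closure_of {\<eta>}" using * W openin_subset by blast
      ultimately show "\<eta> \<in> W" using W by (auto simp: in_closure_of)
    qed
  next
    assume "\<forall>W. opn W \<and> W \<noteq> {} \<longrightarrow> \<eta> \<in> W"
    then show "points \<S> \<subseteq> topo \<S> closure_of {\<eta>}" unfolding subset_iff in_closure_of by blast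
  qed
  finally show ?thesis by blast
qed

end

locale chart_of_scheme = normal_noetherian_scheme \<S> + affine_chart \<S> U A f \<phi>
  for \<S> :: "('p, 'r) ringed_space" and U A f \<phi> +
  assumes noetherian_A: "noetherian_ring A" and U_nonempty: "U \<noteq> {}"
begin

lemma U_points: "U \<subseteq> points \<S>"
  using U_open by (rule openin_subset)

text \<open>The kernel of the map from A to the sections over U, which form a domain. The point
  belonging to it turns out to be the generic point (\<open>f_\<eta>\<close>).\<close>

definition least_prime :: "'r set" where
  "least_prime = {a \<in> carrier A. \<phi> primes (frac_section A primes a \<one>\<^bsub>A\<^esub>) = \<zero>\<^bsub>sect \<S> U\<^esub>}"

lemma least_prime: "primeideal least_prime A"
proof -
  interpret D: domain "sect \<S> U" using sect_domain U_open U_nonempty .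
  interpret h: ring_hom_ring A "sect \<S> U" "\<lambda>a. \<phi> primes (frac_section A primes a \<one>\<^bsub>A\<^esub>)"
    using global_hom by unfold_locales
  have "primeideal {\<zero>\<^bsub>sect \<S> U\<^esub>} (sect \<S> U)" by (rule D.zeroprimeideal)
  from h.primeideal_vimage[OF A_cring this] show ?thesis by (simp add: least_prime_def)
qed

lemma stalk_ring: "x \<in> U \<Longrightarrow> ring (stalk \<S> x)"
  using stalk_cring U_points cring.axioms(1) by blast

lemma \<sigma>_zero: "x \<in> U \<Longrightarrow> \<sigma> x \<zero>\<^bsub>A\<^esub> = \<zero>\<^bsub>stalk \<S> x\<^esub>"
  using ring_hom_zero[OF \<sigma>_hom A.ring_axioms stalk_ring] .

lemma \<sigma>_least_prime: "\<lbrakk>x \<in> U; a \<in> least_prime\<rbrakk> \<Longrightarrow> \<sigma> x a = \<zero>\<^bsub>stalk \<S> x\<^esub>"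
  using ring_hom_zero[OF germ_hom[OF U_open] cring.axioms(1)[OF sect_cring[OF U_open]] stalk_ring, of x]
  unfolding \<sigma>_def frac_germ_def pre_primes least_prime_def by simp

lemma zero_in_prime: "primeideal p A \<Longrightarrow> \<zero>\<^bsub>A\<^esub> \<in> p"
  using additive_subgroup.zero_closed ideal.axioms(1) primeideal.axioms(1) by blast

lemma \<sigma>_zero_imp_mem:
  assumes x: "x \<in> U" and a: "a \<in> carrier A" "\<sigma> x a = \<zero>\<^bsub>stalk \<S> x\<^esub>" and p: "primeideal p A" "p \<subseteq> f x"
  shows "a \<in> p"
proof -
  obtain u where u: "u \<in> carrier A" "u \<notin> f x" "u \<otimes>\<^bsub>A\<^esub> a = \<zero>\<^bsub>A\<^esub>"
    using \<sigma>_zeroD[OF x a(1)] a(2) \<sigma>_zero[OF x] by auto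
  then show ?thesis using primeideal.I_prime[OF p(1) u(1) a(1)] zero_in_prime[OF p(1)] p(2) by auto
qed

text \<open>A prime p is \<open>f x\<close> for some x, and an element whose image in the stalk at x
  vanishes is killed by some u outside p, so it lies in p.\<close>

lemma least_prime_least: "primeideal p A \<Longrightarrow> least_prime \<subseteq> p"
  using prime_point[of p] \<sigma>_zero_imp_mem[of _ _ p] \<sigma>_least_prime by (auto simp: least_prime_def)

text \<open>By irreducibility W meets the chart; a basic open set around a point of the intersection
  and inside it contains the least prime.\<close>

lemma nonempty_open_in_chart:
  assumes "opn W" "W \<noteq> {}" "x \<in> U" "f x = least_prime"
  shows "x \<in> W"
proof -
  have o: "opn (W \<inter> U)" "W \<inter> U \<subseteq> U" using assms U_open by auto
  obtain y where y: "y \<in> W" "y \<in> U" using irreducible[OF assms(1,2) U_open U_nonempty] by blast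
  then have "f y \<in> f ` (W \<inter> U)" by blast
  then obtain a where a: "a \<notin> f y" "a \<in> carrier A" "{q. primeideal q A \<and> a \<notin> q} \<subseteq> f ` (W \<inter> U)"
    using openin_spec_basis[OF image_open[OF o]] by metis
  have "a \<notin> least_prime" using least_prime_least[OF f_prime[OF y(2)]] a(1) by blast
  then have "f x \<in> f ` (W \<inter> U)" using a(3) least_prime assms(4) by auto
  then show ?thesis using pre_image[OF o(2)] assms(3) mem_pre by blast
qed

lemma f_injD: "\<lbrakk>x \<in> U; y \<in> U; f x = f y\<rbrakk> \<Longrightarrow> x = y"
  using f_bij by (auto simp: bij_betw_def dest: inj_onD)

text \<open>Both points lie in U, and an element of one prime but not of the other would give a
  nonempty basic open set missing one of them.\<close>

lemma generic_unique:
  assumes "\<And>W. \<lbrakk>opn W; W \<noteq> {}\<rbrakk> \<Longrightarrow> x \<in> W" "\<And>W. \<lbrakk>opn W; W \<noteq> {}\<rbrakk> \<Longrightarrow> y \<in> W"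
  shows "x = y"
proof -
  have sub: "f x \<subseteq> f y" if xy: "\<And>W. \<lbrakk>opn W; W \<noteq> {}\<rbrakk> \<Longrightarrow> x \<in> W" "y \<in> U" for x y
  proof
    fix a assume a: "a \<in> f x"
    have xU: "x \<in> U" using xy U_open U_nonempty by blast
    have aA: "a \<in> carrier A" using a prime_proper(1)[OF f_prime[OF xU]] by blast
    show "a \<in> f y"
    proof (rule ccontr)
      assume "a \<notin> f y"
      then have "y \<in> pre {p. primeideal p A \<and> a \<notin> p}" using xy(2) f_prime by (simp add: mem_pre)
      then have "x \<in> pre {p. primeideal p A \<and> a \<notin> p}" using xy(1) pre_open[OF openin_basic[OF aA]] by blast
      then show False using a by (simp add: mem_pre)
    qed
  qed
  have "x \<in> U" "y \<in> U" using assms U_open U_nonempty by blast+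
  then show ?thesis using sub[of x y] sub[of y x] assms f_injD by blast
qed

end

section \<open>The generic point and the maps of stalks into the function field\<close>

context normal_noetherian_scheme
begin

lemma chart_of_scheme_exists:
  assumes "x \<in> points \<S>"
  obtains U A f \<phi> where "x \<in> U" "chart_of_scheme \<S> U A f \<phi>"
proof -
  obtain U A f \<phi> where U: "x \<in> U" "affine_chart \<S> U A f \<phi>" "noetherian_ring A"
    using assms by (rule noetherian_chart)
  have "U \<noteq> {}" using U(1) by blast
  with U(3) have "chart_of_scheme_axioms U A" by (rule chart_of_scheme_axioms.intro)
  with normal_noetherian_scheme_axioms U(2) have "chart_of_scheme \<S> U A f \<phi>"
    by (rule chart_of_scheme.intro)
  with U(1) show ?thesis by (rule that)
qed

text \<open>In any chart the point of \<open>least_prime\<close> lies in all nonempty open sets, and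
  by \<open>generic_unique\<close> it is the only such point; this justifies the definite
  description.\<close>

lemma generic_point:
  shows "generic_point \<S> \<in> points \<S>" "\<lbrakk>opn W; W \<noteq> {}\<rbrakk> \<Longrightarrow> generic_point \<S> \<in> W"
proof -
  obtain x where "x \<in> points \<S>" using integral unfolding integral_scheme_def by blast
  then obtain U A f \<phi> where "chart_of_scheme \<S> U A f \<phi>" by (rule chart_of_scheme_exists)
  then interpret chart_of_scheme \<S> U A f \<phi> .
  obtain \<eta> where \<eta>: "\<eta> \<in> U" "f \<eta> = least_prime" using prime_point[OF least_prime] by blast
  have "\<exists>!\<eta>. \<eta> \<in> points \<S> \<and> topo \<S> closure_of {\<eta>} = points \<S>"
    unfolding closure_eq_points_iff
  proof (rule ex1I[of _ \<eta>])
    show 1: "\<eta> \<in> points \<S> \<and> (\<forall>W. opn W \<and> W \<noteq> {} \<longrightarrow> \<eta> \<in> W)"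
      using \<eta> nonempty_open_in_chart[OF _ _ \<eta>] U_points by blast
    show "y = \<eta>" if "y \<in> points \<S> \<and> (\<forall>W. opn W \<and> W \<noteq> {} \<longrightarrow> y \<in> W)" for y
      by (rule generic_unique) (use that 1 in simp_all)
  qed
  from theI'[OF this] have "generic_point \<S> \<in> points \<S> \<and> topo \<S> closure_of {generic_point \<S>} = points \<S>"
    unfolding generic_point_def .
  then show "generic_point \<S> \<in> points \<S>" "\<lbrakk>opn W; W \<noteq> {}\<rbrakk> \<Longrightarrow> generic_point \<S> \<in> W"
    unfolding closure_eq_points_iff by blast+
qed

abbreviation "\<eta> \<equiv> generic_point \<S>"

abbreviation "\<kappa> x \<equiv> cospecialization \<S> x \<eta>"

lemma \<kappa>_hom: "x \<in> points \<S> \<Longrightarrow> \<kappa> x \<in> ring_hom (stalk \<S> x) (function_field \<S>)"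
  unfolding function_field_def by (rule cospecialization_hom) (use generic_point in blast)+

lemma \<kappa>_germ: "\<lbrakk>opn W; x \<in> W; s \<in> carrier (sect \<S> W)\<rbrakk> \<Longrightarrow> \<kappa> x (germ \<S> x W s) = germ \<S> \<eta> W s"
  by (rule cospecialization_germ) (use generic_point in blast)+

end

section \<open>Local rings in the function field\<close>

context chart_of_scheme
begin

lemma \<eta>_U: "\<eta> \<in> U"
  using generic_point(2)[OF U_open U_nonempty] .

text \<open>The open set U contains all generizations of its points, and inside U basic open sets
  translate generization into inclusion of primes.\<close>

lemma generization_chart:
  assumes x: "x \<in> U"
  shows "generization \<S> y x \<longleftrightarrow> y \<in> U \<and> f y \<subseteq> f x"
proof
  assume gen: "generization \<S> y x"
  then have W: "y \<in> W" if "opn W" "x \<in> W" for W using that by (simp add: generization_iff)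
  have yU: "y \<in> U" using W[OF U_open x] .
  have "f y \<subseteq> f x"
  proof
    fix a assume a: "a \<in> f y"
    then have aA: "a \<in> carrier A" using prime_proper(1)[OF f_prime[OF yU]] by blast
    show "a \<in> f x"
    proof (rule ccontr)
      assume "a \<notin> f x"
      then have "x \<in> pre {p. primeideal p A \<and> a \<notin> p}" using x f_prime by (simp add: mem_pre)
      then have "y \<in> pre {p. primeideal p A \<and> a \<notin> p}" using W[OF pre_open[OF openin_basic[OF aA]]] by blast
      then show False using a by (simp add: mem_pre)
    qed
  qed
  then show "y \<in> U \<and> f y \<subseteq> f x" using yU by blast
next
  assume y: "y \<in> U \<and> f y \<subseteq> f x"
  have "y \<in> W" if W: "opn W" "x \<in> W" for W
  proof -
    have o: "opn (W \<inter> U)" "W \<inter> U \<subseteq> U" using W U_open by auto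
    have "f x \<in> f ` (W \<inter> U)" using W x by blast
    then obtain a where a: "a \<notin> f x" "a \<in> carrier A" "{q. primeideal q A \<and> a \<notin> q} \<subseteq> f ` (W \<inter> U)"
      using openin_spec_basis[OF image_open[OF o]] by metis
    then have "f y \<in> f ` (W \<inter> U)" using y f_prime by auto
    then show ?thesis using pre_image[OF o(2)] y mem_pre by blast
  qed
  then show "generization \<S> y x" using x y U_points by (auto simp: generization_iff)
qed

lemma generization_\<eta>: "x \<in> points \<S> \<Longrightarrow> generization \<S> \<eta> x"
  unfolding generization_iff using generic_point by blast

lemma f_\<eta>_subset: "x \<in> U \<Longrightarrow> f \<eta> \<subseteq> f x"
  using generization_\<eta>[of x] generization_chart[of x \<eta>] U_points by blast

lemma f_\<eta>: "f \<eta> = least_prime"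
  using prime_point[OF least_prime] f_\<eta>_subset least_prime_least[OF f_prime[OF \<eta>_U]] by blast

lemma f_\<eta>_least: "primeideal p A \<Longrightarrow> f \<eta> \<subseteq> p"
  unfolding f_\<eta> by (rule least_prime_least)

lemma \<sigma>_zero_iff:
  assumes "x \<in> U" "a \<in> carrier A"
  shows "\<sigma> x a = \<zero>\<^bsub>stalk \<S> x\<^esub> \<longleftrightarrow> a \<in> f \<eta>"
  using \<sigma>_zero_imp_mem[OF assms _ f_prime[OF \<eta>_U] f_\<eta>_subset[OF assms(1)]] \<sigma>_least_prime[OF assms(1)]
  unfolding f_\<eta> by blast

lemma \<kappa>_\<sigma>:
  assumes "x \<in> U" "a \<in> carrier A"
  shows "\<kappa> x (\<sigma> x a) = \<sigma> \<eta> a"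
  unfolding \<sigma>_def frac_germ_def pre_primes
  using \<kappa>_germ[OF U_open assms(1)] ring_hom_closed[OF global_hom assms(2)] by simp

lemma \<sigma>_Unit:
  assumes x: "x \<in> U" and h: "h \<in> carrier A" "h \<notin> f x"
  shows "\<sigma> x h \<in> Units (stalk \<S> x)"
proof -
  interpret D: cring "stalk \<S> x" using stalk_cring U_points x by blast
  obtain t where "t \<in> carrier (stalk \<S> x)" "t \<otimes>\<^bsub>stalk \<S> x\<^esub> \<sigma> x h = \<one>\<^bsub>stalk \<S> x\<^esub>" using \<sigma>_Units[OF x h] by blast
  then show ?thesis using ring_hom_closed[OF \<sigma>_hom[OF x] h(1)] unfolding Units_def by (auto simp: D.m_comm)
qed

text \<open>A nonzero t is a/h with a outside \<open>f \<eta>\<close>, since elements of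
  \<open>f \<eta>\<close> vanish in the stalk; such an a is a unit there.\<close>

lemma field_K: "field (function_field \<S>)"
proof -
  interpret K: cring "function_field \<S>" unfolding function_field_def by (rule stalk_cring[OF generic_point(1)])
  show ?thesis
  proof (rule K.cring_fieldI2)
    have "\<one>\<^bsub>A\<^esub> \<notin> f \<eta>" using primes_nonunit f_prime[OF \<eta>_U] by blast
    then show "\<zero>\<^bsub>function_field \<S>\<^esub> \<noteq> \<one>\<^bsub>function_field \<S>\<^esub>"
      using \<sigma>_zero_iff[OF \<eta>_U A.one_closed] ring_hom_one[OF \<sigma>_hom[OF \<eta>_U]] unfolding function_field_def by auto
    fix t assume t: "t \<in> carrier (function_field \<S>)" "t \<noteq> \<zero>\<^bsub>function_field \<S>\<^esub>"
    obtain a h where a: "a \<in> carrier A" "h \<in> carrier A" "h \<notin> f \<eta>"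
      "t \<otimes>\<^bsub>function_field \<S>\<^esub> \<sigma> \<eta> h = \<sigma> \<eta> a"
      using stalk_frac[OF \<eta>_U, of t] t(1) unfolding function_field_def by blast
    have hU: "\<sigma> \<eta> h \<in> Units (function_field \<S>)" using \<sigma>_Unit[OF \<eta>_U a(2,3)] by (simp add: function_field_def)
    have "\<sigma> \<eta> a \<noteq> \<zero>\<^bsub>function_field \<S>\<^esub>"
    proof
      assume "\<sigma> \<eta> a = \<zero>\<^bsub>function_field \<S>\<^esub>"
      then have "t \<otimes>\<^bsub>function_field \<S>\<^esub> \<sigma> \<eta> h = \<zero>\<^bsub>function_field \<S>\<^esub> \<otimes>\<^bsub>function_field \<S>\<^esub> \<sigma> \<eta> h"
        using a(4) hU by (simp add: K.Units_closed)
      then have "t \<otimes>\<^bsub>function_field \<S>\<^esub> \<sigma> \<eta> h \<otimes>\<^bsub>function_field \<S>\<^esub> inv\<^bsub>function_field \<S>\<^esub> \<sigma> \<eta> h = \<zero>\<^bsub>function_field \<S>\<^esub>"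
        using hU by (simp add: K.Units_closed)
      then show False using t hU by (simp add: K.m_assoc K.Units_closed)
    qed
    then have "a \<notin> f \<eta>" using \<sigma>_zero_iff[OF \<eta>_U a(1)] by (simp add: function_field_def)
    then have aU: "\<sigma> \<eta> a \<in> Units (function_field \<S>)" using \<sigma>_Unit[OF \<eta>_U a(1)] by (simp add: function_field_def)
    have "t \<otimes>\<^bsub>function_field \<S>\<^esub> (\<sigma> \<eta> h \<otimes>\<^bsub>function_field \<S>\<^esub> inv\<^bsub>function_field \<S>\<^esub> \<sigma> \<eta> a) = \<one>\<^bsub>function_field \<S>\<^esub>"
      using a(4) t hU aU by (simp add: K.m_assoc[symmetric] K.Units_closed)
    then show "\<exists>b\<in>carrier (function_field \<S>). t \<otimes>\<^bsub>function_field \<S>\<^esub> b = \<one>\<^bsub>function_field \<S>\<^esub>"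
      using hU aU by blast
  qed
qed

text \<open>Here j is \<open>\<sigma> \<eta>\<close>: its kernel is \<open>f \<eta>\<close>, the
  least prime, and hence contained in every prime.\<close>

sublocale K: noetherian_frac A "function_field \<S>" "\<sigma> \<eta>"
proof (intro noetherian_frac.intro noetherian_frac_axioms.intro field_K noetherian_A A_cring)
  show "\<sigma> \<eta> \<in> ring_hom A (function_field \<S>)" using \<sigma>_hom[OF \<eta>_U] by (simp add: function_field_def)
  show "a \<in> p" if "primeideal p A" "a \<in> carrier A" "\<sigma> \<eta> a = \<zero>\<^bsub>function_field \<S>\<^esub>" for p a
    using \<sigma>_zero_iff[OF \<eta>_U that(2)] that(3) f_\<eta>_least[OF that(1)] unfolding function_field_def by blast
  show "\<exists>a\<in>carrier A. \<exists>s\<in>carrier A. \<sigma> \<eta> s \<noteq> \<zero>\<^bsub>function_field \<S>\<^esub> \<and> z \<otimes>\<^bsub>function_field \<S>\<^esub> \<sigma> \<eta> s = \<sigma> \<eta> a"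
    if "z \<in> carrier (function_field \<S>)" for z
    using stalk_frac[OF \<eta>_U, of z] \<sigma>_zero_iff[OF \<eta>_U] that unfolding function_field_def by blast
qed

lemma \<sigma>_\<eta>_zero_iff: "a \<in> carrier A \<Longrightarrow> \<sigma> \<eta> a = \<zero>\<^bsub>function_field \<S>\<^esub> \<longleftrightarrow> a \<in> f \<eta>"
  using \<sigma>_zero_iff[OF \<eta>_U] by (simp add: function_field_def)

lemma \<kappa>_frac:
  assumes x: "x \<in> U" and t: "t \<in> carrier (stalk \<S> x)"
  obtains a h where "a \<in> carrier A" "h \<in> carrier A" "h \<notin> f x"
    "t \<otimes>\<^bsub>stalk \<S> x\<^esub> \<sigma> x h = \<sigma> x a" "\<kappa> x t \<otimes>\<^bsub>function_field \<S>\<^esub> \<sigma> \<eta> h = \<sigma> \<eta> a"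
proof -
  obtain a h where a: "a \<in> carrier A" "h \<in> carrier A" "h \<notin> f x" "t \<otimes>\<^bsub>stalk \<S> x\<^esub> \<sigma> x h = \<sigma> x a"
    using stalk_frac[OF x t] by blast
  have xp: "x \<in> points \<S>" using x U_points by blast
  have "\<kappa> x t \<otimes>\<^bsub>function_field \<S>\<^esub> \<sigma> \<eta> h = \<kappa> x (t \<otimes>\<^bsub>stalk \<S> x\<^esub> \<sigma> x h)"
    using ring_hom_mult[OF \<kappa>_hom[OF xp] t ring_hom_closed[OF \<sigma>_hom[OF x] a(2)]] \<kappa>_\<sigma>[OF x a(2)] by simp
  then show ?thesis using that a \<kappa>_\<sigma>[OF x a(1)] by simp
qed

text \<open>The maps \<sigma> at x and at \<eta> have the same kernel \<open>f \<eta>\<close>, so a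
  numerator that vanishes at \<eta> already vanishes at x.\<close>

lemma \<kappa>_zero:
  assumes x: "x \<in> U" and t: "t \<in> carrier (stalk \<S> x)" "\<kappa> x t = \<zero>\<^bsub>function_field \<S>\<^esub>"
  shows "t = \<zero>\<^bsub>stalk \<S> x\<^esub>"
proof -
  interpret D: cring "stalk \<S> x" using stalk_cring U_points x by blast
  obtain a h where a: "a \<in> carrier A" "h \<in> carrier A" "h \<notin> f x"
    "t \<otimes>\<^bsub>stalk \<S> x\<^esub> \<sigma> x h = \<sigma> x a" "\<kappa> x t \<otimes>\<^bsub>function_field \<S>\<^esub> \<sigma> \<eta> h = \<sigma> \<eta> a"
    using \<kappa>_frac[OF x t(1)] .
  have "\<sigma> \<eta> a = \<zero>\<^bsub>function_field \<S>\<^esub>" using a(5) t(2) K.j_simps(1)[OF a(2)] by simp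
  then have "\<sigma> x a = \<zero>\<^bsub>stalk \<S> x\<^esub>" using \<sigma>_zero_iff[OF x a(1)] \<sigma>_\<eta>_zero_iff[OF a(1)] by simp
  then have "t \<otimes>\<^bsub>stalk \<S> x\<^esub> \<sigma> x h \<otimes>\<^bsub>stalk \<S> x\<^esub> inv\<^bsub>stalk \<S> x\<^esub> \<sigma> x h = \<zero>\<^bsub>stalk \<S> x\<^esub>"
    using a(4) \<sigma>_Unit[OF x a(2,3)] by simp
  then show ?thesis using \<sigma>_Unit[OF x a(2,3)] t(1) by (simp add: D.m_assoc D.Units_closed)
qed

text \<open>Both sides consist of the quotients of \<open>\<sigma> \<eta> a\<close> by
  \<open>\<sigma> \<eta> h\<close> with h outside \<open>f x\<close>: germs at x are such fractions,
  and conversely h is a unit in the stalk, so the quotient can be formed there.\<close>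

lemma local_ring_eq_loc:
  assumes x: "x \<in> U"
  shows "local_ring \<S> x = K.loc (f x)"
  unfolding local_ring_def
proof (intro equalityI subsetI)
  have xp: "x \<in> points \<S>" using x U_points by blast
  fix z assume "z \<in> \<kappa> x ` carrier (stalk \<S> x)"
  then obtain t where t: "t \<in> carrier (stalk \<S> x)" "z = \<kappa> x t" by blast
  obtain a h where "a \<in> carrier A" "h \<in> carrier A" "h \<notin> f x" "\<kappa> x t \<otimes>\<^bsub>function_field \<S>\<^esub> \<sigma> \<eta> h = \<sigma> \<eta> a"
    using \<kappa>_frac[OF x t(1)] .
  then show "z \<in> K.loc (f x)" unfolding t(2) using ring_hom_closed[OF \<kappa>_hom[OF xp] t(1)] by (intro K.locI)
next
  have xp: "x \<in> points \<S>" using x U_points by blast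
  interpret D: cring "stalk \<S> x" using stalk_cring xp .
  fix z assume "z \<in> K.loc (f x)"
  then obtain a h where a: "z \<in> carrier (function_field \<S>)" "a \<in> carrier A" "h \<in> carrier A" "h \<notin> f x"
    "z \<otimes>\<^bsub>function_field \<S>\<^esub> \<sigma> \<eta> h = \<sigma> \<eta> a" by (rule K.locE)
  have u: "\<sigma> x h \<in> Units (stalk \<S> x)" using \<sigma>_Unit[OF x a(3,4)] .
  have ac: "\<sigma> x a \<in> carrier (stalk \<S> x)" using ring_hom_closed[OF \<sigma>_hom[OF x] a(2)] .
  let ?t = "\<sigma> x a \<otimes>\<^bsub>stalk \<S> x\<^esub> inv\<^bsub>stalk \<S> x\<^esub> \<sigma> x h"
  have t: "?t \<in> carrier (stalk \<S> x)" using ac u by simp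
  have "?t \<otimes>\<^bsub>stalk \<S> x\<^esub> \<sigma> x h = \<sigma> x a" using ac u by (simp add: D.m_assoc D.Units_closed)
  then have "\<kappa> x ?t \<otimes>\<^bsub>function_field \<S>\<^esub> \<sigma> \<eta> h = \<sigma> \<eta> a"
    using ring_hom_mult[OF \<kappa>_hom[OF xp] t D.Units_closed[OF u]] \<kappa>_\<sigma>[OF x a(3)] \<kappa>_\<sigma>[OF x a(2)] by simp
  then have "\<kappa> x ?t \<otimes>\<^bsub>function_field \<S>\<^esub> \<sigma> \<eta> h = z \<otimes>\<^bsub>function_field \<S>\<^esub> \<sigma> \<eta> h" using a(5) by simp
  moreover have "\<sigma> \<eta> h \<in> Units (function_field \<S>)" using K.j_Units[OF f_prime[OF x] a(3,4)] .
  ultimately have "\<kappa> x ?t = z"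
    using K.m_rcancel[of "\<sigma> \<eta> h" "\<kappa> x ?t" z] ring_hom_closed[OF \<kappa>_hom[OF xp] t] a(1) by (simp add: K.Units_iff_nonzero)
  then show "z \<in> \<kappa> x ` carrier (stalk \<S> x)" using t by blast
qed

text \<open>A relation over \<open>K.loc p\<close> has its coefficients in the image of the stalk at
  the point of p. As \<kappa> is injective there and the function field consists of quotients of
  that image, integral closedness of the stalk transfers.\<close>

sublocale K: normal_noetherian_frac A "function_field \<S>" "\<sigma> \<eta>"
proof unfold_locales
  fix p z assume p: "primeideal p A" and z: "z \<in> carrier (function_field \<S>)" and int: "K.integral_over (K.loc p) z"
  obtain x where x: "x \<in> U" "f x = p" using prime_point[OF p] by blast
  have xp: "x \<in> points \<S>" using x U_points by blast
  have loc: "\<kappa> x ` carrier (stalk \<S> x) = K.loc p" using local_ring_eq_loc[OF x(1)] x(2) by (simp add: local_ring_def)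
  obtain n :: nat and c where c: "\<forall>i<n. c i \<in> K.loc p"
    "(z [^]\<^bsub>function_field \<S>\<^esub> n) \<oplus>\<^bsub>function_field \<S>\<^esub>
      (\<Oplus>\<^bsub>function_field \<S>\<^esub>i\<in>{..<n}. c i \<otimes>\<^bsub>function_field \<S>\<^esub> (z [^]\<^bsub>function_field \<S>\<^esub> i)) = \<zero>\<^bsub>function_field \<S>\<^esub>"
    using int unfolding K.integral_over_def by blast
  have "z \<in> \<kappa> x ` carrier (stalk \<S> x)"
  proof (rule integrally_closed_transfer[OF stalk_normal[OF xp] field_K \<kappa>_hom[OF xp] _ _ z _ c(2)])
    show "a = \<zero>\<^bsub>stalk \<S> x\<^esub>" if "a \<in> carrier (stalk \<S> x)" "\<kappa> x a = \<zero>\<^bsub>function_field \<S>\<^esub>" for a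
      using \<kappa>_zero x that by blast
    show "c i \<in> \<kappa> x ` carrier (stalk \<S> x)" if "i < n" for i using c(1) that loc by simp
    show "\<exists>a\<in>carrier (stalk \<S> x). \<exists>s\<in>carrier (stalk \<S> x). \<kappa> x s \<noteq> \<zero>\<^bsub>function_field \<S>\<^esub>
        \<and> y \<otimes>\<^bsub>function_field \<S>\<^esub> \<kappa> x s = \<kappa> x a" if y: "y \<in> carrier (function_field \<S>)" for y
    proof -
      obtain a s where "a \<in> carrier A" "s \<in> carrier A" "\<sigma> \<eta> s \<noteq> \<zero>\<^bsub>function_field \<S>\<^esub>"
        "y \<otimes>\<^bsub>function_field \<S>\<^esub> \<sigma> \<eta> s = \<sigma> \<eta> a" using K.frac[OF y] by blast
      then show ?thesis using ring_hom_closed[OF \<sigma>_hom[OF x(1)]] \<kappa>_\<sigma>[OF x(1)]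
        by (intro bexI[of _ "\<sigma> x a"] bexI[of _ "\<sigma> x s"]) auto
    qed
  qed
  then show "z \<in> K.loc p" unfolding loc .
qed

end

section \<open>Primes of a stalk compared with primes of the chart\<close>

context chart_of_scheme
begin

text \<open>An element of A outside \<open>f x\<close> becomes a unit in the stalk and so cannot map
  into a prime Q.\<close>

lemma contraction:
  assumes x: "x \<in> U" and Q: "primeideal Q (stalk \<S> x)"
  shows "primeideal {a \<in> carrier A. \<sigma> x a \<in> Q} A" "{a \<in> carrier A. \<sigma> x a \<in> Q} \<subseteq> f x"
proof -
  interpret D: cring "stalk \<S> x" using stalk_cring U_points x by blast
  interpret Q: primeideal Q "stalk \<S> x" by (rule Q)
  interpret h: ring_hom_ring A "stalk \<S> x" "\<sigma> x" using \<sigma>_hom[OF x] by unfold_locales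
  show "primeideal {a \<in> carrier A. \<sigma> x a \<in> Q} A" using h.primeideal_vimage[OF A_cring Q] .
  show "{a \<in> carrier A. \<sigma> x a \<in> Q} \<subseteq> f x"
  proof
    fix a assume a: "a \<in> {a \<in> carrier A. \<sigma> x a \<in> Q}"
    show "a \<in> f x"
    proof (rule ccontr)
      assume "a \<notin> f x"
      then have u: "\<sigma> x a \<in> Units (stalk \<S> x)" using \<sigma>_Unit[OF x] a by blast
      then have "inv\<^bsub>stalk \<S> x\<^esub> \<sigma> x a \<otimes>\<^bsub>stalk \<S> x\<^esub> \<sigma> x a \<in> Q" using a by (intro Q.I_l_closed) auto
      then have "\<one>\<^bsub>stalk \<S> x\<^esub> \<in> Q" using u by simp
      then show False using Q.one_imp_carrier Q.I_notcarr by blast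
    qed
  qed
qed

text \<open>The numerator of an element of Q' outside Q separates the contractions: its denominator
  is outside \<open>f x\<close>, hence not mapped into Q.\<close>

lemma contraction_strict_mono:
  assumes x: "x \<in> U" and Q: "primeideal Q (stalk \<S> x)" and Q': "primeideal Q' (stalk \<S> x)" and sub: "Q \<subset> Q'"
  shows "{a \<in> carrier A. \<sigma> x a \<in> Q} \<subset> {a \<in> carrier A. \<sigma> x a \<in> Q'}"
proof -
  interpret Q: primeideal Q "stalk \<S> x" by (rule Q)
  interpret Q': primeideal Q' "stalk \<S> x" by (rule Q')
  obtain t where t: "t \<in> Q'" "t \<notin> Q" using sub by blast
  have tD: "t \<in> carrier (stalk \<S> x)" using t Q'.Icarr by blast
  obtain a h where a: "a \<in> carrier A" "h \<in> carrier A" "h \<notin> f x" "t \<otimes>\<^bsub>stalk \<S> x\<^esub> \<sigma> x h = \<sigma> x a"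
    using \<kappa>_frac[OF x tD] .
  have hD: "\<sigma> x h \<in> carrier (stalk \<S> x)" using ring_hom_closed[OF \<sigma>_hom[OF x] a(2)] .
  have "\<sigma> x a \<in> Q'" using Q'.I_r_closed[OF t(1) hD] a(4) by simp
  moreover have "\<sigma> x a \<notin> Q"
  proof
    assume "\<sigma> x a \<in> Q"
    then have "\<sigma> x h \<in> Q" using Q.I_prime[OF tD hD] a(4) t(2) by auto
    then show False using contraction(2)[OF x Q] a(2,3) by blast
  qed
  ultimately show ?thesis using sub a(1) by blast
qed

text \<open>The ideal generated by r in the stalk, described by numerators. For primes inside
  \<open>f x\<close> any presentation of t decides membership
  (\<open>mem_extension_iff\<close>).\<close>

definition extension :: "'p \<Rightarrow> 'r set \<Rightarrow> ('p set \<times> 'r) set set" where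
  "extension x r = {t \<in> carrier (stalk \<S> x). \<exists>a\<in>r. \<exists>s\<in>carrier A - f x. t \<otimes>\<^bsub>stalk \<S> x\<^esub> \<sigma> x s = \<sigma> x a}"

lemma \<sigma>_eq_imp_mem:
  assumes x: "x \<in> U" and r: "primeideal r A" and a: "a \<in> r" and b: "b \<in> carrier A" and eq: "\<sigma> x a = \<sigma> x b"
  shows "b \<in> r"
proof -
  have aA: "a \<in> carrier A" using a prime_proper(1)[OF r] by blast
  have "\<sigma> \<eta> a = \<sigma> \<eta> b" using \<kappa>_\<sigma>[OF x aA] \<kappa>_\<sigma>[OF x b] eq by simp
  then show ?thesis using K.prime_diff[OF r aA b] a by blast
qed

lemma mem_extension_iff:
  assumes x: "x \<in> U" and r: "primeideal r A" "r \<subseteq> f x" and t: "t \<in> carrier (stalk \<S> x)"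
    and a: "a \<in> carrier A" and h: "h \<in> carrier A" "h \<notin> f x" and eq: "t \<otimes>\<^bsub>stalk \<S> x\<^esub> \<sigma> x h = \<sigma> x a"
  shows "t \<in> extension x r \<longleftrightarrow> a \<in> r"
proof
  interpret D: cring "stalk \<S> x" using stalk_cring U_points x by blast
  note hs = ring_hom_closed[OF \<sigma>_hom[OF x]] ring_hom_mult[OF \<sigma>_hom[OF x]]
  assume "t \<in> extension x r"
  then obtain b s where b: "b \<in> r" "s \<in> carrier A" "s \<notin> f x" "t \<otimes>\<^bsub>stalk \<S> x\<^esub> \<sigma> x s = \<sigma> x b"
    by (auto simp: extension_def)
  have bA: "b \<in> carrier A" using b prime_proper(1)[OF r(1)] by blast
  have "\<sigma> x (b \<otimes>\<^bsub>A\<^esub> h) = t \<otimes>\<^bsub>stalk \<S> x\<^esub> \<sigma> x s \<otimes>\<^bsub>stalk \<S> x\<^esub> \<sigma> x h" using hs bA h b(4) by simp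
  also have "\<dots> = t \<otimes>\<^bsub>stalk \<S> x\<^esub> \<sigma> x h \<otimes>\<^bsub>stalk \<S> x\<^esub> \<sigma> x s"
    using t hs(1)[OF h(1)] hs(1)[OF b(2)] by (simp only: D.m_ac D.m_closed)
  also have "\<dots> = \<sigma> x (a \<otimes>\<^bsub>A\<^esub> s)" using hs a b(2) eq by simp
  finally have "\<sigma> x (b \<otimes>\<^bsub>A\<^esub> h) = \<sigma> x (a \<otimes>\<^bsub>A\<^esub> s)" .
  moreover have "b \<otimes>\<^bsub>A\<^esub> h \<in> r" using ideal.I_r_closed[OF primeideal.axioms(1)[OF r(1)] b(1) h(1)] .
  ultimately have "a \<otimes>\<^bsub>A\<^esub> s \<in> r" using \<sigma>_eq_imp_mem[OF x r(1)] a b(2) by simp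
  then show "a \<in> r" using primeideal.I_prime[OF r(1) a b(2)] b(3) r(2) by blast
next
  assume "a \<in> r"
  then show "t \<in> extension x r" unfolding extension_def using t h eq by blast
qed

text \<open>Membership is a condition on numerators, so sums, products and primality are inherited
  from r.\<close>

lemma extension_prime:
  assumes x: "x \<in> U" and r: "primeideal r A" "r \<subseteq> f x"
  shows "primeideal (extension x r) (stalk \<S> x)"
proof -
  interpret D: cring "stalk \<S> x" using stalk_cring U_points x by blast
  interpret r: primeideal r A by (rule r(1))
  note hs = ring_hom_closed[OF \<sigma>_hom[OF x]] ring_hom_mult[OF \<sigma>_hom[OF x]] ring_hom_add[OF \<sigma>_hom[OF x]]
    ring_hom_one[OF \<sigma>_hom[OF x]]
  have compl: "h \<otimes>\<^bsub>A\<^esub> k \<in> carrier A" "h \<otimes>\<^bsub>A\<^esub> k \<notin> f x"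
    if "h \<in> carrier A" "h \<notin> f x" "k \<in> carrier A" "k \<notin> f x" for h k
    using mult_subset.S_mult[OF mult_subset_prime[OF f_prime[OF x]], of h k] that by auto
  have ms: "t \<otimes>\<^bsub>stalk \<S> x\<^esub> t' \<in> extension x r \<longleftrightarrow> t \<in> extension x r \<or> t' \<in> extension x r"
    if t: "t \<in> carrier (stalk \<S> x)" and t': "t' \<in> carrier (stalk \<S> x)" for t t'
  proof -
    obtain a h where a: "a \<in> carrier A" "h \<in> carrier A" "h \<notin> f x" "t \<otimes>\<^bsub>stalk \<S> x\<^esub> \<sigma> x h = \<sigma> x a" using \<kappa>_frac[OF x t] .
    obtain b k where b: "b \<in> carrier A" "k \<in> carrier A" "k \<notin> f x" "t' \<otimes>\<^bsub>stalk \<S> x\<^esub> \<sigma> x k = \<sigma> x b" using \<kappa>_frac[OF x t'] .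
    note c = t t' hs(1)[OF a(2)] hs(1)[OF b(2)]
    have "(t \<otimes>\<^bsub>stalk \<S> x\<^esub> t') \<otimes>\<^bsub>stalk \<S> x\<^esub> \<sigma> x (h \<otimes>\<^bsub>A\<^esub> k) = (t \<otimes>\<^bsub>stalk \<S> x\<^esub> \<sigma> x h) \<otimes>\<^bsub>stalk \<S> x\<^esub> (t' \<otimes>\<^bsub>stalk \<S> x\<^esub> \<sigma> x k)"
      unfolding hs(2)[OF a(2) b(2)] using c by (simp only: D.m_ac D.m_closed)
    also have "\<dots> = \<sigma> x (a \<otimes>\<^bsub>A\<^esub> b)" using a b hs by simp
    finally have "t \<otimes>\<^bsub>stalk \<S> x\<^esub> t' \<in> extension x r \<longleftrightarrow> a \<otimes>\<^bsub>A\<^esub> b \<in> r"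
      using mem_extension_iff[OF x r D.m_closed[OF t t'] A.m_closed[OF a(1) b(1)] compl[OF a(2,3) b(2,3)]] by blast
    also have "\<dots> \<longleftrightarrow> a \<in> r \<or> b \<in> r" using r.I_prime r.I_l_closed r.I_r_closed a(1) b(1) by blast
    also have "\<dots> \<longleftrightarrow> t \<in> extension x r \<or> t' \<in> extension x r"
      using mem_extension_iff[OF x r t a] mem_extension_iff[OF x r t' b] by simp
    finally show ?thesis .
  qed
  have ideal: "ideal (extension x r) (stalk \<S> x)"
  proof (rule D.cring_idealI)
    show "extension x r \<subseteq> carrier (stalk \<S> x)" by (auto simp: extension_def)
    have "\<zero>\<^bsub>stalk \<S> x\<^esub> \<otimes>\<^bsub>stalk \<S> x\<^esub> \<sigma> x \<one>\<^bsub>A\<^esub> = \<sigma> x \<zero>\<^bsub>A\<^esub>" using hs(4) \<sigma>_zero[OF x] by simp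
    then have "\<zero>\<^bsub>stalk \<S> x\<^esub> \<in> extension x r"
      using mem_extension_iff[OF x r D.zero_closed A.zero_closed A.one_closed] primes_nonunit f_prime[OF x] zero_in_prime[OF r(1)] by blast
    then show "extension x r \<noteq> {}" by blast
    show "t \<otimes>\<^bsub>stalk \<S> x\<^esub> t' \<in> extension x r" if "t \<in> carrier (stalk \<S> x)" "t' \<in> extension x r" for t t'
      using ms[of t t'] that by (auto simp: extension_def)
    show "t \<oplus>\<^bsub>stalk \<S> x\<^esub> t' \<in> extension x r" if tt: "t \<in> extension x r" "t' \<in> extension x r" for t t'
    proof -
      have t: "t \<in> carrier (stalk \<S> x)" "t' \<in> carrier (stalk \<S> x)" using tt by (auto simp: extension_def)
      obtain a h where a: "a \<in> carrier A" "h \<in> carrier A" "h \<notin> f x" "t \<otimes>\<^bsub>stalk \<S> x\<^esub> \<sigma> x h = \<sigma> x a" using \<kappa>_frac[OF x t(1)] .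
      obtain b k where b: "b \<in> carrier A" "k \<in> carrier A" "k \<notin> f x" "t' \<otimes>\<^bsub>stalk \<S> x\<^esub> \<sigma> x k = \<sigma> x b" using \<kappa>_frac[OF x t(2)] .
      note c = t hs(1)[OF a(2)] hs(1)[OF b(2)]
      have ab: "a \<in> r" "b \<in> r" using mem_extension_iff[OF x r t(1) a] mem_extension_iff[OF x r t(2) b] tt by auto
      have "(t \<oplus>\<^bsub>stalk \<S> x\<^esub> t') \<otimes>\<^bsub>stalk \<S> x\<^esub> \<sigma> x (h \<otimes>\<^bsub>A\<^esub> k)
          = (t \<otimes>\<^bsub>stalk \<S> x\<^esub> \<sigma> x h) \<otimes>\<^bsub>stalk \<S> x\<^esub> \<sigma> x k \<oplus>\<^bsub>stalk \<S> x\<^esub> (t' \<otimes>\<^bsub>stalk \<S> x\<^esub> \<sigma> x k) \<otimes>\<^bsub>stalk \<S> x\<^esub> \<sigma> x h"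
        unfolding hs(2)[OF a(2) b(2)] using c by (simp only: D.m_ac D.m_closed D.l_distr D.r_distr D.a_closed)
      also have "\<dots> = \<sigma> x ((a \<otimes>\<^bsub>A\<^esub> k) \<oplus>\<^bsub>A\<^esub> (b \<otimes>\<^bsub>A\<^esub> h))" using a b hs by simp
      finally show ?thesis
        using mem_extension_iff[OF x r D.a_closed[OF t] _ compl[OF a(2,3) b(2,3)]] ab r.I_r_closed[OF ab(1) b(2)]
          r.I_r_closed[OF ab(2) a(2)] r.a_closed a b by (metis A.a_closed A.m_closed)
    qed
  qed
  show ?thesis
  proof (rule primeidealI[OF ideal D.is_cring])
    have "\<one>\<^bsub>stalk \<S> x\<^esub> \<otimes>\<^bsub>stalk \<S> x\<^esub> \<sigma> x \<one>\<^bsub>A\<^esub> = \<sigma> x \<one>\<^bsub>A\<^esub>" using hs(4) by simp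
    then have "\<one>\<^bsub>stalk \<S> x\<^esub> \<notin> extension x r"
      using mem_extension_iff[OF x r D.one_closed A.one_closed A.one_closed] primes_nonunit f_prime[OF x] r(1) by blast
    then show "carrier (stalk \<S> x) \<noteq> extension x r" by blast
    show "t \<in> extension x r \<or> t' \<in> extension x r"
      if "t \<in> carrier (stalk \<S> x)" "t' \<in> carrier (stalk \<S> x)" "t \<otimes>\<^bsub>stalk \<S> x\<^esub> t' \<in> extension x r" for t t'
      using ms that by blast
  qed
qed

lemma extension_strict_mono:
  assumes x: "x \<in> U" and r: "primeideal r A" and r': "primeideal r' A" "r' \<subseteq> f x" and sub: "r \<subset> r'"
  shows "extension x r \<subset> extension x r'"
proof -
  interpret D: cring "stalk \<S> x" using stalk_cring U_points x by blast
  obtain b where b: "b \<in> r'" "b \<notin> r" using sub by blast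
  have bA: "b \<in> carrier A" using b prime_proper(1)[OF r'(1)] by blast
  have bD: "\<sigma> x b \<in> carrier (stalk \<S> x)" using ring_hom_closed[OF \<sigma>_hom[OF x] bA] .
  have one: "\<one>\<^bsub>A\<^esub> \<notin> f x" using primes_nonunit f_prime[OF x] by blast
  have "\<sigma> x b \<otimes>\<^bsub>stalk \<S> x\<^esub> \<sigma> x \<one>\<^bsub>A\<^esub> = \<sigma> x b" using bD ring_hom_one[OF \<sigma>_hom[OF x]] by simp
  then have "\<sigma> x b \<in> extension x r'" "\<sigma> x b \<notin> extension x r"
    using mem_extension_iff[OF x r' bD bA A.one_closed one] mem_extension_iff[OF x r _ bD bA A.one_closed one] b sub r' by auto
  moreover have "extension x r \<subseteq> extension x r'" using sub by (auto simp: extension_def)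
  ultimately show ?thesis by blast
qed

text \<open>Contraction and extension both preserve strict inclusions, so the chain lengths in the
  stalk are those of chains in A ending inside \<open>f x\<close>. As \<open>f \<eta>\<close> is the
  least prime, the condition on chains becomes that of \<open>height_one\<close>.\<close>

lemma codim_one_iff:
  assumes x: "x \<in> U"
  shows "x \<in> codim_one_points \<S> \<longleftrightarrow> K.height_one (f x)"
proof -
  have fx: "primeideal (f x) A" using f_prime[OF x] .
  have f\<eta>: "primeideal (f \<eta>) A" using f_prime[OF \<eta>_U] .
  have j0: "(\<forall>a\<in>r. \<sigma> \<eta> a = \<zero>\<^bsub>function_field \<S>\<^esub>) \<longleftrightarrow> r = f \<eta>" if "primeideal r A" for r
    using \<sigma>_\<eta>_zero_iff prime_proper(1)[OF that] f_\<eta>_least[OF that] by blast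
  let ?c = "\<lambda>Q. {a \<in> carrier A. \<sigma> x a \<in> Q}"
  have "x \<in> codim_one_points \<S> \<longleftrightarrow> krull_dim (stalk \<S> x) = 1"
    using x U_points by (auto simp: codim_one_points_def)
  also have "\<dots> \<longleftrightarrow> (\<exists>p q. primeideal p A \<and> primeideal q A \<and> q \<subseteq> f x \<and> p \<subset> q) \<and>
     \<not> (\<exists>p q r. primeideal p A \<and> primeideal q A \<and> primeideal r A \<and> r \<subseteq> f x \<and> p \<subset> q \<and> q \<subset> r)"
  proof -
    have 1: "(\<exists>p q. primeideal p (stalk \<S> x) \<and> primeideal q (stalk \<S> x) \<and> p \<subset> q)
      \<longleftrightarrow> (\<exists>p q. primeideal p A \<and> primeideal q A \<and> q \<subseteq> f x \<and> p \<subset> q)" (is "?l \<longleftrightarrow> ?r")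
    proof
      assume ?l
      then obtain p q where "primeideal p (stalk \<S> x)" "primeideal q (stalk \<S> x)" "p \<subset> q" by blast
      then show ?r using contraction[OF x] contraction_strict_mono[OF x]
        by (intro exI[of _ "?c p"] exI[of _ "?c q"]) simp
    next
      assume ?r
      then obtain p q where "primeideal p A" "primeideal q A" "q \<subseteq> f x" "p \<subset> q" by blast
      then show ?l using extension_prime[OF x] extension_strict_mono[OF x]
        by (intro exI[of _ "extension x p"] exI[of _ "extension x q"]) auto
    qed
    have 2: "(\<exists>p q r. primeideal p (stalk \<S> x) \<and> primeideal q (stalk \<S> x) \<and> primeideal r (stalk \<S> x) \<and> p \<subset> q \<and> q \<subset> r)
      \<longleftrightarrow> (\<exists>p q r. primeideal p A \<and> primeideal q A \<and> primeideal r A \<and> r \<subseteq> f x \<and> p \<subset> q \<and> q \<subset> r)" (is "?l \<longleftrightarrow> ?r")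
    proof
      assume ?l
      then obtain p q r where "primeideal p (stalk \<S> x)" "primeideal q (stalk \<S> x)" "primeideal r (stalk \<S> x)"
        "p \<subset> q" "q \<subset> r" by blast
      then show ?r using contraction[OF x] contraction_strict_mono[OF x]
        by (intro exI[of _ "?c p"] exI[of _ "?c q"] exI[of _ "?c r"]) simp
    next
      assume ?r
      then obtain p q r where "primeideal p A" "primeideal q A" "primeideal r A" "r \<subseteq> f x" "p \<subset> q" "q \<subset> r" by blast
      then show ?l using extension_prime[OF x] extension_strict_mono[OF x]
        by (intro exI[of _ "extension x p"] exI[of _ "extension x q"] exI[of _ "extension x r"]) auto
    qed
    show ?thesis unfolding krull_dim_eq_1_iff 1 2 ..
  qed
  also have "\<dots> \<longleftrightarrow> f \<eta> \<noteq> f x \<and> (\<forall>r. primeideal r A \<and> r \<subseteq> f x \<longrightarrow> r = f x \<or> r = f \<eta>)"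
  proof (intro iffI conjI)
    assume *: "(\<exists>p q. primeideal p A \<and> primeideal q A \<and> q \<subseteq> f x \<and> p \<subset> q) \<and>
     \<not> (\<exists>p q r. primeideal p A \<and> primeideal q A \<and> primeideal r A \<and> r \<subseteq> f x \<and> p \<subset> q \<and> q \<subset> r)"
    then obtain p q where "primeideal p A" "primeideal q A" "q \<subseteq> f x" "p \<subset> q" by blast
    then show "f \<eta> \<noteq> f x" using f_\<eta>_least[of p] by blast
    show "\<forall>r. primeideal r A \<and> r \<subseteq> f x \<longrightarrow> r = f x \<or> r = f \<eta>"
    proof (intro allI impI)
      fix r assume r: "primeideal r A \<and> r \<subseteq> f x"
      have "\<not> (f \<eta> \<subset> r \<and> r \<subset> f x)" using * f\<eta> fx r by blast
      then show "r = f x \<or> r = f \<eta>" using r f_\<eta>_least[of r] by blast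
    qed
  next
    assume *: "f \<eta> \<noteq> f x \<and> (\<forall>r. primeideal r A \<and> r \<subseteq> f x \<longrightarrow> r = f x \<or> r = f \<eta>)"
    show "\<exists>p q. primeideal p A \<and> primeideal q A \<and> q \<subseteq> f x \<and> p \<subset> q"
      using * f\<eta> fx f_\<eta>_subset[OF x]
      by (intro exI[of _ "f \<eta>"] exI[of _ "f x"]) (simp add: psubset_eq)
    show "\<not> (\<exists>p q r. primeideal p A \<and> primeideal q A \<and> primeideal r A \<and> r \<subseteq> f x \<and> p \<subset> q \<and> q \<subset> r)"
    proof (intro notI, elim exE conjE)
      fix p q r assume pqr: "primeideal p A" "primeideal q A" "primeideal r A" "r \<subseteq> f x" "p \<subset> q" "q \<subset> r"
      then have "q = f x \<or> q = f \<eta>" using * by blast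
      then show False
      proof
        assume "q = f x"
        then show False using pqr(4,6) by (simp add: subset_not_subset_eq)
      next
        assume "q = f \<eta>"
        then show False using pqr(5) f_\<eta>_least[OF pqr(1)] by (simp add: subset_not_subset_eq)
      qed
    qed
  qed
  also have "\<dots> \<longleftrightarrow> K.height_one (f x)"
    unfolding K.height_one_def using fx j0 by (metis (no_types, lifting))
  finally show ?thesis .
qed

end

section \<open>Weil divisors and the local class groups\<close>

lemma (in chart_of_scheme) ord_at_chart: "\<xi> \<in> U \<Longrightarrow> ord_at \<S> \<xi> = K.val (f \<xi>)"
  unfolding ord_at_def by (simp add: local_ring_eq_loc)

text \<open>On U the map f is injective, so the finiteness of the height-one primes with nonzero
  value carries over to points.\<close>

lemma (in chart_of_scheme) ord_at_finite:
  assumes g: "g \<in> Units (function_field \<S>)"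
  shows "finite {\<xi> \<in> codim_one_points \<S> \<inter> U. ord_at \<S> \<xi> g \<noteq> 0}"
proof (rule finite_imageD[of f])
  have "f ` {\<xi> \<in> codim_one_points \<S> \<inter> U. ord_at \<S> \<xi> g \<noteq> 0} \<subseteq> {q. K.height_one q \<and> K.val q g \<noteq> 0}"
    using codim_one_iff ord_at_chart by auto
  then show "finite (f ` {\<xi> \<in> codim_one_points \<S> \<inter> U. ord_at \<S> \<xi> g \<noteq> 0})"
    using K.val_finite[OF g] by (rule finite_subset)
  show "inj_on f {\<xi> \<in> codim_one_points \<S> \<inter> U. ord_at \<S> \<xi> g \<noteq> 0}"
    by (intro inj_onI f_injD) auto
qed

section \<open>The divisor system of the scheme\<close>

context normal_noetherian_scheme
begin

lemma codim_one_points_subset: "codim_one_points \<S> \<subseteq> points \<S>"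
  by (auto simp: codim_one_points_def)

text \<open>Conditions with a base point x are checked in a chart around x, which contains all
  generizations of x; those on a single codimension-one point are checked in a chart around
  it.\<close>

lemma is_divisor_system:
  "divisor_system (function_field \<S>) (points \<S>) (codim_one_points \<S>) (generization \<S>) (local_ring \<S>) (ord_at \<S>)"
proof -
  let ?K = "function_field \<S>" and ?Z = "codim_one_points \<S>"
  have field: "field ?K"
    using chart_of_scheme_exists[OF generic_point(1)] chart_of_scheme.field_K by metis
  show ?thesis
  proof (intro divisor_system.intro divisor_system_axioms.intro field codim_one_points_subset)
    fix x assume "x \<in> points \<S>"
    then obtain U A f \<phi> where x: "x \<in> U" and c: "chart_of_scheme \<S> U A f \<phi>" by (rule chart_of_scheme_exists)
    interpret c: chart_of_scheme \<S> U A f \<phi> by (rule c)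
    show "subring (local_ring \<S> x) ?K"
      using c.K.loc_subring[OF c.f_prime[OF x]] c.local_ring_eq_loc[OF x] by simp
    show "generization \<S> x x" using c.generization_chart[OF x] x by blast
    show "local_ring \<S> x \<subseteq> local_ring \<S> y" if "generization \<S> y x" for y
      using that c.generization_chart[OF x, of y] c.K.loc_mono[of "f y" "f x"] c.local_ring_eq_loc x by auto
    show "finite {\<xi> \<in> ?Z. generization \<S> \<xi> x \<and> ord_at \<S> \<xi> g \<noteq> 0}" if "g \<in> Units ?K" for g
      by (rule finite_subset[OF _ c.ord_at_finite[OF that]]) (use c.generization_chart[OF x] in auto)
    show "g \<in> local_ring \<S> x"
      if g: "g \<in> Units ?K" and ge: "\<And>\<xi>. \<lbrakk>\<xi> \<in> ?Z; generization \<S> \<xi> x\<rbrakk> \<Longrightarrow> 0 \<le> ord_at \<S> \<xi> g" for g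
      unfolding c.local_ring_eq_loc[OF x]
    proof (rule c.K.val_hartogs[OF c.f_prime[OF x] g])
      fix q assume q: "c.K.height_one q" "q \<subseteq> f x"
      then have "primeideal q A" by (simp add: c.K.height_one_def)
      then obtain \<xi> where \<xi>: "\<xi> \<in> U" "f \<xi> = q" using c.prime_point by blast
      then have "\<xi> \<in> ?Z" "generization \<S> \<xi> x"
        using c.codim_one_iff[OF \<xi>(1)] c.generization_chart[OF x] q by auto
      then show "0 \<le> c.K.val q g" using ge[of \<xi>] c.ord_at_chart[OF \<xi>(1)] \<xi>(2) by simp
    qed
    show "\<exists>h\<in>local_ring \<S> x. h \<in> Units ?K \<and> 1 \<le> ord_at \<S> \<xi> h \<and> inv\<^bsub>?K\<^esub> h \<in> local_ring \<S> y"
      if \<xi>: "\<xi> \<in> ?Z" and gen: "generization \<S> \<xi> x" "generization \<S> y x" "\<not> generization \<S> \<xi> y" for \<xi> y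
    proof -
      have \<xi>U: "\<xi> \<in> U" and yU: "y \<in> U" using gen c.generization_chart[OF x] by auto
      have "\<not> f \<xi> \<subseteq> f y" using gen(3) c.generization_chart[OF yU] \<xi>U by blast
      moreover have "c.K.height_one (f \<xi>)" using \<xi> c.codim_one_iff[OF \<xi>U] by blast
      ultimately show ?thesis
        unfolding c.local_ring_eq_loc[OF x] c.local_ring_eq_loc[OF yU] c.ord_at_chart[OF \<xi>U]
        using c.f_prime[OF x] c.f_prime[OF yU] by (intro c.K.val_separation)
    qed
  next
    fix \<xi> assume \<xi>: "\<xi> \<in> ?Z"
    then have "\<xi> \<in> points \<S>" using codim_one_points_subset by blast
    then obtain U A f \<phi> where \<xi>U: "\<xi> \<in> U" and c: "chart_of_scheme \<S> U A f \<phi>" by (rule chart_of_scheme_exists)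
    interpret c: chart_of_scheme \<S> U A f \<phi> by (rule c)
    have h: "c.K.height_one (f \<xi>)" using \<xi> c.codim_one_iff[OF \<xi>U] by blast
    show "ord_at \<S> \<xi> (g \<otimes>\<^bsub>?K\<^esub> k) = ord_at \<S> \<xi> g + ord_at \<S> \<xi> k" if "g \<in> Units ?K" "k \<in> Units ?K" for g k
      unfolding c.ord_at_chart[OF \<xi>U] using c.K.val_mult[OF h that] .
    show "g \<in> local_ring \<S> \<xi> \<longleftrightarrow> 0 \<le> ord_at \<S> \<xi> g" if "g \<in> Units ?K" for g
      unfolding c.ord_at_chart[OF \<xi>U] c.local_ring_eq_loc[OF \<xi>U] using c.K.val_nonneg[OF h that] .
    show "\<exists>\<pi>\<in>Units ?K. ord_at \<S> \<xi> \<pi> = 1"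
      unfolding c.ord_at_chart[OF \<xi>U] using c.K.val_uniformizer[OF h] .
    show "\<zeta> = \<xi>" if \<zeta>: "\<zeta> \<in> ?Z" "generization \<S> \<zeta> \<xi>" for \<zeta>
    proof -
      have \<zeta>U: "\<zeta> \<in> U" "f \<zeta> \<subseteq> f \<xi>" using \<zeta>(2) c.generization_chart[OF \<xi>U] by auto
      have "c.K.height_one (f \<zeta>)" using c.codim_one_iff[OF \<zeta>U(1)] \<zeta>(1) by blast
      then have "f \<zeta> = f \<xi>" using c.K.height_one_incomparable[OF h _ \<zeta>U(2)] by blast
      then show ?thesis by (rule c.f_injD[OF \<zeta>U(1) \<xi>U])
    qed
  next
    show "generization \<S> z x" if "generization \<S> z y" "generization \<S> y x" for x y z
      using that unfolding generization_iff by blast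
  qed
qed

sublocale divisor_system "function_field \<S>" "points \<S>" "codim_one_points \<S>" "generization \<S>" "local_ring \<S>" "ord_at \<S>"
  by (rule is_divisor_system)

lemma divisor_class_at_eq: "divisor_class_at \<S> x D = class_at x (Poly_Mapping.lookup D)"
  unfolding divisor_class_at_def class_at_def local_divisorial_ideal_def div_ideal_def ..

lemma finite_at_lookup: "finite_at x (Poly_Mapping.lookup D)"
proof -
  have "{\<xi> \<in> codim_one_points \<S>. generization \<S> \<xi> x \<and> Poly_Mapping.lookup D \<xi> \<noteq> 0} \<subseteq> Poly_Mapping.keys D"
    by (auto simp: in_keys_iff)
  then show ?thesis unfolding finite_at_def using finite_keys by (rule finite_subset)
qed

section \<open>Cartier divisors and the canonical map\<close>

lemma cartier_iff:
  "D \<in> cartier_divisors \<S> \<longleftrightarrow> D \<in> carrier (weil_divisors \<S>) \<and>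
     (\<forall>x\<in>points \<S>. \<exists>V. \<exists>g\<in>Units (function_field \<S>). opn V \<and> x \<in> V \<and>
       (\<forall>\<xi>\<in>codim_one_points \<S> \<inter> V. Poly_Mapping.lookup D \<xi> = ord_at \<S> \<xi> g))"
  by (simp only: cartier_divisors_def Units_iff_nonzero Bex_def mem_Collect_eq conj_ac)

lemma weil_comm_group: "comm_group (weil_divisors \<S>)"
  unfolding weil_divisors_def by (rule abelian_free_Abelian_group)

lemma weil_simps:
  "D \<otimes>\<^bsub>weil_divisors \<S>\<^esub> E = D + E" "\<one>\<^bsub>weil_divisors \<S>\<^esub> = 0"
  "D \<in> carrier (weil_divisors \<S>) \<Longrightarrow> inv\<^bsub>weil_divisors \<S>\<^esub> D = - D"
  by (simp_all add: weil_divisors_def)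

text \<open>Local equations are inverted and multiplied, for a sum on the intersection of the two
  neighbourhoods.\<close>

lemma cartier_subgroup: "subgroup (cartier_divisors \<S>) (weil_divisors \<S>)"
proof -
  interpret W: comm_group "weil_divisors \<S>" by (rule weil_comm_group)
  show ?thesis
  proof (rule W.subgroupI)
    show "cartier_divisors \<S> \<subseteq> carrier (weil_divisors \<S>)" unfolding cartier_divisors_def by blast
    have "0 \<in> cartier_divisors \<S>" unfolding cartier_iff
    proof (intro conjI ballI)
      show "0 \<in> carrier (weil_divisors \<S>)" using W.one_closed by (simp add: weil_simps)
      fix x assume "x \<in> points \<S>"
      then show "\<exists>V. \<exists>g\<in>Units (function_field \<S>). opn V \<and> x \<in> V \<and>
          (\<forall>\<xi>\<in>codim_one_points \<S> \<inter> V. Poly_Mapping.lookup 0 \<xi> = ord_at \<S> \<xi> g)"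
        by (intro exI[of _ "points \<S>"] bexI[of _ "\<one>\<^bsub>function_field \<S>\<^esub>"]) (auto simp: v_one)
    qed
    then show "cartier_divisors \<S> \<noteq> {}" by blast
  next
    fix D assume D: "D \<in> cartier_divisors \<S>"
    then have DW: "D \<in> carrier (weil_divisors \<S>)" by (simp add: cartier_iff)
    show "inv\<^bsub>weil_divisors \<S>\<^esub> D \<in> cartier_divisors \<S>" unfolding cartier_iff
    proof (intro conjI ballI)
      fix x assume "x \<in> points \<S>"
      then obtain V g where g: "g \<in> Units (function_field \<S>)" "opn V" "x \<in> V"
        "\<forall>\<xi>\<in>codim_one_points \<S> \<inter> V. Poly_Mapping.lookup D \<xi> = ord_at \<S> \<xi> g" using D unfolding cartier_iff by blast
      then show "\<exists>V. \<exists>g\<in>Units (function_field \<S>). opn V \<and> x \<in> V \<and>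
          (\<forall>\<xi>\<in>codim_one_points \<S> \<inter> V. Poly_Mapping.lookup (inv\<^bsub>weil_divisors \<S>\<^esub> D) \<xi> = ord_at \<S> \<xi> g)"
        by (intro exI[of _ V] bexI[of _ "inv\<^bsub>function_field \<S>\<^esub> g"]) (auto simp: v_inv weil_simps DW)
    qed (use DW in simp)
  next
    fix D E assume D: "D \<in> cartier_divisors \<S>" and E: "E \<in> cartier_divisors \<S>"
    show "D \<otimes>\<^bsub>weil_divisors \<S>\<^esub> E \<in> cartier_divisors \<S>" unfolding cartier_iff
    proof (intro conjI ballI)
      show "D \<otimes>\<^bsub>weil_divisors \<S>\<^esub> E \<in> carrier (weil_divisors \<S>)" using D E unfolding cartier_iff by simp
      fix x assume x: "x \<in> points \<S>"
      obtain V g where g: "g \<in> Units (function_field \<S>)" "opn V" "x \<in> V"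
        "\<forall>\<xi>\<in>codim_one_points \<S> \<inter> V. Poly_Mapping.lookup D \<xi> = ord_at \<S> \<xi> g" using D x unfolding cartier_iff by blast
      obtain V' g' where g': "g' \<in> Units (function_field \<S>)" "opn V'" "x \<in> V'"
        "\<forall>\<xi>\<in>codim_one_points \<S> \<inter> V'. Poly_Mapping.lookup E \<xi> = ord_at \<S> \<xi> g'" using E x unfolding cartier_iff by blast
      have "opn (V \<inter> V')" using g g' by blast
      then show "\<exists>V. \<exists>g\<in>Units (function_field \<S>). opn V \<and> x \<in> V \<and>
          (\<forall>\<xi>\<in>codim_one_points \<S> \<inter> V. Poly_Mapping.lookup (D \<otimes>\<^bsub>weil_divisors \<S>\<^esub> E) \<xi> = ord_at \<S> \<xi> g)"
        using g g'
        by (intro exI[of _ "V \<inter> V'"] bexI[of _ "g \<otimes>\<^bsub>function_field \<S>\<^esub> g'"])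
          (auto simp: v_mult weil_simps lookup_add)
    qed
  qed
qed

text \<open>Near x the divisor C is \<open>div g\<close>, and a neighbourhood of x contains every
  generization of x; at x, adding C is therefore a shift by a principal divisor.\<close>

lemma divisor_classes_cartier:
  assumes "C \<in> cartier_divisors \<S>"
  shows "divisor_classes \<S> (C + D) = divisor_classes \<S> D"
  unfolding divisor_classes_def
proof (rule restrict_ext)
  fix x assume x: "x \<in> points \<S>"
  then obtain V g where g: "g \<in> Units (function_field \<S>)" "opn V" "x \<in> V"
    "\<forall>\<xi>\<in>codim_one_points \<S> \<inter> V. Poly_Mapping.lookup C \<xi> = ord_at \<S> \<xi> g"
    using assms unfolding cartier_iff by blast
  show "divisor_class_at \<S> x (C + D) = divisor_class_at \<S> x D"
    unfolding divisor_class_at_eq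
  proof (rule class_at_add_v[OF x finite_at_lookup finite_at_lookup g(1)])
    fix \<xi> assume "\<xi> \<in> codim_one_points \<S>" "generization \<S> \<xi> x"
    then have "\<xi> \<in> codim_one_points \<S> \<inter> V" using g(2,3) by (simp add: generization_iff)
    then show "Poly_Mapping.lookup (C + D) \<xi> = Poly_Mapping.lookup D \<xi> + ord_at \<S> \<xi> g"
      using g(4) by (simp add: lookup_add)
  qed
qed

text \<open>An equality of divisors at the points specializing to \<open>x\<close> spreads out to a neighbourhood of
  \<open>x\<close>, as only finitely many closures of points have to be removed.\<close>

lemma divisor_classes_inject:
  assumes D: "D \<in> carrier (weil_divisors \<S>)" and E: "E \<in> carrier (weil_divisors \<S>)"
    and eq: "divisor_classes \<S> D = divisor_classes \<S> E"
  shows "D - E \<in> cartier_divisors \<S>"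
  unfolding cartier_iff
proof (intro conjI ballI)
  interpret W: comm_group "weil_divisors \<S>" by (rule weil_comm_group)
  have "D \<otimes>\<^bsub>weil_divisors \<S>\<^esub> inv\<^bsub>weil_divisors \<S>\<^esub> E \<in> carrier (weil_divisors \<S>)" using D E by simp
  then show "D - E \<in> carrier (weil_divisors \<S>)" using E by (simp add: weil_simps)
  fix x assume x: "x \<in> points \<S>"
  have "class_at x (Poly_Mapping.lookup D) = class_at x (Poly_Mapping.lookup E)"
    using fun_cong[OF eq, of x] x by (simp add: divisor_classes_def divisor_class_at_eq)
  then obtain g where g: "g \<in> Units (function_field \<S>)"
    "\<forall>\<xi>\<in>codim_one_points \<S>. generization \<S> \<xi> x \<longrightarrow> Poly_Mapping.lookup D \<xi> = Poly_Mapping.lookup E \<xi> + ord_at \<S> \<xi> g"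
    using class_at_eqD[OF x finite_at_lookup finite_at_lookup] by blast
  obtain U A f \<phi> where xU: "x \<in> U" and c: "chart_of_scheme \<S> U A f \<phi>" using x by (rule chart_of_scheme_exists)
  interpret c: chart_of_scheme \<S> U A f \<phi> by (rule c)
  \<comment> \<open>The points of the chart where D and E + div g differ; such a point lies in the
    support of D or of E or is a zero or pole of g, so there are finitely many.\<close>
  let ?F = "{\<xi> \<in> codim_one_points \<S> \<inter> U. Poly_Mapping.lookup D \<xi> \<noteq> Poly_Mapping.lookup E \<xi> + ord_at \<S> \<xi> g}"
  have fin: "finite ?F"
    by (rule finite_subset[OF _ finite_UnI[OF c.ord_at_finite[OF g(1)] finite_UnI[OF finite_keys[of D] finite_keys[of E]]]])
      (auto simp: in_keys_iff)
  let ?V = "U - (\<Union>\<xi>\<in>?F. topo \<S> closure_of {\<xi>})"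
  have "closedin (topo \<S>) (\<Union>\<xi>\<in>?F. topo \<S> closure_of {\<xi>})"
    using fin by (intro closedin_Union) auto
  then have V: "opn ?V" using c.U_open by (rule openin_diff[rotated])
  \<comment> \<open>A point of \<open>?F\<close> with x in its closure would be a generization of x,
    where the two divisors agree.\<close>
  have "x \<notin> topo \<S> closure_of {\<xi>}" if "\<xi> \<in> ?F" for \<xi>
    using that g(2) codim_one_points_subset by (auto simp: generization_def)
  then have xV: "x \<in> ?V" using xU by blast
  have "Poly_Mapping.lookup (D - E) \<xi> = ord_at \<S> \<xi> g" if \<xi>: "\<xi> \<in> codim_one_points \<S> \<inter> ?V" for \<xi>
  proof -
    have "\<xi> \<in> topo \<S> closure_of {\<xi>}" using \<xi> codim_one_points_subset by (auto simp: in_closure_of)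
    then have "\<xi> \<notin> ?F" using \<xi> by blast
    then show ?thesis using \<xi> by (simp add: lookup_minus)
  qed
  then show "\<exists>V. \<exists>g\<in>Units (function_field \<S>). opn V \<and> x \<in> V \<and>
      (\<forall>\<xi>\<in>codim_one_points \<S> \<inter> V. Poly_Mapping.lookup (D - E) \<xi> = ord_at \<S> \<xi> g)"
    using V xV g(1) by (intro exI[of _ ?V] bexI[of _ g]) blast+
qed

text \<open>Compatibility along generizations is \<open>class_at_localize\<close> for one and the
  same divisor at both points.\<close>

lemma divisor_classes_in_limit: "divisor_classes \<S> D \<in> carrier (class_group_limit \<S>)"
proof -
  have "class_group_map \<S> y (class_at x (Poly_Mapping.lookup D)) = class_at y (Poly_Mapping.lookup D)"
    if "x \<in> points \<S>" "y \<in> points \<S>" "generization \<S> y x" for x y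
    unfolding class_group_map_def using class_at_localize[OF that finite_at_lookup] .
  then show ?thesis
    using class_at_carrier[OF _ finite_at_lookup]
    by (simp add: class_group_limit_def divisor_classes_def divisor_class_at_eq local_class_group_def)
qed

lemma divisor_classes_add:
  "divisor_classes \<S> (D + E) = divisor_classes \<S> D \<otimes>\<^bsub>class_group_limit \<S>\<^esub> divisor_classes \<S> E"
proof -
  have "divisor_classes \<S> (D + E) x = (divisor_classes \<S> D \<otimes>\<^bsub>class_group_limit \<S>\<^esub> divisor_classes \<S> E) x" for x
  proof (cases "x \<in> points \<S>")
    case True
    have "Poly_Mapping.lookup (D + E) = (\<lambda>\<xi>. Poly_Mapping.lookup D \<xi> + Poly_Mapping.lookup E \<xi>)"
      by (rule ext) (rule lookup_add)
    then show ?thesis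
      using class_at_mult[OF True finite_at_lookup finite_at_lookup, of D E] True
      by (simp add: class_group_limit_def product_group_def divisor_classes_def divisor_class_at_eq
        local_class_group_def)
  qed (simp add: class_group_limit_def product_group_def divisor_classes_def)
  then show ?thesis by (rule ext)
qed

text \<open>Adding a Cartier divisor leaves all classes unchanged, so the coset has a single image
  for \<open>the_elem\<close> to return.\<close>

lemma canonical_map_coset:
  assumes "D \<in> carrier (weil_divisors \<S>)"
  shows "canonical_map \<S> (cartier_divisors \<S> #>\<^bsub>weil_divisors \<S>\<^esub> D) = divisor_classes \<S> D"
proof -
  have "divisor_classes \<S> ` (cartier_divisors \<S> #>\<^bsub>weil_divisors \<S>\<^esub> D)
      = (\<lambda>C. divisor_classes \<S> (C + D)) ` cartier_divisors \<S>"
    unfolding r_coset_def UN_singleton_image weil_simps image_image ..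
  also have "\<dots> = (\<lambda>C. divisor_classes \<S> D) ` cartier_divisors \<S>"
    by (rule image_cong[OF refl]) (rule divisor_classes_cartier)
  also have "\<dots> = {divisor_classes \<S> D}"
    using subgroup.one_closed[OF cartier_subgroup] by auto
  finally show ?thesis by (simp add: canonical_map_def)
qed

text \<open>Cosets multiply through representatives, which reduces additivity to
  \<open>divisor_classes_add\<close> and injectivity to
  \<open>divisor_classes_inject\<close>.\<close>

lemma canonical_map_mon:
  "canonical_map \<S> \<in> mon (weil_divisors \<S> Mod cartier_divisors \<S>) (class_group_limit \<S>)"
proof -
  let ?W = "weil_divisors \<S>" and ?C = "cartier_divisors \<S>"
  interpret W: comm_group ?W by (rule weil_comm_group)
  interpret N: normal ?C ?W by (rule W.subgroup_imp_normal[OF cartier_subgroup])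
  have cases: "\<exists>D\<in>carrier ?W. Q = ?C #>\<^bsub>?W\<^esub> D" if "Q \<in> carrier (?W Mod ?C)" for Q
    using that by (auto simp: FactGroup_def RCOSETS_def)
  have "canonical_map \<S> \<in> hom (?W Mod ?C) (class_group_limit \<S>)"
  proof (rule homI)
    fix Q assume "Q \<in> carrier (?W Mod ?C)"
    then show "canonical_map \<S> Q \<in> carrier (class_group_limit \<S>)"
      using cases canonical_map_coset divisor_classes_in_limit by metis
  next
    fix Q Q' assume "Q \<in> carrier (?W Mod ?C)" "Q' \<in> carrier (?W Mod ?C)"
    then obtain D E where D: "D \<in> carrier ?W" "Q = ?C #>\<^bsub>?W\<^esub> D" and E: "E \<in> carrier ?W" "Q' = ?C #>\<^bsub>?W\<^esub> E"
      using cases by meson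
    have "Q \<otimes>\<^bsub>?W Mod ?C\<^esub> Q' = ?C #>\<^bsub>?W\<^esub> (D \<otimes>\<^bsub>?W\<^esub> E)"
      using N.rcos_sum[OF D(1) E(1)] D(2) E(2) by (simp add: FactGroup_def)
    then show "canonical_map \<S> (Q \<otimes>\<^bsub>?W Mod ?C\<^esub> Q') = canonical_map \<S> Q \<otimes>\<^bsub>class_group_limit \<S>\<^esub> canonical_map \<S> Q'"
      using canonical_map_coset[OF W.m_closed[OF D(1) E(1)]] canonical_map_coset[OF D(1)] canonical_map_coset[OF E(1)]
        divisor_classes_add[of D E] D(2) E(2) by (simp add: weil_simps)
  qed
  moreover have "inj_on (canonical_map \<S>) (carrier (?W Mod ?C))"
  proof (rule inj_onI)
    fix Q Q' assume "Q \<in> carrier (?W Mod ?C)" "Q' \<in> carrier (?W Mod ?C)" and eq: "canonical_map \<S> Q = canonical_map \<S> Q'"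
    then obtain D E where D: "D \<in> carrier ?W" "Q = ?C #>\<^bsub>?W\<^esub> D" and E: "E \<in> carrier ?W" "Q' = ?C #>\<^bsub>?W\<^esub> E"
      using cases by meson
    have "divisor_classes \<S> D = divisor_classes \<S> E" using eq canonical_map_coset D E by simp
    then have "D - E \<in> ?C" using divisor_classes_inject D(1) E(1) by blast
    then have "(D - E) \<otimes>\<^bsub>?W\<^esub> E \<in> ?C #>\<^bsub>?W\<^esub> E" by (auto simp: r_coset_def)
    then have "D \<in> ?C #>\<^bsub>?W\<^esub> E" by (simp add: weil_simps)
    then show "Q = Q'" using W.repr_independence[OF _ E(1) cartier_subgroup] D(2) E(2) by simp
  qed
  ultimately show ?thesis by (simp add: mon_def)
qed

end

theorem proposition4p1:
  fixes \<S> :: "('p, 'r) ringed_space"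
  assumes "integral_scheme \<S>"
    and "noetherian_scheme \<S>"
    and "normal_scheme \<S>"
  shows "canonical_map \<S>
           \<in> mon (weil_divisors \<S> Mod cartier_divisors \<S>) (class_group_limit \<S>)
         \<and> (\<forall>D\<in>carrier (weil_divisors \<S>).
              canonical_map \<S> (cartier_divisors \<S> #>\<^bsub>weil_divisors \<S>\<^esub> D) = divisor_classes \<S> D)"
proof -
  interpret normal_noetherian_scheme \<S> using assms by unfold_locales
  show ?thesis using canonical_map_mon canonical_map_coset by blast
qed

end
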